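(* Let $0\le t<T$ and $k\ge1$. Let $\phi_\tau\in\tilde H_2(\rho,[t,T])$, let every $\psi_l(\tau)$ $(l=1,\ldots,k)$ be a continuous nonrandom function on the interval $[t,T]$, and suppose that there is a constant $K$ with $|\rho_\tau|\le K<\infty$ with probability 1 for all $\tau\in[t,T]$. For each $l=1,\ldots,k+1$ let either $M^{(l)}_\tau=M_\tau$ or $M^{(l)}_\tau=\tau$ for $\tau\in[t,T]$. Then the stochastic integral $\hat S[\phi,\psi^{(k)}]_{T,t}$ exists and $$S[\phi,\psi^{(k)}]_{T,t}=\hat S[\phi,\psi^{(k)}]_{T,t}\quad\text{with probability }1.$$
   Context: Setting. $(\Omega,\mathrm{F},\mathsf{P})$ is a complete probability space, $\mathsf{M}$ denotes expectation, $\{\mathrm{F}_\tau,\ \tau\in[0,T]\}$ is a nondecreasing family of $\sigma$-algebras in $\mathrm{F}$, and $M_\tau$, $\tau\in[0,T]$, is a martingale with respect to it ($M_\tau$ is $\mathrm{F}_\tau$-measurable and $\mathsf{M}\{|M_\tau|\}<\infty$). It is assumed that there is a stochastic process $\rho_\tau$, $\tau\in[0,T]$, $\mathrm{F}_\tau$-measurable for each $\tau$ and nonnegative with probability 1, such that for $0\le t<s\le T$ $$\mathsf{M}\{(M_s-M_t)^2\,|\,\mathrm{F}_t\}=\mathsf{M}\Big\{\int_t^s\rho_\tau d\tau\,\Big|\,\mathrm{F}_t\Big\}\quad\text{with probability }1.$$ $H_2(\rho,[t,T])$ is the class of processes $\varphi_\tau$, $\tau\in[t,T]$, $\mathrm{F}_\tau$-measurable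 for each $\tau$, with $\mathsf{M}\{\int_t^T\varphi_\tau^2\rho_\tau d\tau\}<\infty$. $\tilde H_2(\rho,[t,T])$ is the class of $\varphi\in H_2(\rho,[t,T])$ that are mean-square continuous on $[t,T]$. For $\varphi\in H_2(\rho,[t,T])$ the integral $\int_t^T\varphi_\tau dM_\tau$ is the mean-square limit of $\sum_j\varphi^{(N)}(\tau_j)(M_{\tau_{j+1}}-M_{\tau_j})$ along partitions of $[t,T]$ with mesh tending to $0$, for any step processes $\varphi^{(N)}\in H_2(\rho,[t,T])$ (constant in time on each $[\tau_j,\tau_{j+1})$) with $\int_t^T\mathsf{M}\{|\varphi^{(N)}_\tau-\varphi_\tau|^2\rho_\tau\}d\tau\to0$. Integrals with respect to $d\tau$ are mean-square integrals with respect to time. Iterated integral. With $\psi^{(k)}=(\psi_1,\ldots,\psi_k)$, $$S[\phi,\psi^{(k)}]_{T,t}=\int_t^T\psi_1(t_1)\ldots\int_t^{t_{k-1}}\psi_k(t_k)\int_t^{t_k}\phi_\tau\,dM^{(k+1)}_\tau\,dM^{(k)}_{t_k}\ldots dM^{(1)}_{t_1}.$$ Reversed-order integrals. All limits $\mathrm{l.i.m.}$ are mean-square limits along partitions $s=\tau_0<\tau_1<\ldots<\tau_N=T$ of the relevant interval $[s,T]$ with mesh tending to $0$ as $N\to\infty$, and $\Delta M^{(i)}_{\tau_l}=M^{(i)}_{\tau_{l+1}}-M^{(i)}_{\tau_l}$. Put $\hat S[\psi^{(0)}]_{T,s}=1$ and, recursively, for $r\ge1$ and $[s,T]\subseteq[t,T]$,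 $$\hat S[\psi^{(r)}]_{T,s}=\underset{N\to\infty}{\mathrm{l.i.m.}}\ \sum_{l=0}^{N-1}\psi_r(\tau_l)\,\Delta M^{(r)}_{\tau_l}\,\hat S[\psi^{(r-1)}]_{T,\tau_{l+1}},$$ where $\psi^{(r)}=(\psi_1,\ldots,\psi_r)$ and $\{\tau_l\}$ partitions $[s,T]$. Then $$\hat S[\phi,\psi^{(k)}]_{T,t}=\int_t^T\phi_s\,dM^{(k+1)}_s\,\hat S[\psi^{(k)}]_{T,s}:=\underset{N\to\infty}{\mathrm{l.i.m.}}\ \sum_{l=0}^{N-1}\phi_{\tau_l}\,\Delta M^{(k+1)}_{\tau_l}\,\hat S[\psi^{(k)}]_{T,\tau_{l+1}},$$ where $\{\tau_l\}$ partitions $[t,T]$. Existence of $\hat S$ means existence of the mean-square limits in this definition. *)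

theory Defs
  imports "HOL-Probability.Probability"
begin

text \<open>A process \<open>\<phi>\<close> is a curried function of time and outcome; only its values at times in the
  interval at hand matter. Joint measurability in time and outcome is what gives the time integrals
  of a process along its paths, and the expectations of these integrals, a meaning.\<close>

definition measurable_process :: "'a measure \<Rightarrow> real \<Rightarrow> real \<Rightarrow> (real \<Rightarrow> 'a \<Rightarrow> real) \<Rightarrow> bool" where
  "measurable_process P a b \<phi> \<longleftrightarrow>
     (\<lambda>(\<tau>, \<omega>). \<phi> \<tau> \<omega>) \<in> borel_measurable (restrict_space borel {a..b} \<Otimes>\<^sub>M P)"

text \<open>The conditional second moments below use \<^const>\<open>nn_cond_exp\<close>, which may take the value
  \<open>\<infinity>\<close>, because a martingale is not assumed to be square integrable. Statements that hold
  with probability 1 are required at each time separately.\<close>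

locale martingale_setting = prob_space P + complete_measure P
  for P :: "'a measure" +
  fixes F :: "real \<Rightarrow> 'a measure" and T :: real
    and M :: "real \<Rightarrow> 'a \<Rightarrow> real" and \<rho> :: "real \<Rightarrow> 'a \<Rightarrow> real"
  assumes subalgebra_F: "\<And>\<tau>. 0 \<le> \<tau> \<Longrightarrow> \<tau> \<le> T \<Longrightarrow> subalgebra P (F \<tau>)"
    and F_mono: "\<And>u s. 0 \<le> u \<Longrightarrow> u \<le> s \<Longrightarrow> s \<le> T \<Longrightarrow> sets (F u) \<subseteq> sets (F s)"
    and M_adapted: "\<And>\<tau>. 0 \<le> \<tau> \<Longrightarrow> \<tau> \<le> T \<Longrightarrow> M \<tau> \<in> borel_measurable (F \<tau>)"
    and M_integrable: "\<And>\<tau>. 0 \<le> \<tau> \<Longrightarrow> \<tau> \<le> T \<Longrightarrow> integrable P (M \<tau>)"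
    and M_martingale: "\<And>u s. 0 \<le> u \<Longrightarrow> u \<le> s \<Longrightarrow> s \<le> T \<Longrightarrow>
          AE \<omega> in P. real_cond_exp P (F u) (M s) \<omega> = M u \<omega>"
    and \<rho>_adapted: "\<And>\<tau>. 0 \<le> \<tau> \<Longrightarrow> \<tau> \<le> T \<Longrightarrow> \<rho> \<tau> \<in> borel_measurable (F \<tau>)"
    and \<rho>_measurable: "measurable_process P 0 T \<rho>"
    and \<rho>_nonneg: "\<And>\<tau>. 0 \<le> \<tau> \<Longrightarrow> \<tau> \<le> T \<Longrightarrow> AE \<omega> in P. 0 \<le> \<rho> \<tau> \<omega>"
    and M_square: "\<And>u s. 0 \<le> u \<Longrightarrow> u < s \<Longrightarrow> s \<le> T \<Longrightarrow>
          AE \<omega> in P. nn_cond_exp P (F u) (\<lambda>\<omega>. ennreal ((M s \<omega> - M u \<omega>)\<^sup>2)) \<omega>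
                   = nn_cond_exp P (F u) (\<lambda>\<omega>. \<integral>\<^sup>+\<tau>\<in>{u..s}. ennreal (\<rho> \<tau> \<omega>) \<partial>lborel) \<omega>"

definition square_integrable :: "'a measure \<Rightarrow> ('a \<Rightarrow> real) \<Rightarrow> bool" where
  "square_integrable P X \<longleftrightarrow> X \<in> borel_measurable P \<and> integrable P (\<lambda>\<omega>. (X \<omega>)\<^sup>2)"

definition ms_tendsto :: "'a measure \<Rightarrow> (nat \<Rightarrow> 'a \<Rightarrow> real) \<Rightarrow> ('a \<Rightarrow> real) \<Rightarrow> bool" where
  "ms_tendsto P Xs X \<longleftrightarrow>
     (\<forall>n. Xs n \<in> borel_measurable P) \<and> square_integrable P X \<and>
     (\<lambda>n. \<integral>\<^sup>+\<omega>. ennreal ((Xs n \<omega> - X \<omega>)\<^sup>2) \<partial>P) \<longlonglongrightarrow> 0"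

definition ms_continuous_on :: "'a measure \<Rightarrow> real set \<Rightarrow> (real \<Rightarrow> 'a \<Rightarrow> real) \<Rightarrow> bool" where
  "ms_continuous_on P I \<phi> \<longleftrightarrow>
     (\<forall>s\<in>I. square_integrable P (\<phi> s)) \<and>
     (\<forall>s\<in>I. ((\<lambda>\<tau>. \<integral>\<omega>. (\<phi> \<tau> \<omega> - \<phi> s \<omega>)\<^sup>2 \<partial>P) \<longlongrightarrow> 0) (at s within I))"

text \<open>A partition is the list of its nodes \<open>\<tau>\<^sub>0 < \<dots> < \<tau>\<^sub>N\<close>. The only partition of a
  degenerate interval is the one with the single node \<open>\<tau>\<^sub>0\<close>; sums over it are empty.\<close>

definition partition_on_interval :: "real \<Rightarrow> real \<Rightarrow> real list \<Rightarrow> bool" where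
  "partition_on_interval a b p \<longleftrightarrow> p \<noteq> [] \<and> hd p = a \<and> last p = b \<and> sorted_wrt (<) p"

definition mesh :: "real list \<Rightarrow> real" where
  "mesh p = Max (insert 0 ((\<lambda>i. p ! Suc i - p ! i) ` {..<length p - 1}))"

definition partition_seq :: "real \<Rightarrow> real \<Rightarrow> (nat \<Rightarrow> real list) \<Rightarrow> bool" where
  "partition_seq a b p \<longleftrightarrow>
     (\<forall>n. partition_on_interval a b (p n)) \<and> (\<lambda>n. mesh (p n)) \<longlonglongrightarrow> 0"

definition ms_partition_limit ::
  "'a measure \<Rightarrow> real \<Rightarrow> real \<Rightarrow> (real list \<Rightarrow> 'a \<Rightarrow> real) \<Rightarrow> ('a \<Rightarrow> real) \<Rightarrow> bool" where
  "ms_partition_limit P a b S X \<longleftrightarrow>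
     (\<forall>p. partition_seq a b p \<longrightarrow> ms_tendsto P (\<lambda>n. S (p n)) X)"

definition H2 :: "'a measure \<Rightarrow> (real \<Rightarrow> 'a measure) \<Rightarrow> (real \<Rightarrow> 'a \<Rightarrow> real) \<Rightarrow> real \<Rightarrow> real
    \<Rightarrow> (real \<Rightarrow> 'a \<Rightarrow> real) set" where
  "H2 P F \<rho> a b = {\<phi>. measurable_process P a b \<phi> \<and>
     (\<forall>\<tau>\<in>{a..b}. \<phi> \<tau> \<in> borel_measurable (F \<tau>)) \<and>
     (\<integral>\<^sup>+\<omega>. (\<integral>\<^sup>+\<tau>\<in>{a..b}. ennreal ((\<phi> \<tau> \<omega>)\<^sup>2 * \<rho> \<tau> \<omega>) \<partial>lborel) \<partial>P) < \<infinity>}"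

definition H2_ms :: "'a measure \<Rightarrow> (real \<Rightarrow> 'a measure) \<Rightarrow> (real \<Rightarrow> 'a \<Rightarrow> real) \<Rightarrow> real \<Rightarrow> real
    \<Rightarrow> (real \<Rightarrow> 'a \<Rightarrow> real) set" where
  "H2_ms P F \<rho> a b = {\<phi> \<in> H2 P F \<rho> a b. ms_continuous_on P {a..b} \<phi>}"

definition step_on :: "real list \<Rightarrow> (real \<Rightarrow> 'a \<Rightarrow> real) \<Rightarrow> bool" where
  "step_on p \<phi> \<longleftrightarrow> (\<forall>i<length p - 1. \<forall>\<tau>\<in>{p ! i..<p ! Suc i}. \<phi> \<tau> = \<phi> (p ! i))"

definition step_approximation :: "'a measure \<Rightarrow> (real \<Rightarrow> 'a measure) \<Rightarrow> (real \<Rightarrow> 'a \<Rightarrow> real)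
    \<Rightarrow> real \<Rightarrow> real \<Rightarrow> (real \<Rightarrow> 'a \<Rightarrow> real) \<Rightarrow> (nat \<Rightarrow> real list) \<Rightarrow> (nat \<Rightarrow> real \<Rightarrow> 'a \<Rightarrow> real) \<Rightarrow> bool" where
  "step_approximation P F \<rho> a b \<phi> p \<phi>s \<longleftrightarrow>
     partition_seq a b p \<and>
     (\<forall>n. \<phi>s n \<in> H2 P F \<rho> a b \<and> step_on (p n) (\<phi>s n)) \<and>
     (\<lambda>n. \<integral>\<^sup>+\<tau>\<in>{a..b}. (\<integral>\<^sup>+\<omega>. ennreal (\<bar>\<phi>s n \<tau> \<omega> - \<phi> \<tau> \<omega>\<bar>\<^sup>2 * \<rho> \<tau> \<omega>) \<partial>P) \<partial>lborel) \<longlonglongrightarrow> 0"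

text \<open>Integrals are determined only up to null sets, so they are rendered as relations:
  \<open>X\<close> is a version of the integral of \<open>\<phi>\<close> over \<open>[a,b]\<close>.\<close>

definition martingale_integral :: "'a measure \<Rightarrow> (real \<Rightarrow> 'a measure) \<Rightarrow> (real \<Rightarrow> 'a \<Rightarrow> real)
    \<Rightarrow> (real \<Rightarrow> 'a \<Rightarrow> real) \<Rightarrow> (real \<Rightarrow> 'a \<Rightarrow> real) \<Rightarrow> real \<Rightarrow> real \<Rightarrow> ('a \<Rightarrow> real) \<Rightarrow> bool" where
  "martingale_integral P F M \<rho> \<phi> a b X \<longleftrightarrow>
     \<phi> \<in> H2 P F \<rho> a b \<and>
     (\<exists>p \<phi>s. step_approximation P F \<rho> a b \<phi> p \<phi>s) \<and>
     (\<forall>p \<phi>s. step_approximation P F \<rho> a b \<phi> p \<phi>s \<longrightarrow>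
        ms_tendsto P (\<lambda>n \<omega>. \<Sum>j<length (p n) - 1.
          \<phi>s n (p n ! j) \<omega> * (M (p n ! Suc j) \<omega> - M (p n ! j) \<omega>)) X)"

text \<open>The mean-square Riemann integral with respect to time, with arbitrary intermediate
  points \<open>\<xi>\<close>.\<close>

definition time_integral :: "'a measure \<Rightarrow> (real \<Rightarrow> 'a \<Rightarrow> real) \<Rightarrow> real \<Rightarrow> real \<Rightarrow> ('a \<Rightarrow> real) \<Rightarrow> bool" where
  "time_integral P \<phi> a b X \<longleftrightarrow>
     (\<forall>p \<xi>. partition_seq a b p \<and>
        (\<forall>n. \<forall>j<length (p n) - 1. \<xi> n j \<in> {p n ! j..p n ! Suc j}) \<longrightarrow>
        ms_tendsto P (\<lambda>n \<omega>. \<Sum>j<length (p n) - 1.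
          \<phi> (\<xi> n j) \<omega> * (p n ! Suc j - p n ! j)) X)"

datatype integrator = Martingale | Time

fun integrator_process :: "(real \<Rightarrow> 'a \<Rightarrow> real) \<Rightarrow> integrator \<Rightarrow> real \<Rightarrow> 'a \<Rightarrow> real" where
  "integrator_process M Martingale = M"
| "integrator_process M Time = (\<lambda>\<tau> \<omega>. \<tau>)"

fun stoch_integral :: "'a measure \<Rightarrow> (real \<Rightarrow> 'a measure) \<Rightarrow> (real \<Rightarrow> 'a \<Rightarrow> real)
    \<Rightarrow> (real \<Rightarrow> 'a \<Rightarrow> real) \<Rightarrow> integrator \<Rightarrow> (real \<Rightarrow> 'a \<Rightarrow> real) \<Rightarrow> real \<Rightarrow> real \<Rightarrow> ('a \<Rightarrow> real) \<Rightarrow> bool" where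
  "stoch_integral P F M \<rho> Martingale \<phi> a b X = martingale_integral P F M \<rho> \<phi> a b X"
| "stoch_integral P F M \<rho> Time \<phi> a b X = time_integral P \<phi> a b X"

text \<open>\<open>X\<close> is a version of \<open>S[\<phi>, \<psi>\<^sub>1, \<dots>, \<psi>\<^sub>k]\<^sub>T\<^sub>,\<^sub>t\<close>, where \<open>c l\<close> selects the
  integrator of the \<open>l\<close>-th integral. The process \<open>I (k+1)\<close> is the innermost integral, and
  \<open>I l\<close> is the integral of \<open>\<psi>\<^sub>l\<close> times \<open>I (l+1)\<close>, all as functions of the upper limit.\<close>

definition iterated_integral :: "'a measure \<Rightarrow> (real \<Rightarrow> 'a measure) \<Rightarrow> (real \<Rightarrow> 'a \<Rightarrow> real)
    \<Rightarrow> (real \<Rightarrow> 'a \<Rightarrow> real) \<Rightarrow> real \<Rightarrow> real \<Rightarrow> nat \<Rightarrow> (nat \<Rightarrow> integrator)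
    \<Rightarrow> (real \<Rightarrow> 'a \<Rightarrow> real) \<Rightarrow> (nat \<Rightarrow> real \<Rightarrow> real) \<Rightarrow> ('a \<Rightarrow> real) \<Rightarrow> bool" where
  "iterated_integral P F M \<rho> t T k c \<phi> \<psi> X \<longleftrightarrow>
     (\<exists>I. (\<forall>s\<in>{t..T}. stoch_integral P F M \<rho> (c (k + 1)) \<phi> t s (I (k + 1) s)) \<and>
          (\<forall>l\<in>{1..k}. \<forall>s\<in>{t..T}.
             stoch_integral P F M \<rho> (c l) (\<lambda>\<tau> \<omega>. \<psi> l \<tau> * I (l + 1) \<tau> \<omega>) t s (I l s)) \<and>
          X = I 1 T)"

text \<open>\<open>X\<close> is a version of the integral taken in the reversed order; \<open>R r s\<close> is the
  multiple integral of \<open>\<psi>\<^sub>1, \<dots>, \<psi>\<^sub>r\<close> over \<open>[s,T]\<close>.\<close>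

definition reversed_integral :: "'a measure \<Rightarrow> (real \<Rightarrow> 'a \<Rightarrow> real)
    \<Rightarrow> real \<Rightarrow> real \<Rightarrow> nat \<Rightarrow> (nat \<Rightarrow> integrator)
    \<Rightarrow> (real \<Rightarrow> 'a \<Rightarrow> real) \<Rightarrow> (nat \<Rightarrow> real \<Rightarrow> real) \<Rightarrow> ('a \<Rightarrow> real) \<Rightarrow> bool" where
  "reversed_integral P M t T k c \<phi> \<psi> X \<longleftrightarrow>
     (\<exists>R. (\<forall>s\<in>{t..T}. R 0 s = (\<lambda>\<omega>. 1)) \<and>
          (\<forall>r\<in>{1..k}. \<forall>s\<in>{t..T}.
             ms_partition_limit P s T (\<lambda>p \<omega>. \<Sum>l<length p - 1.
               \<psi> r (p ! l) *
               (integrator_process M (c r) (p ! Suc l) \<omega> - integrator_process M (c r) (p ! l) \<omega>) *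
               R (r - 1) (p ! Suc l) \<omega>) (R r s)) \<and>
          ms_partition_limit P t T (\<lambda>p \<omega>. \<Sum>l<length p - 1.
            \<phi> (p ! l) \<omega> *
            (integrator_process M (c (k + 1)) (p ! Suc l) \<omega>
               - integrator_process M (c (k + 1)) (p ! l) \<omega>) *
            R k (p ! Suc l) \<omega>) X)"

end

theory Submission
  imports Defs
begin

text \<open>Both integrals are limits of finite sums, compared through the bound
  \<open>M{(\<Sum> \<xi>\<^sub>j \<Delta>Z\<^sub>j)\<^sup>2} \<le> C \<integral> M{\<xi>\<^sub>\<tau>\<^sup>2} d\<tau>\<close> for adapted simple processes \<open>\<xi>\<close>, which holds for \<open>Z = M\<close> by
  orthogonality of the increments and for \<open>Z = \<tau>\<close> by the Cauchy-Schwarz inequality. The sums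
  defining the reversed integral have anticipating, non-orthogonal terms, so they are not
  estimated directly. Put \<open>\<xi>\<^sub>l = \<phi>\<^bsub>\<tau>\<^sub>l\<^esub> \<Delta>M\<^bsub>\<tau>\<^sub>l\<^esub>\<close>. This factor is known at time \<open>\<tau>\<^sub>l\<^sub>+\<^sub>1\<close>, so it can be
  pulled out of the outer integrals, and \<open>\<Sum> \<xi>\<^sub>l S[\<psi>]\<^bsub>T,\<tau>\<^sub>l\<^sub>+\<^sub>1\<^esub>\<close> is exactly the forward iterated integral
  of \<open>\<psi>\<^sub>1, \<dots>, \<psi>\<^sub>k\<close> applied to the jump process \<open>\<Sum> \<xi>\<^sub>l 1\<^bsub>[\<tau>\<^sub>l\<^sub>+\<^sub>1,T]\<^esub>\<close>. That process converges in mean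
  square, boundedly and at every time, to \<open>\<integral> \<phi> dM\<close>, and forward integration is continuous for
  this convergence. The same argument with \<open>\<psi>\<^sub>r\<close> in place of \<open>\<phi>\<close> identifies the inner reversed
  integrals.\<close>

section \<open>Mean-square convergence\<close>

text \<open>Three gaps shape the proof. Iterated integrands are limits known only up to null sets at
  each time, while the class \<open>H2\<close> asks for joint measurability and adaptedness. The
  sigma-algebras \<open>F\<close> need not contain the null sets, so limits that have to be adapted
  are taken as pointwise limits of adapted variables along a subsequence. Next, the jump process has
  finitely many discontinuities, so the integration theory is set up for mean-square bounded
  processes that are mean-square continuous off a finite set (\<open>regular\<close>). Finally, the
  martingale integral of the statement tests step processes in the norm weighted by \<rho>, while
  iteration and the treatment of both integrators at once call for the norm of d\<tau>. The bound on
  \<rho> compares these norms in one direction only, so integrals are built in the norm of d\<tau>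
  and matched with the definition of the statement afterwards. A bound on second moments at every
  time, rather than a finite integrated norm, is carried along because it supplies the dominating
  constant when jump processes converge time by time.\<close>

definition msq :: "'a measure \<Rightarrow> ('a \<Rightarrow> real) \<Rightarrow> ennreal" where
  "msq P X = (\<integral>\<^sup>+\<omega>. ennreal ((X \<omega>)\<^sup>2) \<partial>P)"

abbreviation msd :: "'a measure \<Rightarrow> ('a \<Rightarrow> real) \<Rightarrow> ('a \<Rightarrow> real) \<Rightarrow> ennreal" where
  "msd P X Y \<equiv> msq P (\<lambda>\<omega>. X \<omega> - Y \<omega>)"

lemma msq_cong_AE: "AE \<omega> in P. X \<omega> = Y \<omega> \<Longrightarrow> msq P X = msq P Y"
  unfolding msq_def by (rule nn_integral_cong_AE) (auto elim: AE_mp)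

lemma msq_zero [simp]: "msq P (\<lambda>\<omega>. 0) = 0"
  by (simp add: msq_def)

lemma msq_minus_commute: "msd P X Y = msd P Y X"
  by (simp add: msq_def power2_commute)

text \<open>The factor 2 replaces the triangle inequality of the L2 norm and avoids square roots.
  Only finiteness and convergence to 0 are extracted from it, so accumulating constants do no
  harm.\<close>

lemma msq_add_le:
  assumes [measurable]: "X \<in> borel_measurable P" "Y \<in> borel_measurable P"
  shows "msq P (\<lambda>\<omega>. X \<omega> + Y \<omega>) \<le> 2 * msq P X + 2 * msq P Y"
proof -
  have *: "(x + y)\<^sup>2 \<le> 2 * x\<^sup>2 + 2 * y\<^sup>2" for x y :: real
    using zero_le_power2[of "x - y"] by (simp add: power2_eq_square algebra_simps)
  have "msq P (\<lambda>\<omega>. X \<omega> + Y \<omega>) \<le> (\<integral>\<^sup>+\<omega>. 2 * ennreal ((X \<omega>)\<^sup>2) + 2 * ennreal ((Y \<omega>)\<^sup>2) \<partial>P)"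
    unfolding msq_def
  proof (rule nn_integral_mono)
    fix \<omega>
    have "ennreal ((X \<omega> + Y \<omega>)\<^sup>2) \<le> ennreal (2 * (X \<omega>)\<^sup>2 + 2 * (Y \<omega>)\<^sup>2)"
      by (rule ennreal_leI) (rule *)
    also have "\<dots> = 2 * ennreal ((X \<omega>)\<^sup>2) + 2 * ennreal ((Y \<omega>)\<^sup>2)"
      by (simp add: ennreal_mult)
    finally show "ennreal ((X \<omega> + Y \<omega>)\<^sup>2) \<le> 2 * ennreal ((X \<omega>)\<^sup>2) + 2 * ennreal ((Y \<omega>)\<^sup>2)" .
  qed
  also have "\<dots> = 2 * msq P X + 2 * msq P Y"
    unfolding msq_def by (simp add: nn_integral_add nn_integral_cmult)
  finally show ?thesis .
qed

lemma msq_uminus [simp]: "msq P (\<lambda>\<omega>. - X \<omega>) = msq P X"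
  by (simp add: msq_def)

lemma msq_diff_le:
  assumes "X \<in> borel_measurable P" "Y \<in> borel_measurable P"
  shows "msd P X Y \<le> 2 * msq P X + 2 * msq P Y"
  using msq_add_le[of X P "\<lambda>\<omega>. - Y \<omega>"] assms by simp

lemma msq_triangle:
  assumes "X \<in> borel_measurable P" "Y \<in> borel_measurable P" "Z \<in> borel_measurable P"
  shows "msd P X Z \<le> 2 * msd P X Y + 2 * msd P Y Z"
  using msq_add_le[of "\<lambda>\<omega>. X \<omega> - Y \<omega>" P "\<lambda>\<omega>. Y \<omega> - Z \<omega>"] assms by simp

lemma msq_cmult: "X \<in> borel_measurable P \<Longrightarrow> msq P (\<lambda>\<omega>. a * X \<omega>) = ennreal (a\<^sup>2) * msq P X"
  unfolding msq_def by (simp add: power_mult_distrib ennreal_mult nn_integral_cmult)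

lemma msq_eq_0D:
  assumes [measurable]: "X \<in> borel_measurable P" and "msq P X = 0"
  shows "AE \<omega> in P. X \<omega> = 0"
  using assms(2) unfolding msq_def by (subst (asm) nn_integral_0_iff_AE) auto

lemma square_integrable_iff_msq:
  "square_integrable P X \<longleftrightarrow> X \<in> borel_measurable P \<and> msq P X < \<infinity>"
  unfolding square_integrable_def msq_def by (auto simp: integrable_iff_bounded)

lemma msq_eq_integral: "square_integrable P X \<Longrightarrow> msq P X = ennreal (\<integral>\<omega>. (X \<omega>)\<^sup>2 \<partial>P)"
  unfolding msq_def square_integrable_def by (rule nn_integral_eq_integral) auto

lemma square_integrable_diff:
  assumes "square_integrable P X" "square_integrable P Y"
  shows "square_integrable P (\<lambda>\<omega>. X \<omega> - Y \<omega>)"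
  using assms msq_diff_le[of X P Y]
  by (auto simp: square_integrable_iff_msq ennreal_mult_less_top elim: order.strict_trans1)

lemma square_integrable_mult:
  assumes "square_integrable P X" "square_integrable P Y"
  shows "integrable P (\<lambda>\<omega>. X \<omega> * Y \<omega>)"
proof (rule Bochner_Integration.integrable_bound)
  show "integrable P (\<lambda>\<omega>. (X \<omega>)\<^sup>2 + (Y \<omega>)\<^sup>2)"
    using assms by (auto simp: square_integrable_def)
  show "AE \<omega> in P. norm (X \<omega> * Y \<omega>) \<le> norm ((X \<omega>)\<^sup>2 + (Y \<omega>)\<^sup>2)"
  proof (intro AE_I2)
    fix \<omega>
    have "2 * (\<bar>X \<omega>\<bar> * \<bar>Y \<omega>\<bar>) \<le> (X \<omega>)\<^sup>2 + (Y \<omega>)\<^sup>2"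
      using zero_le_power2[of "\<bar>X \<omega>\<bar> - \<bar>Y \<omega>\<bar>"] by (simp add: power2_diff)
    moreover have "0 \<le> \<bar>X \<omega>\<bar> * \<bar>Y \<omega>\<bar>" by simp
    ultimately have "\<bar>X \<omega>\<bar> * \<bar>Y \<omega>\<bar> \<le> (X \<omega>)\<^sup>2 + (Y \<omega>)\<^sup>2" by linarith
    then show "norm (X \<omega> * Y \<omega>) \<le> norm ((X \<omega>)\<^sup>2 + (Y \<omega>)\<^sup>2)" by (simp add: abs_mult)
  qed
  show "(\<lambda>\<omega>. X \<omega> * Y \<omega>) \<in> borel_measurable P"
    using assms by (auto simp: square_integrable_def)
qed

lemma ennreal_tendsto_0_le:
  fixes f g :: "'b \<Rightarrow> ennreal"
  assumes "(g \<longlongrightarrow> 0) F" "\<And>n. f n \<le> g n"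
  shows "(f \<longlongrightarrow> 0) F"
  by (rule tendsto_sandwich[OF _ _ tendsto_const assms(1)]) (auto simp: assms(2))

lemma ennreal_tendsto_0_lincomb:
  fixes f g :: "'b \<Rightarrow> ennreal"
  assumes "(f \<longlongrightarrow> 0) F" "(g \<longlongrightarrow> 0) F" "a < \<infinity>" "b < \<infinity>"
  shows "((\<lambda>n. a * f n + b * g n) \<longlongrightarrow> 0) F"
proof -
  have "((\<lambda>n. a * f n + b * g n) \<longlongrightarrow> a * 0 + b * 0) F"
    using assms by (intro tendsto_add ennreal_tendsto_cmult) auto
  then show ?thesis by simp
qed

lemma ennreal_tendsto_0_iff_real:
  fixes f :: "'b \<Rightarrow> ennreal"
  shows "(f \<longlongrightarrow> 0) F \<longleftrightarrow> (\<forall>e>0. eventually (\<lambda>x. f x < ennreal e) F)"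
proof
  assume "(f \<longlongrightarrow> 0) F"
  then show "\<forall>e>0. eventually (\<lambda>x. f x < ennreal e) F"
    by (auto intro: order_tendstoD)
next
  assume *: "\<forall>e>0. eventually (\<lambda>x. f x < ennreal e) F"
  show "(f \<longlongrightarrow> 0) F"
  proof (rule order_tendstoI)
    fix a :: ennreal assume "0 < a"
    then obtain b where b: "0 < b" "b < a" using dense by blast
    then obtain e where "b = ennreal e" "0 \<le> e"
      by (cases b) (auto simp: less_top[symmetric])
    with b have "0 < e" "ennreal e < a" by auto
    then have "eventually (\<lambda>x. f x < ennreal e) F" using * by blast
    then show "eventually (\<lambda>x. f x < a) F"
      by (rule eventually_mono) (rule less_trans[OF _ \<open>ennreal e < a\<close>])
  qed simp
qed

section \<open>Almost sure convergence along subsequences and completeness of L2\<close>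

lemma AE_LIMSEQ_of_summable_msq:
  assumes [measurable]: "\<And>n. Y n \<in> borel_measurable P" and "(\<Sum>n. msq P (Y n)) < \<infinity>"
  shows "AE \<omega> in P. (\<lambda>n. Y n \<omega>) \<longlonglongrightarrow> 0"
proof -
  have "(\<integral>\<^sup>+\<omega>. (\<Sum>n. ennreal ((Y n \<omega>)\<^sup>2)) \<partial>P) = (\<Sum>n. msq P (Y n))"
    unfolding msq_def by (rule nn_integral_suminf) simp
  then have "AE \<omega> in P. (\<Sum>n. ennreal ((Y n \<omega>)\<^sup>2)) \<noteq> \<infinity>"
    using assms(2) by (intro nn_integral_PInf_AE) auto
  then show ?thesis
  proof eventually_elim
    case (elim \<omega>)
    then have "summable (\<lambda>n. (Y n \<omega>)\<^sup>2)"
      by (intro summable_suminf_not_top) auto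
    then have "(\<lambda>n. (Y n \<omega>)\<^sup>2) \<longlonglongrightarrow> 0" by (rule summable_LIMSEQ_zero)
    then have "(\<lambda>n. sqrt ((Y n \<omega>)\<^sup>2)) \<longlonglongrightarrow> sqrt 0" by (rule tendsto_real_sqrt)
    then show ?case by (auto intro: tendsto_rabs_zero_cancel)
  qed
qed

lemma suminf_half_finite: "(\<Sum>n. ennreal ((1/2)^n)) < \<infinity>"
proof -
  have "summable (\<lambda>n. (1/2::real)^n)" by (rule summable_geometric) simp
  then have "(\<Sum>n. ennreal ((1/2)^n)) = ennreal (\<Sum>n. (1/2)^n)"
    by (rule suminf_ennreal2[rotated]) simp
  then show ?thesis by (simp only: infinity_ennreal_def ennreal_less_top)
qed

lemma AE_LIMSEQ_of_msq_le:
  assumes "\<And>n. Y n \<in> borel_measurable P" and "\<And>n. msq P (Y n) \<le> ennreal ((1/2)^n)"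
  shows "AE \<omega> in P. (\<lambda>n. Y n \<omega>) \<longlonglongrightarrow> 0"
  using assms(1)
proof (rule AE_LIMSEQ_of_summable_msq)
  show "(\<Sum>n. msq P (Y n)) < \<infinity>"
    using suminf_half_finite suminf_le[of "\<lambda>n. msq P (Y n)" "\<lambda>n. ennreal ((1/2)^n)"] assms(2)
    by (auto elim: order.strict_trans1)
qed

text \<open>The property may change with \<open>n\<close>, so that one strictly increasing choice
  can meet the n-th tolerance at its n-th place.\<close>

lemma subseq_of_eventually:
  assumes "\<And>n. eventually (Q n) sequentially"
  shows "\<exists>r::nat\<Rightarrow>nat. strict_mono r \<and> (\<forall>n. Q n (r n))"
proof -
  have "\<exists>r. \<forall>n. Q n (r n) \<and> r n < r (Suc n)"
  proof (rule dependent_nat_choice)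
    show "\<exists>x. Q 0 x" using assms[of 0] by (auto simp: eventually_sequentially)
    fix x n
    have "eventually (\<lambda>y. Q (Suc n) y \<and> x < y) sequentially"
      using assms eventually_gt_at_top by (rule eventually_conj)
    then show "\<exists>y. Q (Suc n) y \<and> x < y" by (auto simp: eventually_sequentially)
  qed
  then show ?thesis by (auto simp: strict_mono_Suc_iff)
qed

lemma msq_tendsto_subseq_AE:
  assumes [measurable]: "\<And>n. X n \<in> borel_measurable P" "Y \<in> borel_measurable P"
    and lim: "(\<lambda>n. msd P (X n) Y) \<longlonglongrightarrow> 0"
  shows "\<exists>r::nat\<Rightarrow>nat. strict_mono r \<and> (AE \<omega> in P. (\<lambda>n. X (r n) \<omega>) \<longlonglongrightarrow> Y \<omega>)"
proof -
  have "eventually (\<lambda>m. msd P (X m) Y < ennreal ((1/2)^n)) sequentially" for n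
    using lim unfolding ennreal_tendsto_0_iff_real by simp
  then obtain r :: "nat \<Rightarrow> nat" where r: "strict_mono r"
      "\<And>n. msd P (X (r n)) Y < ennreal ((1/2)^n)"
    using subseq_of_eventually[of "\<lambda>n m. msd P (X m) Y < ennreal ((1/2)^n)"] by auto
  have "AE \<omega> in P. (\<lambda>n. X (r n) \<omega> - Y \<omega>) \<longlonglongrightarrow> 0"
    by (rule AE_LIMSEQ_of_msq_le) (auto intro: less_imp_le[OF r(2)])
  then have "AE \<omega> in P. (\<lambda>n. X (r n) \<omega>) \<longlonglongrightarrow> Y \<omega>"
    by eventually_elim (simp add: LIM_zero_iff)
  with r(1) show ?thesis by auto
qed

lemma msq_tendsto_unique:
  assumes [measurable]: "\<And>n. X n \<in> borel_measurable P" "Y \<in> borel_measurable P" "Z \<in> borel_measurable P"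
    and "(\<lambda>n. msd P (X n) Y) \<longlonglongrightarrow> 0" "(\<lambda>n. msd P (X n) Z) \<longlonglongrightarrow> 0"
  shows "AE \<omega> in P. Y \<omega> = Z \<omega>"
proof -
  have "msd P Y Z \<le> 2 * msd P (X n) Y + 2 * msd P (X n) Z" for n
    using msq_triangle[of Y P "X n" Z] by (simp add: msq_minus_commute[of P Y])
  then have "(\<lambda>n::nat. msd P Y Z) \<longlonglongrightarrow> 0"
    by (intro ennreal_tendsto_0_le[OF ennreal_tendsto_0_lincomb[OF assms(4,5)]]) auto
  then have "msd P Y Z = 0" by (simp add: LIMSEQ_const_iff)
  then have "AE \<omega> in P. Y \<omega> - Z \<omega> = 0" by (intro msq_eq_0D) auto
  then show ?thesis by eventually_elim simp
qed

text \<open>Fatou's lemma for squares; it carries a Cauchy bound over to an almost sure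
  limit.\<close>

lemma msq_LIMSEQ_le:
  assumes [measurable]: "\<And>n. X n \<in> borel_measurable P" "Y \<in> borel_measurable P"
    and lim: "AE \<omega> in P. (\<lambda>n. X n \<omega>) \<longlonglongrightarrow> Y \<omega>"
    and "eventually (\<lambda>n. msq P (X n) \<le> B) sequentially"
  shows "msq P Y \<le> B"
proof -
  have "msq P Y = (\<integral>\<^sup>+\<omega>. liminf (\<lambda>n. ennreal ((X n \<omega>)\<^sup>2)) \<partial>P)"
    unfolding msq_def
  proof (rule nn_integral_cong_AE)
    show "AE \<omega> in P. ennreal ((Y \<omega>)\<^sup>2) = liminf (\<lambda>n. ennreal ((X n \<omega>)\<^sup>2))"
      using lim
    proof eventually_elim
      case (elim \<omega>)
      then have "(\<lambda>n. ennreal ((X n \<omega>)\<^sup>2)) \<longlonglongrightarrow> ennreal ((Y \<omega>)\<^sup>2)"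
        by (intro tendsto_ennrealI tendsto_power)
      then show ?case by (rule lim_imp_Liminf[OF sequentially_bot, symmetric])
    qed
  qed
  also have "\<dots> \<le> liminf (\<lambda>n. msq P (X n))"
    unfolding msq_def by (rule nn_integral_liminf) simp
  also have "\<dots> \<le> B"
    by (rule Liminf_le) (use assms(4) in auto)
  finally show ?thesis .
qed

text \<open>The weight \<open>2^n\<close> still leaves a summable series \<open>(1/2)^n\<close> of
  second moments, and it makes the increments themselves absolutely summable almost surely, which
  their squares alone would not give.\<close>

lemma AE_convergent_of_msq_increments:
  fixes X :: "nat \<Rightarrow> 'a \<Rightarrow> real"
  assumes P: "prob_space P" and [measurable]: "\<And>n. X n \<in> borel_measurable P"
    and "\<And>n. msd P (X (Suc n)) (X n) \<le> ennreal ((1/4)^n)"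
  shows "AE \<omega> in P. convergent (\<lambda>n. X n \<omega>)"
proof -
  have "(\<Sum>n. \<integral>\<^sup>+\<omega>. ennreal (2^n * (X (Suc n) \<omega> - X n \<omega>)\<^sup>2) \<partial>P) \<le> (\<Sum>n. ennreal ((1/2)^n))"
  proof (rule suminf_le)
    fix n
    have "(\<integral>\<^sup>+\<omega>. ennreal (2^n * (X (Suc n) \<omega> - X n \<omega>)\<^sup>2) \<partial>P)
        = ennreal (2^n) * msd P (X (Suc n)) (X n)"
      unfolding msq_def by (simp add: ennreal_mult nn_integral_cmult)
    also have "\<dots> \<le> ennreal (2^n) * ennreal ((1/4)^n)"
      by (intro mult_left_mono assms) simp
    also have "\<dots> = ennreal ((1/2)^n)"
      by (simp flip: ennreal_mult power_mult_distrib)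
    finally show "(\<integral>\<^sup>+\<omega>. ennreal (2^n * (X (Suc n) \<omega> - X n \<omega>)\<^sup>2) \<partial>P) \<le> ennreal ((1/2)^n)" .
  qed simp_all
  also have "\<dots> < \<infinity>" by (rule suminf_half_finite)
  finally have "(\<integral>\<^sup>+\<omega>. (\<Sum>n. ennreal (2^n * (X (Suc n) \<omega> - X n \<omega>)\<^sup>2)) \<partial>P) \<noteq> \<infinity>"
    by (subst nn_integral_suminf) auto
  then have "AE \<omega> in P. (\<Sum>n. ennreal (2^n * (X (Suc n) \<omega> - X n \<omega>)\<^sup>2)) \<noteq> \<infinity>"
    by (intro nn_integral_PInf_AE) auto
  then show ?thesis
  proof eventually_elim
    case (elim \<omega>)
    let ?d = "\<lambda>n. X (Suc n) \<omega> - X n \<omega>"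
    have "summable (\<lambda>n. 2^n * (?d n)\<^sup>2)"
      using elim by (intro summable_suminf_not_top) auto
    then have *: "summable (\<lambda>n. (1/2)^n + 2^n * (?d n)\<^sup>2)"
      by (intro summable_add summable_geometric) auto
    have "\<bar>?d n\<bar> \<le> (1/2)^n + 2^n * (?d n)\<^sup>2" for n
    proof -
      \<comment> \<open>AM-GM\<close>
      have "0 \<le> 2^n * ((1/2)^n - \<bar>?d n\<bar>)\<^sup>2" by simp
      also have "\<dots> = (1/2)^n - 2 * \<bar>?d n\<bar> + 2^n * (?d n)\<^sup>2"
        by (simp add: power2_diff field_simps power2_eq_square)
      finally have "2 * \<bar>?d n\<bar> \<le> (1/2)^n + 2^n * (?d n)\<^sup>2" by (simp only: diff_add_eq le_diff_eq add_0)
      moreover have "\<bar>?d n\<bar> \<le> 2 * \<bar>?d n\<bar>" by simp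
      ultimately show ?thesis by (rule order_trans[rotated])
    qed
    then have "summable ?d"
      by (intro summable_comparison_test'[OF *, where N = 0]) (simp only: real_norm_def)
    then have "convergent (\<lambda>n. \<Sum>i<n. ?d i)" by (simp add: summable_iff_convergent)
    then have "convergent (\<lambda>n. X n \<omega> - X 0 \<omega>)" by (simp only: sum_lessThan_telescope[of "\<lambda>n. X n \<omega>"])
    then have "convergent (\<lambda>n. (X n \<omega> - X 0 \<omega>) + X 0 \<omega>)" by (rule convergent_add) (rule convergent_const)
    then show ?case by simp
  qed
qed

text \<open>The limit has to be measurable for the sub-sigma-algebra \<open>N\<close>, which need
  not contain the null sets of \<open>P\<close>. A pointwise \<open>lim\<close> along a fast
  subsequence is such a version, whatever value it takes where there is no convergence.\<close>

lemma msq_complete: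
  fixes X :: "nat \<Rightarrow> 'a \<Rightarrow> real"
  assumes P: "prob_space P" and N: "subalgebra P N" and XN: "\<And>n. X n \<in> borel_measurable N"
    and cauchy: "\<And>e. 0 < e \<Longrightarrow> \<exists>m0. \<forall>m\<ge>m0. \<forall>n\<ge>m0. msd P (X m) (X n) \<le> ennreal e"
  shows "\<exists>Y \<in> borel_measurable N. (\<lambda>n. msd P (X n) Y) \<longlonglongrightarrow> 0"
proof -
  have XP [measurable]: "X n \<in> borel_measurable P" for n
    using measurable_from_subalg[OF N XN] .
  have "eventually (\<lambda>m. \<forall>n\<ge>m. msd P (X n) (X m) \<le> ennreal ((1/4)^j)) sequentially" for j
  proof -
    obtain m0 where "\<forall>m\<ge>m0. \<forall>n\<ge>m0. msd P (X m) (X n) \<le> ennreal ((1/4)^j)"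
      using cauchy[of "(1/4)^j"] by auto
    then show ?thesis unfolding eventually_sequentially by (intro exI[of _ m0]) auto
  qed
  then obtain r :: "nat \<Rightarrow> nat" where r: "strict_mono r"
    "\<And>j n. n \<ge> r j \<Longrightarrow> msd P (X n) (X (r j)) \<le> ennreal ((1/4)^j)"
    using subseq_of_eventually[of "\<lambda>j m. \<forall>n\<ge>m. msd P (X n) (X m) \<le> ennreal ((1/4)^j)"]
    by auto
  define Y where "Y \<omega> = lim (\<lambda>j. X (r j) \<omega>)" for \<omega>
  have Y: "Y \<in> borel_measurable N" unfolding Y_def
    using XN by (intro borel_measurable_lim_metric) auto
  have [measurable]: "Y \<in> borel_measurable P" using measurable_from_subalg[OF N Y] .
  have "AE \<omega> in P. convergent (\<lambda>j. X (r j) \<omega>)"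
    by (rule AE_convergent_of_msq_increments[OF P]) (auto intro!: r(2) simp: strict_mono_less_eq r(1))
  then have lim: "AE \<omega> in P. (\<lambda>j. X (r j) \<omega>) \<longlonglongrightarrow> Y \<omega>"
    by eventually_elim (simp add: Y_def convergent_LIMSEQ_iff)
  have "(\<lambda>n. msd P (X n) Y) \<longlonglongrightarrow> 0"
    unfolding ennreal_tendsto_0_iff_real
  proof safe
    fix e :: real assume e: "0 < e"
    then obtain m0 where m0: "\<And>m n. m \<ge> m0 \<Longrightarrow> n \<ge> m0 \<Longrightarrow> msd P (X m) (X n) \<le> ennreal (e/2)"
      using cauchy[of "e/2"] by auto
    have "msd P (X n) Y < ennreal e" if n: "n \<ge> m0" for n
    proof -
      \<comment> \<open>Fatou along the fast subsequence. It yields only a weak inequality, hence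
        \<open>e/2\<close> where a strict bound by \<open>e\<close> is wanted.\<close>
      have "msd P (X n) Y \<le> ennreal (e/2)"
      proof (rule msq_LIMSEQ_le)
        show "AE \<omega> in P. (\<lambda>j. X n \<omega> - X (r j) \<omega>) \<longlonglongrightarrow> X n \<omega> - Y \<omega>"
          using lim by eventually_elim (intro tendsto_intros)
        show "\<forall>\<^sub>F j in sequentially. msd P (X n) (X (r j)) \<le> ennreal (e/2)"
          using eventually_ge_at_top[of m0]
          by eventually_elim (use n seq_suble[OF r(1)] in \<open>auto intro!: m0 intro: order_trans\<close>)
      qed auto
      also have "\<dots> < ennreal e" using e by (simp add: ennreal_less_iff)
      finally show ?thesis .
    qed
    then show "\<forall>\<^sub>F n in sequentially. msd P (X n) Y < ennreal e"
      by (auto simp: eventually_sequentially)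
  qed
  with Y show ?thesis by auto
qed

lemma ms_tendsto_iff_msq:
  "ms_tendsto P Xs X \<longleftrightarrow> (\<forall>n. Xs n \<in> borel_measurable P) \<and> square_integrable P X \<and>
     (\<lambda>n. msd P (Xs n) X) \<longlonglongrightarrow> 0"
  unfolding ms_tendsto_def msq_def ..

text \<open>Allowing sequences that agree only almost everywhere lets integrands be replaced by
  other versions.\<close>

lemma ms_tendsto_unique:
  assumes "ms_tendsto P Xs X" "ms_tendsto P Ys Y" "\<And>n. AE \<omega> in P. Xs n \<omega> = Ys n \<omega>"
  shows "AE \<omega> in P. X \<omega> = Y \<omega>"
proof -
  have "msd P (Ys n) Y = msd P (Xs n) Y" for n
    by (rule msq_cong_AE) (use assms(3)[of n] in eventually_elim, simp)
  then show ?thesis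
    using assms by (intro msq_tendsto_unique[of Xs]) (auto simp: ms_tendsto_iff_msq square_integrable_def)
qed

section \<open>Simple processes and their integrals\<close>

text \<open>A list of triples \<open>(u, v, \<xi>)\<close> stands for the process \<open>\<Sum> \<xi> 1\<^bsub>[u,v)\<^esub>\<close>; the intervals may overlap,
  so that linear combinations are again lists of triples.\<close>

type_synonym 'a simple = "(real \<times> real \<times> ('a \<Rightarrow> real)) list"

definition proc :: "'a simple \<Rightarrow> real \<Rightarrow> 'a \<Rightarrow> real" where
  "proc G \<tau> \<omega> = (\<Sum>(u, v, \<xi>)\<leftarrow>G. indicator {u..<v} \<tau> * \<xi> \<omega>)"

definition sint :: "(real \<Rightarrow> 'a \<Rightarrow> real) \<Rightarrow> 'a simple \<Rightarrow> 'a \<Rightarrow> real" where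
  "sint Z G \<omega> = (\<Sum>(u, v, \<xi>)\<leftarrow>G. \<xi> \<omega> * (Z v \<omega> - Z u \<omega>))"

definition scale :: "real \<Rightarrow> 'a simple \<Rightarrow> 'a simple" where
  "scale a G = map (\<lambda>(u, v, \<xi>). (u, v, \<lambda>\<omega>. a * \<xi> \<omega>)) G"

lemma proc_Nil [simp]: "proc [] \<tau> \<omega> = 0"
  and proc_Cons [simp]: "proc ((u, v, \<xi>) # G) \<tau> \<omega> = indicator {u..<v} \<tau> * \<xi> \<omega> + proc G \<tau> \<omega>"
  and proc_append [simp]: "proc (G @ H) \<tau> \<omega> = proc G \<tau> \<omega> + proc H \<tau> \<omega>"
  by (simp_all add: proc_def)

lemma sint_Nil [simp]: "sint Z [] \<omega> = 0"
  and sint_Cons [simp]: "sint Z ((u, v, \<xi>) # G) \<omega> = \<xi> \<omega> * (Z v \<omega> - Z u \<omega>) + sint Z G \<omega>"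
  and sint_append [simp]: "sint Z (G @ H) \<omega> = sint Z G \<omega> + sint Z H \<omega>"
  by (simp_all add: sint_def)

lemma proc_scale [simp]: "proc (scale a G) \<tau> \<omega> = a * proc G \<tau> \<omega>"
  by (induction G) (auto simp: scale_def algebra_simps)

lemma sint_scale [simp]: "sint Z (scale a G) \<omega> = a * sint Z G \<omega>"
  by (induction G) (auto simp: scale_def algebra_simps)

lemma sorted_wrt_nth_le_iff:
  assumes "sorted_wrt (<) (l :: real list)" "i < length l" "j < length l"
  shows "l ! i \<le> l ! j \<longleftrightarrow> i \<le> j"
  using assms sorted_wrt_iff_nth_less[of "(<)" l] by (metis linorder_not_le nle_le)

text \<open>If every endpoint is a node, no interval begins or ends strictly inside a gap.\<close>

lemma proc_nodes:
  assumes "sorted_wrt (<) l" "\<forall>(u, v, \<xi>)\<in>set G. u \<in> set l \<and> v \<in> set l \<and> u \<le> v"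
    and "Suc i < length l" "l ! i \<le> \<tau>" "\<tau> < l ! Suc i"
  shows "proc G \<tau> \<omega> = proc G (l ! i) \<omega>"
  using assms(2)
proof (induction G)
  case (Cons g G)
  obtain u v \<xi> where g: "g = (u, v, \<xi>)" by (cases g)
  from Cons.prems g obtain a b where ab: "a < length l" "u = l ! a" "b < length l" "v = l ! b"
    by (auto simp: in_set_conv_nth)
  have "u \<le> \<tau> \<longleftrightarrow> u \<le> l ! i" "\<tau> < v \<longleftrightarrow> l ! i < v"
  proof -
    show "u \<le> \<tau> \<longleftrightarrow> u \<le> l ! i"
    proof
      assume "u \<le> \<tau>"
      then have "\<not> l ! Suc i \<le> u" using assms(5) by simp
      then have "a < Suc i" using sorted_wrt_nth_le_iff[OF assms(1,3) ab(1)] ab by auto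
      then show "u \<le> l ! i" using sorted_wrt_nth_le_iff[OF assms(1) ab(1), of i] assms(3) ab by auto
    qed (use assms(4) in simp)
    show "\<tau> < v \<longleftrightarrow> l ! i < v"
    proof
      assume "l ! i < v"
      then have "Suc i \<le> b" using sorted_wrt_nth_le_iff[OF assms(1) ab(3), of i] assms(3) ab by auto
      then show "\<tau> < v" using sorted_wrt_nth_le_iff[OF assms(1,3) ab(3)] assms(5) ab by auto
    qed (use assms(4) in simp)
  qed
  then show ?case using Cons by (auto simp: g indicator_def)
qed simp

text \<open>Each triple telescopes over the nodes between its endpoints, so overlapping triples
  become increments over disjoint gaps, the form in which orthogonality and Cauchy-Schwarz
  apply.\<close>

lemma sint_nodes:
  assumes "sorted_wrt (<) l" "\<forall>(u, v, \<xi>)\<in>set G. u \<in> set l \<and> v \<in> set l \<and> u \<le> v"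
  shows "sint Z G \<omega> = (\<Sum>i<length l - 1. proc G (l ! i) \<omega> * (Z (l ! Suc i) \<omega> - Z (l ! i) \<omega>))"
  using assms(2)
proof (induction G)
  case (Cons g G)
  obtain u v \<xi> where g: "g = (u, v, \<xi>)" by (cases g)
  from Cons.prems g obtain a b where ab: "a < length l" "u = l ! a" "b < length l" "v = l ! b" "u \<le> v"
    by (auto simp: in_set_conv_nth)
  then have "a \<le> b" using sorted_wrt_nth_le_iff[OF assms(1) ab(1,3)] by auto
  have iff: "u \<le> l ! i \<longleftrightarrow> a \<le> i" "l ! i < v \<longleftrightarrow> i < b" if "i < length l - 1" for i
    using that sorted_wrt_nth_le_iff[OF assms(1) ab(1), of i] sorted_wrt_nth_le_iff[OF assms(1) ab(3), of i] ab
    by (auto simp flip: not_le)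
  have "(\<Sum>i<length l - 1. indicator {u..<v} (l ! i) * (Z (l ! Suc i) \<omega> - Z (l ! i) \<omega>))
      = (\<Sum>i\<in>{a..<b}. Z (l ! Suc i) \<omega> - Z (l ! i) \<omega>)"
    by (rule sum.mono_neutral_cong_right) (use ab iff in \<open>auto simp: indicator_def\<close>)
  also have "\<dots> = Z v \<omega> - Z u \<omega>"
    using sum_Suc_diff'[OF \<open>a \<le> b\<close>, of "\<lambda>i. Z (l ! i) \<omega>"] ab by simp
  finally have "\<xi> \<omega> * (Z v \<omega> - Z u \<omega>) =
      \<xi> \<omega> * (\<Sum>i<length l - 1. indicator {u..<v} (l ! i) * (Z (l ! Suc i) \<omega> - Z (l ! i) \<omega>))"
    by simp
  also have "\<dots> = (\<Sum>i<length l - 1. indicator {u..<v} (l ! i) * \<xi> \<omega> * (Z (l ! Suc i) \<omega> - Z (l ! i) \<omega>))"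
    unfolding sum_distrib_left by (intro sum.cong) auto
  finally show ?case using Cons unfolding g sint_Cons proc_Cons distrib_right sum.distrib by simp
qed simp

lemma sum_indicator_nodes:
  assumes "sorted_wrt (<) (l :: real list)" "n < length l"
  shows "(\<Sum>i<n. indicator {l ! i..<l ! Suc i} \<tau> :: ennreal) = indicator {l ! 0..<l ! n} \<tau>"
  using assms(2)
proof (induction n)
  case (Suc n)
  have "0 < length l" using Suc.prems by linarith
  then have "l ! 0 \<le> l ! n" "l ! n \<le> l ! Suc n"
    using Suc.prems sorted_wrt_nth_le_iff[OF assms(1), of 0 n] sorted_wrt_nth_le_iff[OF assms(1), of n "Suc n"] by auto
  then show ?case using Suc by (auto simp: indicator_def)
qed simp

lemma nodes_exist:
  assumes "\<forall>(u, v, \<xi>)\<in>set G. a \<le> u \<and> u \<le> v \<and> v \<le> (b::real)"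
  obtains l where "sorted_wrt (<) l" "set l \<subseteq> {a..b}"
    "\<forall>(u, v, \<xi>)\<in>set G. u \<in> set l \<and> v \<in> set l \<and> u \<le> v"
proof
  define D where "D = fst ` set G \<union> (fst \<circ> snd) ` set G"
  have fin: "finite D" by (simp add: D_def)
  show "sorted_wrt (<) (sorted_list_of_set D)" by simp
  show "set (sorted_list_of_set D) \<subseteq> {a..b}" using assms fin by (force simp: D_def)
  show "\<forall>(u, v, \<xi>)\<in>set G. u \<in> set (sorted_list_of_set D) \<and> v \<in> set (sorted_list_of_set D) \<and> u \<le> v"
    using assms fin by (force simp: D_def)
qed

text \<open>Measurability is asked of \<open>h\<close> only after restriction to
  \<open>{a..b}\<close>, since the processes to which this is applied are controlled on that
  interval alone.\<close>

lemma sum_nodes_nn_integral_le: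
  fixes h :: "real \<Rightarrow> ennreal"
  assumes "sorted_wrt (<) l" "set l \<subseteq> {a..b}"
    and h: "(\<lambda>\<tau>. h \<tau> * indicator {a..b} \<tau>) \<in> borel_measurable borel"
  shows "(\<Sum>i<length l - 1. \<integral>\<^sup>+\<tau>\<in>{l ! i..<l ! Suc i}. h \<tau> \<partial>lborel) \<le> (\<integral>\<^sup>+\<tau>\<in>{a..b}. h \<tau> \<partial>lborel)"
proof (cases "length l > 1")
  case True
  let ?h = "\<lambda>\<tau>. h \<tau> * indicator {a..b} \<tau>"
  have ab: "l ! i \<in> {a..b}" if "i < length l" for i using that assms(2) nth_mem by blast
  have eq: "h \<tau> * indicator {l ! i..<l ! Suc i} \<tau> = ?h \<tau> * indicator {l ! i..<l ! Suc i} \<tau>"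
    if "i < length l - 1" for i \<tau>
  proof -
    have "i < length l" "Suc i < length l" using that by simp_all
    then show ?thesis using ab[of i] ab[of "Suc i"] by (auto simp: indicator_def)
  qed
  have "(\<Sum>i<length l - 1. \<integral>\<^sup>+\<tau>\<in>{l ! i..<l ! Suc i}. h \<tau> \<partial>lborel)
      = (\<Sum>i<length l - 1. \<integral>\<^sup>+\<tau>. ?h \<tau> * indicator {l ! i..<l ! Suc i} \<tau> \<partial>lborel)"
    by (intro sum.cong nn_integral_cong eq) auto
  also have "\<dots> = (\<integral>\<^sup>+\<tau>. (\<Sum>i<length l - 1. ?h \<tau> * indicator {l ! i..<l ! Suc i} \<tau>) \<partial>lborel)"
    using h by (subst nn_integral_sum) (auto intro: borel_measurable_times_ennreal)
  also have "\<dots> = (\<integral>\<^sup>+\<tau>. ?h \<tau> * indicator {l ! 0..<l ! (length l - 1)} \<tau> \<partial>lborel)"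
    using True by (simp add: sum_indicator_nodes[OF assms(1)] flip: sum_distrib_left)
  also have "\<dots> \<le> (\<integral>\<^sup>+\<tau>\<in>{a..b}. h \<tau> \<partial>lborel)"
    by (intro nn_integral_mono) (auto simp: indicator_def)
  finally show ?thesis .
qed simp

lemma indicator_fst_measurable:
  fixes A :: "real set"
  assumes "A \<in> sets borel"
  shows "(\<lambda>x. indicator A (fst x) :: real) \<in> borel_measurable (lborel \<Otimes>\<^sub>M N)"
  by (rule measurable_compose[OF measurable_fst]) (use assms in simp)

section \<open>Adapted simple processes on [t,T] when \<rho> is bounded\<close>

locale bounded_martingale_setting = martingale_setting P F T M \<rho>
  for P :: "'a measure" and F and T :: real and M and \<rho> +
  fixes t K :: real
  assumes t_nonneg: "0 \<le> t" and t_less: "t < T"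
    and \<rho>_bound: "\<And>\<tau>. \<tau> \<in> {t..T} \<Longrightarrow> AE \<omega> in P. \<bar>\<rho> \<tau> \<omega>\<bar> \<le> K"
begin

lemma K_nonneg: "0 \<le> K"
proof -
  have "AE \<omega> in P. \<bar>\<rho> t \<omega>\<bar> \<le> K" using \<rho>_bound[of t] t_less by simp
  then have "AE \<omega> in P. 0 \<le> K" by eventually_elim linarith
  then show ?thesis by simp
qed

lemma subalg: "\<tau> \<in> {t..T} \<Longrightarrow> subalgebra P (F \<tau>)"
  using subalgebra_F t_nonneg by auto

lemma sigma_finite_subalg: "\<tau> \<in> {t..T} \<Longrightarrow> sigma_finite_subalgebra P (F \<tau>)"
  using subalg finite_measure_axioms
  by (intro finite_measure_subalgebra_is_sigma_finite)
     (auto simp: finite_measure_subalgebra_def finite_measure_subalgebra_axioms_def)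

lemma measurable_F_P: "X \<in> borel_measurable (F \<tau>) \<Longrightarrow> \<tau> \<in> {t..T} \<Longrightarrow> X \<in> borel_measurable P"
  using measurable_from_subalg subalg by blast

lemma measurable_F_mono:
  assumes "X \<in> borel_measurable (F u)" "t \<le> u" "u \<le> s" "s \<le> T"
  shows "X \<in> borel_measurable (F s)"
proof -
  have "subalgebra (F s) (F u)"
    using subalg[of u] subalg[of s] F_mono[of u s] assms t_nonneg by (auto simp: subalgebra_def)
  then show ?thesis using assms(1) measurable_from_subalg by blast
qed

lemma M_meas_F: "\<tau> \<in> {t..T} \<Longrightarrow> M \<tau> \<in> borel_measurable (F \<tau>)"
  using M_adapted t_nonneg by auto

lemma M_meas: "\<tau> \<in> {t..T} \<Longrightarrow> M \<tau> \<in> borel_measurable P"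
  using M_meas_F measurable_F_P by blast

definition alg :: "integrator \<Rightarrow> real \<Rightarrow> 'a measure" where
  "alg c u = (case c of Martingale \<Rightarrow> F u | Time \<Rightarrow> P)"

lemma alg_simps [simp]: "alg Martingale u = F u" "alg Time u = P"
  by (simp_all add: alg_def)

abbreviation Z :: "integrator \<Rightarrow> real \<Rightarrow> 'a \<Rightarrow> real" where
  "Z \<equiv> integrator_process M"

lemma Z_meas_F: "\<tau> \<in> {t..T} \<Longrightarrow> Z c \<tau> \<in> borel_measurable (F \<tau>)"
  by (cases c) (auto simp: M_meas_F)

lemma Z_meas: "\<tau> \<in> {t..T} \<Longrightarrow> Z c \<tau> \<in> borel_measurable P"
  using Z_meas_F measurable_F_P by blast

definition simple :: "integrator \<Rightarrow> 'a simple \<Rightarrow> bool" where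
  "simple c G \<longleftrightarrow> (\<forall>(u, v, \<xi>)\<in>set G. t \<le> u \<and> u \<le> v \<and> v \<le> T \<and> \<xi> \<in> borel_measurable (alg c u))"

lemma simple_Nil [simp]: "simple c []"
  and simple_append [simp]: "simple c (G @ H) \<longleftrightarrow> simple c G \<and> simple c H"
  and simple_Cons: "simple c ((u, v, \<xi>) # G) \<longleftrightarrow>
    t \<le> u \<and> u \<le> v \<and> v \<le> T \<and> \<xi> \<in> borel_measurable (alg c u) \<and> simple c G"
  by (simp_all add: simple_def ball_Un)

lemma simple_scale [simp]: "simple c G \<Longrightarrow> simple c (scale a G)"
  by (fastforce simp: simple_def scale_def)

lemma simple_coeff_meas: "simple c G \<Longrightarrow> (u, v, \<xi>) \<in> set G \<Longrightarrow> \<xi> \<in> borel_measurable P"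
  by (cases c) (fastforce simp: simple_def intro: measurable_F_P)+

lemma proc_meas: "simple c G \<Longrightarrow> proc G \<tau> \<in> borel_measurable P"
proof (induction G)
  case (Cons g G)
  obtain u v \<xi> where g: "g = (u, v, \<xi>)" by (cases g)
  show ?case using Cons simple_coeff_meas[OF Cons.prems, of u v \<xi>]
    by (auto simp: g simple_Cons)
qed (simp add: proc_def[abs_def])

lemma sint_meas: "simple c G \<Longrightarrow> sint (Z c) G \<in> borel_measurable P"
proof (induction G)
  case (Cons g G)
  obtain u v \<xi> where g: "g = (u, v, \<xi>)" by (cases g)
  show ?case using Cons simple_coeff_meas[OF Cons.prems, of u v \<xi>] Z_meas[of u c] Z_meas[of v c]
    by (auto simp: g simple_Cons)
qed (simp add: sint_def[abs_def])

lemma proc_adapted: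
  assumes "simple Martingale G" "s \<in> {t..T}"
  shows "proc G s \<in> borel_measurable (F s)"
  using assms(1)
proof (induction G)
  case (Cons g G)
  obtain u v \<xi> where g: "g = (u, v, \<xi>)" by (cases g)
  have "(\<lambda>\<omega>. indicator {u..<v} s * \<xi> \<omega>) \<in> borel_measurable (F s)"
    using Cons.prems assms(2) by (cases "u \<le> s") (auto simp: g simple_Cons intro!: borel_measurable_times measurable_F_mono[of \<xi> u s])
  then show ?case using Cons by (simp add: g simple_Cons)
qed (simp add: proc_def[abs_def])

text \<open>Extension by 0 outside \<open>{t..T}\<close> gives a function on the whole product with
  \<open>lborel\<close>, the form in which Fubini's theorem applies, while values outside the
  interval stay arbitrary.\<close>

definition joint_meas :: "(real \<Rightarrow> 'a \<Rightarrow> real) \<Rightarrow> bool" where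
  "joint_meas f \<longleftrightarrow> (\<lambda>(\<tau>, \<omega>). indicator {t..T} \<tau> * f \<tau> \<omega>) \<in> borel_measurable (lborel \<Otimes>\<^sub>M P)"

text \<open>The squared norm of L2 over time and outcome, one norm for both integrators.\<close>

definition msq_int :: "(real \<Rightarrow> 'a \<Rightarrow> real) \<Rightarrow> ennreal" where
  "msq_int f = (\<integral>\<^sup>+\<tau>\<in>{t..T}. msq P (f \<tau>) \<partial>lborel)"

abbreviation msd_int :: "(real \<Rightarrow> 'a \<Rightarrow> real) \<Rightarrow> (real \<Rightarrow> 'a \<Rightarrow> real) \<Rightarrow> ennreal" where
  "msd_int f g \<equiv> msq_int (\<lambda>\<tau> \<omega>. f \<tau> \<omega> - g \<tau> \<omega>)"

abbreviation cut :: "real \<Rightarrow> real \<Rightarrow> (real \<Rightarrow> 'a \<Rightarrow> real) \<Rightarrow> real \<Rightarrow> 'a \<Rightarrow> real" where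
  "cut a b f \<equiv> (\<lambda>\<tau> \<omega>. indicator {a..<b} \<tau> * f \<tau> \<omega>)"

lemma joint_meas_msq:
  assumes "joint_meas f"
  shows "(\<lambda>\<tau>. msq P (f \<tau>) * indicator {t..T} \<tau>) \<in> borel_measurable lborel"
proof -
  have "(\<lambda>\<tau>. \<integral>\<^sup>+\<omega>. (\<lambda>(\<tau>, \<omega>). ennreal ((indicator {t..T} \<tau> * f \<tau> \<omega>)\<^sup>2)) (\<tau>, \<omega>) \<partial>P) \<in> borel_measurable lborel"
    using assms unfolding joint_meas_def
    by (intro borel_measurable_nn_integral_fst) (simp add: split_beta' borel_measurable_power)
  moreover have "(\<integral>\<^sup>+\<omega>. (\<lambda>(\<tau>, \<omega>). ennreal ((indicator {t..T} \<tau> * f \<tau> \<omega>)\<^sup>2)) (\<tau>, \<omega>) \<partial>P)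
      = msq P (f \<tau>) * indicator {t..T} \<tau>" for \<tau>
    by (auto simp: msq_def indicator_def)
  ultimately show ?thesis by simp
qed

lemma joint_meas_add: "joint_meas f \<Longrightarrow> joint_meas g \<Longrightarrow> joint_meas (\<lambda>\<tau> \<omega>. f \<tau> \<omega> + g \<tau> \<omega>)"
  and joint_meas_diff: "joint_meas f \<Longrightarrow> joint_meas g \<Longrightarrow> joint_meas (\<lambda>\<tau> \<omega>. f \<tau> \<omega> - g \<tau> \<omega>)"
  unfolding joint_meas_def by (simp_all add: split_beta' ring_distribs)

lemma joint_meas_prod:
  assumes "joint_meas f" "(\<lambda>\<tau>. indicator {t..T} \<tau> * g \<tau>) \<in> borel_measurable borel" "\<xi> \<in> borel_measurable P"
  shows "joint_meas (\<lambda>\<tau> \<omega>. g \<tau> * \<xi> \<omega> * f \<tau> \<omega>)"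
proof -
  have eq: "(\<lambda>(\<tau>, \<omega>). indicator {t..T} \<tau> * (g \<tau> * \<xi> \<omega> * f \<tau> \<omega>))
    = (\<lambda>x. ((indicator {t..T} (fst x) * g (fst x)) * \<xi> (snd x)) * (\<lambda>(\<tau>, \<omega>). indicator {t..T} \<tau> * f \<tau> \<omega>) x :: real)"
    by (auto simp: indicator_def fun_eq_iff)
  have "(\<lambda>x. indicator {t..T} (fst x) * g (fst x) :: real) \<in> borel_measurable (lborel \<Otimes>\<^sub>M P)"
    using measurable_compose[OF measurable_fst, of "\<lambda>\<tau>. indicator {t..T} \<tau> * g \<tau>" lborel borel P] assms(2) by simp
  moreover have "(\<lambda>x. \<xi> (snd x)) \<in> borel_measurable (lborel \<Otimes>\<^sub>M P)"
    using measurable_compose[OF measurable_snd, of \<xi> P borel lborel] assms(3) by simp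
  ultimately show ?thesis
    using assms(1) unfolding joint_meas_def eq by (intro borel_measurable_times[of _ _ "\<lambda>x. case x of (\<tau>, \<omega>) \<Rightarrow> indicator {t..T} \<tau> * f \<tau> \<omega>"] borel_measurable_times[of _ _ "\<lambda>x. \<xi> (snd x)"])
qed

lemma joint_meas_const: "joint_meas (\<lambda>\<tau> \<omega>. 1)"
  unfolding joint_meas_def by (simp add: split_beta')

lemma joint_meas_proc: "simple c G \<Longrightarrow> joint_meas (proc G)"
proof (induction G)
  case Nil
  then show ?case by (simp add: joint_meas_def proc_def)
next
  case (Cons g G)
  obtain u v \<xi> where g: "g = (u, v, \<xi>)" by (cases g)
  have "joint_meas (\<lambda>\<tau> \<omega>. indicator {u..<v} \<tau> * \<xi> \<omega> * 1)"
    using simple_coeff_meas[OF Cons.prems, of u v \<xi>] g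
    by (intro joint_meas_prod joint_meas_const) auto
  then have "joint_meas (\<lambda>\<tau> \<omega>. indicator {u..<v} \<tau> * \<xi> \<omega> * 1 + proc G \<tau> \<omega>)"
    using Cons by (intro joint_meas_add) (auto simp: g simple_Cons)
  moreover have "proc (g # G) = (\<lambda>\<tau> \<omega>. indicator {u..<v} \<tau> * \<xi> \<omega> * 1 + proc G \<tau> \<omega>)"
    by (simp add: g fun_eq_iff)
  ultimately show ?case by simp
qed

lemma joint_meas_section: "joint_meas f \<Longrightarrow> \<tau> \<in> {t..T} \<Longrightarrow> f \<tau> \<in> borel_measurable P"
  unfolding joint_meas_def using measurable_Pair2[of "\<lambda>(\<tau>, \<omega>). indicator {t..T} \<tau> * f \<tau> \<omega>" lborel P borel \<tau>]
  by simp

lemma msq_int_triangle: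
  assumes "joint_meas f" "joint_meas g" "joint_meas h"
  shows "msd_int f h \<le> 2 * msd_int f g + 2 * msd_int g h"
proof -
  note m = joint_meas_msq[OF joint_meas_diff[OF assms(1,2)]] joint_meas_msq[OF joint_meas_diff[OF assms(2,3)]]
  have "msd_int f h \<le> (\<integral>\<^sup>+\<tau>. 2 * (msd P (f \<tau>) (g \<tau>) * indicator {t..T} \<tau>)
      + 2 * (msd P (g \<tau>) (h \<tau>) * indicator {t..T} \<tau>) \<partial>lborel)"
    unfolding msq_int_def
  proof (rule nn_integral_mono)
    fix \<tau>
    show "msd P (f \<tau>) (h \<tau>) * indicator {t..T} \<tau> \<le> 2 * (msd P (f \<tau>) (g \<tau>) * indicator {t..T} \<tau>)
      + 2 * (msd P (g \<tau>) (h \<tau>) * indicator {t..T} \<tau>)"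
      using msq_triangle[of "f \<tau>" P "g \<tau>" "h \<tau>"] assms[THEN joint_meas_section, of \<tau>]
      by (cases "\<tau> \<in> {t..T}") auto
  qed
  also have "\<dots> = 2 * msd_int f g + 2 * msd_int g h"
    unfolding msq_int_def using m
    by (subst nn_integral_add) (auto simp: nn_integral_cmult intro!: borel_measurable_times_ennreal)
  finally show ?thesis .
qed

text \<open>A process measurable over the restricted time space is composed with the projection of
  the line onto \<open>{a..b}\<close>; the indicator then removes the constant continuation.\<close>

lemma clamp_meas:
  assumes "measurable_process P a b f" "a \<le> b"
  shows "(\<lambda>(\<tau>, \<omega>). indicator {a..b} \<tau> * f \<tau> \<omega>) \<in> borel_measurable (lborel \<Otimes>\<^sub>M P)"
proof -
  have c: "(\<lambda>\<tau>. max a (min b \<tau>)) \<in> measurable lborel (restrict_space borel {a..b})"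
    using assms(2) by (intro measurable_restrict_space2) auto
  have "(\<lambda>x. (max a (min b (fst x)), snd x)) \<in> measurable (lborel \<Otimes>\<^sub>M P) (restrict_space borel {a..b} \<Otimes>\<^sub>M P)"
    by (intro measurable_Pair measurable_compose[OF measurable_fst c] measurable_snd)
  from measurable_compose[OF this assms(1)[unfolded measurable_process_def]]
  have "(\<lambda>x. indicator {a..b} (fst x) * f (max a (min b (fst x))) (snd x)) \<in> borel_measurable (lborel \<Otimes>\<^sub>M P)"
    by (intro borel_measurable_times indicator_fst_measurable) (auto simp: split_beta')
  moreover have "(\<lambda>x. indicator {a..b} (fst x) * f (max a (min b (fst x))) (snd x)) = (\<lambda>(\<tau>, \<omega>). indicator {a..b} \<tau> * f \<tau> \<omega>)"
    by (auto simp: fun_eq_iff indicator_def max_def min_def)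
  ultimately show ?thesis by simp
qed

lemma measurable_process_of_joint_meas:
  assumes "joint_meas f" "t \<le> a" "b \<le> T"
  shows "measurable_process P a b f"
proof -
  have "(\<lambda>x. (fst x, snd x)) \<in> measurable (restrict_space borel {a..b} \<Otimes>\<^sub>M P) (lborel \<Otimes>\<^sub>M P)"
    by (intro measurable_Pair measurable_compose[OF measurable_fst] measurable_snd)
       (auto intro: measurable_restrict_space1)
  from measurable_compose[OF this assms(1)[unfolded joint_meas_def]]
  have "(\<lambda>(\<tau>, \<omega>). indicator {t..T} \<tau> * f \<tau> \<omega>) \<in> borel_measurable (restrict_space borel {a..b} \<Otimes>\<^sub>M P)"
    by simp
  then show ?thesis unfolding measurable_process_def
    by (rule measurable_cong[THEN iffD1, rotated])
       (use assms(2,3) in \<open>auto simp: space_pair_measure space_restrict_space indicator_def\<close>)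
qed

lemma joint_meas_of_measurable_process: "measurable_process P t T f \<Longrightarrow> joint_meas f"
  unfolding joint_meas_def using clamp_meas t_less by simp

section \<open>The norm weighted by \<rho>\<close>

lemma \<rho>_joint_meas: "joint_meas \<rho>"
proof -
  have "(\<lambda>(\<tau>, \<omega>). indicator {0..T} \<tau> * \<rho> \<tau> \<omega>) \<in> borel_measurable (lborel \<Otimes>\<^sub>M P)"
    using clamp_meas[OF \<rho>_measurable] t_less t_nonneg by simp
  then have "(\<lambda>x. indicator {t..T} (fst x) * (\<lambda>(\<tau>, \<omega>). indicator {0..T} \<tau> * \<rho> \<tau> \<omega>) x) \<in> borel_measurable (lborel \<Otimes>\<^sub>M P)"
    by (intro borel_measurable_times indicator_fst_measurable) auto
  moreover have "(\<lambda>x. indicator {t..T} (fst x) * (\<lambda>(\<tau>, \<omega>). indicator {0..T} \<tau> * \<rho> \<tau> \<omega>) x)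
      = (\<lambda>(\<tau>, \<omega>). indicator {t..T} \<tau> * \<rho> \<tau> \<omega>)"
    using t_nonneg by (auto simp: fun_eq_iff indicator_def)
  ultimately show ?thesis by (simp add: joint_meas_def)
qed

text \<open>The squared norm of \<open>H2\<close> on \<open>[t,T]\<close>. \<open>H2\<close>
  integrates over time first, \<open>step_approximation\<close> over the outcome first; Fubini's
  theorem relates the two.\<close>

abbreviation weighted :: "(real \<Rightarrow> 'a \<Rightarrow> real) \<Rightarrow> ennreal" where
  "weighted f \<equiv> (\<integral>\<^sup>+\<omega>. (\<integral>\<^sup>+\<tau>\<in>{t..T}. ennreal ((f \<tau> \<omega>)\<^sup>2 * \<rho> \<tau> \<omega>) \<partial>lborel) \<partial>P)"

lemma pair_sigma_finite_lborel: "pair_sigma_finite lborel P"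
  by (simp add: pair_sigma_finite_def lborel.sigma_finite_measure_axioms sigma_finite_measure_axioms)

lemma nn_integral_time_measurable:
  assumes "h \<in> borel_measurable (lborel \<Otimes>\<^sub>M P)"
  shows "(\<lambda>\<omega>. \<integral>\<^sup>+\<tau>. h (\<tau>, \<omega>) \<partial>lborel) \<in> borel_measurable P"
  using lborel.borel_measurable_nn_integral_fst[OF measurable_pair_swap[OF assms]] by simp

lemma joint_meas_path:
  assumes "joint_meas f" "\<omega> \<in> space P"
  shows "(\<lambda>\<tau>. indicator {t..T} \<tau> * f \<tau> \<omega>) \<in> borel_measurable lborel"
  using measurable_Pair1[OF assms(1)[unfolded joint_meas_def] assms(2)] by simp

lemma weighted_square_measurable:
  assumes "joint_meas f"
  shows "(\<lambda>(\<tau>, \<omega>). ennreal ((f \<tau> \<omega>)\<^sup>2 * \<rho> \<tau> \<omega>) * indicator {t..T} \<tau>) \<in> borel_measurable (lborel \<Otimes>\<^sub>M P)"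
proof -
  have "(\<lambda>x. ennreal (((\<lambda>(\<tau>, \<omega>). indicator {t..T} \<tau> * f \<tau> \<omega>) x)\<^sup>2 * (\<lambda>(\<tau>, \<omega>). indicator {t..T} \<tau> * \<rho> \<tau> \<omega>) x))
      \<in> borel_measurable (lborel \<Otimes>\<^sub>M P)"
    using assms \<rho>_joint_meas unfolding joint_meas_def
    by (intro measurable_compose[OF _ measurable_ennreal] borel_measurable_times borel_measurable_power)
  moreover have "(\<lambda>x. ennreal (((\<lambda>(\<tau>, \<omega>). indicator {t..T} \<tau> * f \<tau> \<omega>) x)\<^sup>2 * (\<lambda>(\<tau>, \<omega>). indicator {t..T} \<tau> * \<rho> \<tau> \<omega>) x))
    = (\<lambda>(\<tau>, \<omega>). ennreal ((f \<tau> \<omega>)\<^sup>2 * \<rho> \<tau> \<omega>) * indicator {t..T} \<tau>)"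
    by (auto simp: fun_eq_iff indicator_def)
  ultimately show ?thesis by simp
qed

lemma weighted_square_Fubini:
  assumes "joint_meas f"
  shows "weighted f
       = (\<integral>\<^sup>+\<tau>\<in>{t..T}. (\<integral>\<^sup>+\<omega>. ennreal ((f \<tau> \<omega>)\<^sup>2 * \<rho> \<tau> \<omega>) \<partial>P) \<partial>lborel)"
proof -
  have "weighted f
      = (\<integral>\<^sup>+\<tau>. (\<integral>\<^sup>+\<omega>. ennreal ((f \<tau> \<omega>)\<^sup>2 * \<rho> \<tau> \<omega>) * indicator {t..T} \<tau> \<partial>P) \<partial>lborel)"
    using pair_sigma_finite.Fubini[OF pair_sigma_finite_lborel weighted_square_measurable[OF assms]] by simp
  also have "\<dots> = (\<integral>\<^sup>+\<tau>\<in>{t..T}. (\<integral>\<^sup>+\<omega>. ennreal ((f \<tau> \<omega>)\<^sup>2 * \<rho> \<tau> \<omega>) \<partial>P) \<partial>lborel)"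
    by (intro nn_integral_cong) (auto simp: indicator_def)
  finally show ?thesis .
qed

text \<open>Here the bound on \<rho> turns the weighted norm into the norm of d\<tau>. There is no
  converse, since \<rho> may vanish. Negative values of \<rho> are already cut off by
  \<open>ennreal\<close>.\<close>

lemma weighted_square_le:
  assumes "joint_meas f"
  shows "weighted f \<le> ennreal K * msq_int f"
proof -
  have "(\<integral>\<^sup>+\<omega>. ennreal ((f \<tau> \<omega>)\<^sup>2 * \<rho> \<tau> \<omega>) \<partial>P) \<le> ennreal K * msq P (f \<tau>)" if "\<tau> \<in> {t..T}" for \<tau>
  proof -
    have [measurable]: "f \<tau> \<in> borel_measurable P" using joint_meas_section[OF assms that] .
    have "(\<integral>\<^sup>+\<omega>. ennreal ((f \<tau> \<omega>)\<^sup>2 * \<rho> \<tau> \<omega>) \<partial>P) \<le> (\<integral>\<^sup>+\<omega>. ennreal K * ennreal ((f \<tau> \<omega>)\<^sup>2) \<partial>P)"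
    proof (rule nn_integral_mono_AE)
      show "AE \<omega> in P. ennreal ((f \<tau> \<omega>)\<^sup>2 * \<rho> \<tau> \<omega>) \<le> ennreal K * ennreal ((f \<tau> \<omega>)\<^sup>2)"
        using \<rho>_bound[OF that]
      proof eventually_elim
        case (elim \<omega>)
        have "(f \<tau> \<omega>)\<^sup>2 * \<rho> \<tau> \<omega> \<le> K * (f \<tau> \<omega>)\<^sup>2"
          using elim by (subst mult.commute) (intro mult_right_mono, auto)
        then show ?case using K_nonneg by (simp flip: ennreal_mult add: ennreal_leI)
      qed
    qed
    also have "\<dots> = ennreal K * msq P (f \<tau>)"
      unfolding msq_def by (rule nn_integral_cmult) simp
    finally show ?thesis .
  qed
  then have "(\<integral>\<^sup>+\<tau>\<in>{t..T}. (\<integral>\<^sup>+\<omega>. ennreal ((f \<tau> \<omega>)\<^sup>2 * \<rho> \<tau> \<omega>) \<partial>P) \<partial>lborel)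
      \<le> (\<integral>\<^sup>+\<tau>. ennreal K * (msq P (f \<tau>) * indicator {t..T} \<tau>) \<partial>lborel)"
    by (intro nn_integral_mono) (auto simp: indicator_def)
  also have "\<dots> = ennreal K * msq_int f"
    unfolding msq_int_def using joint_meas_msq[OF assms] by (simp add: nn_integral_cmult)
  finally show ?thesis unfolding weighted_square_Fubini[OF assms] .
qed

text \<open>The isometry over one step. With conditional expectations of nonnegative functions it
  holds also when both sides are infinite, so neither M nor \<open>\<eta>\<close> has to be square
  integrable.\<close>

lemma increment_square:
  assumes "t \<le> u" "u < s" "s \<le> T" and \<eta>: "\<eta> \<in> borel_measurable (F u)"
  shows "msq P (\<lambda>\<omega>. \<eta> \<omega> * (M s \<omega> - M u \<omega>))
    = (\<integral>\<^sup>+\<omega>. (\<integral>\<^sup>+\<tau>\<in>{u..<s}. ennreal ((\<eta> \<omega>)\<^sup>2 * \<rho> \<tau> \<omega>) \<partial>lborel) \<partial>P)"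
proof -
  have u: "u \<in> {t..T}" and s: "s \<in> {t..T}" using assms by auto
  interpret sigma_finite_subalgebra P "F u" using sigma_finite_subalg[OF u] .
  note [measurable] = M_meas[OF u] M_meas[OF s] measurable_F_P[OF \<eta> u]
  define R where "R \<omega> = (\<integral>\<^sup>+\<tau>\<in>{u..s}. ennreal (\<rho> \<tau> \<omega>) \<partial>lborel)" for \<omega>
  have R_path: "(\<lambda>\<tau>. ennreal (\<rho> \<tau> \<omega>) * indicator {u..s} \<tau>) \<in> borel_measurable lborel" if "\<omega> \<in> space P" for \<omega>
  proof -
    have "(\<lambda>\<tau>. ennreal (indicator {t..T} \<tau> * \<rho> \<tau> \<omega>) * indicator {u..s} \<tau>) \<in> borel_measurable lborel"
      using joint_meas_path[OF \<rho>_joint_meas that] by simp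
    moreover have "(\<lambda>\<tau>. ennreal (indicator {t..T} \<tau> * \<rho> \<tau> \<omega>) * indicator {u..s} \<tau>)
        = (\<lambda>\<tau>. ennreal (\<rho> \<tau> \<omega>) * indicator {u..s} \<tau>)"
      using u s by (auto simp: fun_eq_iff indicator_def)
    ultimately show ?thesis by simp
  qed
  have [measurable]: "R \<in> borel_measurable P"
  proof -
    have "(\<lambda>x. ennreal ((\<lambda>(\<tau>, \<omega>). indicator {t..T} \<tau> * \<rho> \<tau> \<omega>) x) * ennreal (indicator {u..s} (fst x)))
        \<in> borel_measurable (lborel \<Otimes>\<^sub>M P)"
      using \<rho>_joint_meas unfolding joint_meas_def
      by (intro borel_measurable_times_ennreal measurable_compose[OF _ measurable_ennreal] indicator_fst_measurable) auto
    from nn_integral_time_measurable[OF this]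
    show ?thesis
      by (rule measurable_cong[THEN iffD1, rotated])
         (use u s in \<open>auto simp: R_def indicator_def intro!: nn_integral_cong\<close>)
  qed
  have sq: "(\<lambda>\<omega>. ennreal ((\<eta> \<omega>)\<^sup>2)) \<in> borel_measurable (F u)"
    using \<eta> by (intro measurable_compose[OF _ measurable_ennreal] borel_measurable_power)
  have "msq P (\<lambda>\<omega>. \<eta> \<omega> * (M s \<omega> - M u \<omega>))
      = (\<integral>\<^sup>+\<omega>. ennreal ((\<eta> \<omega>)\<^sup>2) * ennreal ((M s \<omega> - M u \<omega>)\<^sup>2) \<partial>P)"
    unfolding msq_def by (simp add: power_mult_distrib ennreal_mult)
  also have "\<dots> = (\<integral>\<^sup>+\<omega>. ennreal ((\<eta> \<omega>)\<^sup>2) * nn_cond_exp P (F u) (\<lambda>\<omega>. ennreal ((M s \<omega> - M u \<omega>)\<^sup>2)) \<omega> \<partial>P)"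
    by (rule nn_cond_exp_intg[symmetric, OF sq]) simp
  also have "\<dots> = (\<integral>\<^sup>+\<omega>. ennreal ((\<eta> \<omega>)\<^sup>2) * nn_cond_exp P (F u) R \<omega> \<partial>P)"
  proof (rule nn_integral_cong_AE)
    have "AE \<omega> in P. nn_cond_exp P (F u) (\<lambda>\<omega>. ennreal ((M s \<omega> - M u \<omega>)\<^sup>2)) \<omega> = nn_cond_exp P (F u) R \<omega>"
      using M_square[of u s] assms t_nonneg unfolding R_def by simp
    then show "AE \<omega> in P. ennreal ((\<eta> \<omega>)\<^sup>2) * nn_cond_exp P (F u) (\<lambda>\<omega>. ennreal ((M s \<omega> - M u \<omega>)\<^sup>2)) \<omega>
        = ennreal ((\<eta> \<omega>)\<^sup>2) * nn_cond_exp P (F u) R \<omega>"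
      by eventually_elim simp
  qed
  also have "\<dots> = (\<integral>\<^sup>+\<omega>. ennreal ((\<eta> \<omega>)\<^sup>2) * R \<omega> \<partial>P)"
    by (rule nn_cond_exp_intg[OF sq]) simp
  also have "\<dots> = (\<integral>\<^sup>+\<omega>. (\<integral>\<^sup>+\<tau>\<in>{u..<s}. ennreal ((\<eta> \<omega>)\<^sup>2 * \<rho> \<tau> \<omega>) \<partial>lborel) \<partial>P)"
  proof (rule nn_integral_cong)
    fix \<omega> assume "\<omega> \<in> space P"
    then have "ennreal ((\<eta> \<omega>)\<^sup>2) * R \<omega> = (\<integral>\<^sup>+\<tau>. ennreal ((\<eta> \<omega>)\<^sup>2) * (ennreal (\<rho> \<tau> \<omega>) * indicator {u..s} \<tau>) \<partial>lborel)"
      unfolding R_def by (intro nn_integral_cmult[symmetric] R_path)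
    \<comment> \<open>The closed interval in the assumption on M and the half-open one of a simple
      process differ by the point \<open>s\<close>, a Lebesgue null set.\<close>
    also have "\<dots> = (\<integral>\<^sup>+\<tau>\<in>{u..<s}. ennreal ((\<eta> \<omega>)\<^sup>2 * \<rho> \<tau> \<omega>) \<partial>lborel)"
    proof (rule nn_integral_cong_AE)
      show "AE \<tau> in lborel. ennreal ((\<eta> \<omega>)\<^sup>2) * (ennreal (\<rho> \<tau> \<omega>) * indicator {u..s} \<tau>)
          = ennreal ((\<eta> \<omega>)\<^sup>2 * \<rho> \<tau> \<omega>) * indicator {u..<s} \<tau>"
        using AE_lborel_singleton[of s] by eventually_elim (auto simp: indicator_def ennreal_mult')
    qed
    finally show "ennreal ((\<eta> \<omega>)\<^sup>2) * R \<omega> = (\<integral>\<^sup>+\<tau>\<in>{u..<s}. ennreal ((\<eta> \<omega>)\<^sup>2 * \<rho> \<tau> \<omega>) \<partial>lborel)" .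
  qed
  finally show ?thesis .
qed

text \<open>The product of \<open>S\<close> and \<open>\<eta>\<close> is known at time
  \<open>u\<close>, and the increment has conditional mean 0. Square integrability is assumed of
  \<open>S\<close> and of \<open>\<eta>\<close> times the increment, not of \<open>\<eta>\<close>
  and the increment separately; this suffices for the triple product to be integrable.\<close>

lemma increment_orthogonal:
  assumes "t \<le> u" "u < s" "s \<le> T" and \<eta>: "\<eta> \<in> borel_measurable (F u)"
    and S: "S \<in> borel_measurable (F u)" "square_integrable P S"
    and sq: "square_integrable P (\<lambda>\<omega>. \<eta> \<omega> * (M s \<omega> - M u \<omega>))"
  shows "(\<integral>\<omega>. S \<omega> * (\<eta> \<omega> * (M s \<omega> - M u \<omega>)) \<partial>P) = 0"
proof -
  have u: "u \<in> {t..T}" and s: "s \<in> {t..T}" using assms by auto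
  interpret sigma_finite_subalgebra P "F u" using sigma_finite_subalg[OF u] .
  have int: "integrable P (M u)" "integrable P (M s)" using M_integrable u s t_nonneg by auto
  note [measurable] = M_meas[OF u] M_meas[OF s]
  have "integrable P (\<lambda>\<omega>. (S \<omega> * \<eta> \<omega>) * (M s \<omega> - M u \<omega>))"
    using square_integrable_mult[OF S(2) sq] by (simp add: mult.assoc)
  then have "(\<integral>\<omega>. (S \<omega> * \<eta> \<omega>) * (M s \<omega> - M u \<omega>) \<partial>P)
      = (\<integral>\<omega>. (S \<omega> * \<eta> \<omega>) * real_cond_exp P (F u) (\<lambda>\<omega>. M s \<omega> - M u \<omega>) \<omega> \<partial>P)"
    using S(1) \<eta> by (intro real_cond_exp_intg(2)[symmetric] borel_measurable_times) auto
  also have "\<dots> = (\<integral>\<omega>. 0 \<partial>P)"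
  proof (rule integral_cong_AE)
    have "AE \<omega> in P. real_cond_exp P (F u) (\<lambda>\<omega>. M s \<omega> - M u \<omega>) \<omega> = 0"
    proof -
      have "AE \<omega> in P. real_cond_exp P (F u) (M s) \<omega> = M u \<omega>" "AE \<omega> in P. real_cond_exp P (F u) (M u) \<omega> = M u \<omega>"
        using M_martingale[of u s] M_martingale[of u u] u s t_nonneg assms(2) by auto
      with real_cond_exp_diff[OF int(2,1)] show ?thesis by eventually_elim simp
    qed
    then show "AE \<omega> in P. (S \<omega> * \<eta> \<omega>) * real_cond_exp P (F u) (\<lambda>\<omega>. M s \<omega> - M u \<omega>) \<omega> = 0"
      by eventually_elim simp
  qed (use measurable_F_P[OF \<eta> u] measurable_F_P[OF S(1) u] in auto)
  finally show ?thesis by (simp add: mult.assoc)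
qed

text \<open>The bound is kept in the norm weighted by \<rho>, because the step approximations in the
  definition of the martingale integral are only required to converge in that norm.\<close>

theorem sint_martingale_bound:
  assumes G: "simple Martingale G"
  shows "msq P (sint M G) \<le> weighted (proc G)"
    (is "_ \<le> ?W")
proof (cases "?W = \<infinity>")
  case False
  have "\<forall>(u, v, \<xi>)\<in>set G. t \<le> u \<and> u \<le> v \<and> v \<le> T" using G by (auto simp: simple_def)
  then obtain l where l: "sorted_wrt (<) l" "set l \<subseteq> {t..T}"
    "\<forall>(u, v, \<xi>)\<in>set G. u \<in> set l \<and> v \<in> set l \<and> u \<le> v"
    by (rule nodes_exist)
  have lT: "l ! i \<in> {t..T}" if "i < length l" for i using that l(2) nth_mem by blast
  have lless: "l ! i < l ! Suc i" if "Suc i < length l" for i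
    using l(1) that by (simp add: sorted_wrt_nth_less)
  define y where "y i \<omega> = proc G (l ! i) \<omega> * (M (l ! Suc i) \<omega> - M (l ! i) \<omega>)" for i \<omega>
  define w where "w i = (\<integral>\<^sup>+\<omega>. (\<integral>\<^sup>+\<tau>\<in>{l ! i..<l ! Suc i}. ennreal ((proc G \<tau> \<omega>)\<^sup>2 * \<rho> \<tau> \<omega>) \<partial>lborel) \<partial>P)" for i
  have y_w: "msq P (y i) = w i" if "Suc i < length l" for i
  proof -
    have "msq P (y i) = (\<integral>\<^sup>+\<omega>. (\<integral>\<^sup>+\<tau>\<in>{l ! i..<l ! Suc i}. ennreal ((proc G (l ! i) \<omega>)\<^sup>2 * \<rho> \<tau> \<omega>) \<partial>lborel) \<partial>P)"
      unfolding y_def using lT[of i] lT[of "Suc i"] lless[of i] that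
      by (intro increment_square proc_adapted[OF G]) auto
    also have "\<dots> = w i"
      unfolding w_def
    proof (intro nn_integral_cong)
      fix \<omega> \<tau>
      show "ennreal ((proc G (l ! i) \<omega>)\<^sup>2 * \<rho> \<tau> \<omega>) * indicator {l ! i..<l ! Suc i} \<tau>
          = ennreal ((proc G \<tau> \<omega>)\<^sup>2 * \<rho> \<tau> \<omega>) * indicator {l ! i..<l ! Suc i} \<tau>"
        using proc_nodes[OF l(1,3) that, of \<tau> \<omega>] by (cases "\<tau> \<in> {l ! i..<l ! Suc i}") simp_all
    qed
    finally show ?thesis .
  qed
  have sum_w: "(\<Sum>i<length l - 1. w i) \<le> ?W"
  proof -
    note meas = weighted_square_measurable[OF joint_meas_proc[OF G]]
    have "(\<lambda>\<omega>. \<integral>\<^sup>+\<tau>\<in>{l ! i..<l ! Suc i}. ennreal ((proc G \<tau> \<omega>)\<^sup>2 * \<rho> \<tau> \<omega>) \<partial>lborel) \<in> borel_measurable P"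
      if "i < length l - 1" for i
    proof -
      have i: "i < length l" "Suc i < length l" using that by auto
      have "(\<lambda>x. (\<lambda>(\<tau>, \<omega>). ennreal ((proc G \<tau> \<omega>)\<^sup>2 * \<rho> \<tau> \<omega>) * indicator {t..T} \<tau>) x * ennreal (indicator {l ! i..<l ! Suc i} (fst x)))
        \<in> borel_measurable (lborel \<Otimes>\<^sub>M P)"
        by (intro borel_measurable_times_ennreal meas measurable_compose[OF _ measurable_ennreal] indicator_fst_measurable) auto
      from nn_integral_time_measurable[OF this]
      show ?thesis
        by (rule measurable_cong[THEN iffD1, rotated])
           (use lT[OF i(1)] lT[OF i(2)] in \<open>auto simp: indicator_def intro!: nn_integral_cong\<close>)
    qed
    then have "(\<Sum>i<length l - 1. w i)
        = (\<integral>\<^sup>+\<omega>. (\<Sum>i<length l - 1. \<integral>\<^sup>+\<tau>\<in>{l ! i..<l ! Suc i}. ennreal ((proc G \<tau> \<omega>)\<^sup>2 * \<rho> \<tau> \<omega>) \<partial>lborel) \<partial>P)"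
      unfolding w_def by (intro nn_integral_sum[symmetric]) auto
    also have "\<dots> \<le> ?W"
      using measurable_Pair1[OF meas]
      by (intro nn_integral_mono sum_nodes_nn_integral_le[OF l(1,2)]) simp
    finally show ?thesis .
  qed
  \<comment> \<open>Here the assumption that the bound is finite enters: it makes each summand
    square integrable, as orthogonality demands.\<close>
  have w_fin: "w i < \<infinity>" if "Suc i < length l" for i
  proof -
    have "w i \<le> (\<Sum>i<length l - 1. w i)" using that by (intro member_le_sum) auto
    also note sum_w
    also have "?W < \<infinity>" using False by (simp add: top.not_eq_extremum)
    finally show ?thesis .
  qed
  have y_meas: "y i \<in> borel_measurable (F (l ! Suc i))" if "Suc i < length l" for i
    unfolding y_def using lT[of i] lT[of "Suc i"] lless[of i] that
    by (intro borel_measurable_times borel_measurable_diff M_meas_F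
        measurable_F_mono[OF M_meas_F, of "l ! i"] measurable_F_mono[OF proc_adapted[OF G], of "l ! i"]) auto
  have y_sq: "square_integrable P (y i)" if "Suc i < length l" for i
    using y_w[OF that] w_fin[OF that] measurable_F_P[OF y_meas[OF that] lT[OF that]]
    by (simp add: square_integrable_iff_msq)
  \<comment> \<open>Pythagoras by induction: the partial sum is known at node \<open>n\<close>,
    where the next increment starts.\<close>
  have "(\<lambda>\<omega>. \<Sum>i<n. y i \<omega>) \<in> borel_measurable (F (l ! n)) \<and> square_integrable P (\<lambda>\<omega>. \<Sum>i<n. y i \<omega>)
      \<and> msq P (\<lambda>\<omega>. \<Sum>i<n. y i \<omega>) \<le> (\<Sum>i<n. w i)" if "n < length l" for n
    using that
  proof (induction n)
    case 0
    then show ?case by (simp add: square_integrable_def)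
  next
    case (Suc n)
    let ?S = "\<lambda>\<omega>. \<Sum>i<n. y i \<omega>"
    have n: "n < length l" using Suc.prems by simp
    note S = Suc.IH[OF n, THEN conjunct1] Suc.IH[OF n, THEN conjunct2, THEN conjunct1]
    note nT = lT[OF n] lT[OF Suc.prems] lless[OF Suc.prems]
    have SF: "?S \<in> borel_measurable (F (l ! Suc n))"
      using measurable_F_mono[OF S(1)] nT by auto
    have orth: "(\<integral>\<omega>. ?S \<omega> * y n \<omega> \<partial>P) = 0"
      using nT S y_sq[OF Suc.prems] proc_adapted[OF G nT(1)]
      unfolding y_def by (intro increment_orthogonal) (auto simp: y_def)
    have sqS: "integrable P (\<lambda>\<omega>. (?S \<omega>)\<^sup>2)" and sqy: "integrable P (\<lambda>\<omega>. (y n \<omega>)\<^sup>2)"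
      using S(2) y_sq[OF Suc.prems] by (auto simp: square_integrable_def)
    note Sy = square_integrable_mult[OF S(2) y_sq[OF Suc.prems]]
    have exp: "(?S \<omega> + y n \<omega>)\<^sup>2 = (?S \<omega>)\<^sup>2 + (y n \<omega>)\<^sup>2 + 2 * (?S \<omega> * y n \<omega>)" for \<omega>
      by (simp add: power2_sum)
    have sq: "square_integrable P (\<lambda>\<omega>. ?S \<omega> + y n \<omega>)"
      using sqS sqy Sy S(2) y_sq[OF Suc.prems] unfolding square_integrable_def exp by auto
    have "msq P (\<lambda>\<omega>. ?S \<omega> + y n \<omega>) = ennreal ((\<integral>\<omega>. (?S \<omega>)\<^sup>2 \<partial>P) + (\<integral>\<omega>. (y n \<omega>)\<^sup>2 \<partial>P))"
      unfolding msq_eq_integral[OF sq] exp using sqS sqy Sy orth by simp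
    also have "\<dots> = msq P ?S + w n"
      unfolding y_w[OF Suc.prems, symmetric] msq_eq_integral[OF S(2)] msq_eq_integral[OF y_sq[OF Suc.prems]]
      by (simp add: ennreal_plus)
    finally have "msq P (\<lambda>\<omega>. ?S \<omega> + y n \<omega>) = msq P ?S + w n" .
    then have le: "msq P (\<lambda>\<omega>. ?S \<omega> + y n \<omega>) \<le> (\<Sum>i<Suc n. w i)"
      using Suc.IH[OF n] by (simp add: add_right_mono)
    show ?case
      using SF y_meas[OF Suc.prems] sq le
      by (simp add: borel_measurable_add)
  qed
  then have "msq P (\<lambda>\<omega>. \<Sum>i<length l - 1. y i \<omega>) \<le> (\<Sum>i<length l - 1. w i)" if "l \<noteq> []"
    using that by simp
  then have "msq P (\<lambda>\<omega>. \<Sum>i<length l - 1. y i \<omega>) \<le> (\<Sum>i<length l - 1. w i)" by (cases "l = []") auto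
  moreover have "sint M G = (\<lambda>\<omega>. \<Sum>i<length l - 1. y i \<omega>)"
    by (simp add: fun_eq_iff y_def sint_nodes[OF l(1,3)])
  ultimately show ?thesis using sum_w by simp
qed simp

lemma sint_time_bound:
  assumes G: "simple Time G"
  shows "msq P (sint (\<lambda>\<tau> \<omega>. \<tau>) G) \<le> ennreal (T - t) * msq_int (proc G)"
proof -
  have "\<forall>(u, v, \<xi>)\<in>set G. t \<le> u \<and> u \<le> v \<and> v \<le> T" using G by (auto simp: simple_def)
  then obtain l where l: "sorted_wrt (<) l" "set l \<subseteq> {t..T}"
    "\<forall>(u, v, \<xi>)\<in>set G. u \<in> set l \<and> v \<in> set l \<and> u \<le> v"
    by (rule nodes_exist)
  define n where "n = length l - 1"
  define \<Delta> where "\<Delta> i = l ! Suc i - l ! i" for i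
  have \<Delta>: "0 \<le> \<Delta> i" if "i < n" for i
    using l(1) that by (simp add: sorted_wrt_nth_less n_def \<Delta>_def less_imp_le)
  have \<Delta>_sum: "(\<Sum>i<n. \<Delta> i) \<le> T - t"
  proof (cases "l = []")
    case False
    have "l ! i \<in> {t..T}" if "i < length l" for i using that l(2) nth_mem by blast
    from this[of n] this[of 0] False have "l ! n \<in> {t..T}" "l ! 0 \<in> {t..T}" by (simp_all add: n_def)
    then show ?thesis by (simp add: \<Delta>_def sum_lessThan_telescope[of "\<lambda>i. l ! i"])
  qed (use t_less in \<open>simp add: n_def\<close>)
  have [measurable]: "proc G \<tau> \<in> borel_measurable P" for \<tau> using proc_meas[OF G] .
  \<comment> \<open>Each weight is split into two square roots; the first factor then sums to at
    most \<open>T - t\<close>, the origin of the constant.\<close>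
  have cs: "(\<Sum>i<n. x i * \<Delta> i)\<^sup>2 \<le> (T - t) * (\<Sum>i<n. (x i)\<^sup>2 * \<Delta> i)" for x :: "nat \<Rightarrow> real"
  proof -
    have "(\<Sum>i<n. x i * \<Delta> i)\<^sup>2 = (\<Sum>i<n. sqrt (\<Delta> i) * (x i * sqrt (\<Delta> i)))\<^sup>2"
      using \<Delta> by (intro arg_cong[where f = "\<lambda>x. x\<^sup>2"] sum.cong) (auto simp: mult_ac)
    also have "\<dots> \<le> (\<Sum>i<n. (sqrt (\<Delta> i))\<^sup>2) * (\<Sum>i<n. (x i * sqrt (\<Delta> i))\<^sup>2)"
      by (rule Cauchy_Schwarz_ineq_sum)
    also have "\<dots> = (\<Sum>i<n. \<Delta> i) * (\<Sum>i<n. (x i)\<^sup>2 * \<Delta> i)"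
      using \<Delta> by (simp add: power_mult_distrib)
    also have "\<dots> \<le> (T - t) * (\<Sum>i<n. (x i)\<^sup>2 * \<Delta> i)"
      using \<Delta> \<Delta>_sum by (intro mult_right_mono sum_nonneg) auto
    finally show ?thesis .
  qed
  have "msq P (sint (\<lambda>\<tau> \<omega>. \<tau>) G)
      \<le> (\<integral>\<^sup>+\<omega>. ennreal (T - t) * (\<Sum>i<n. ennreal (\<Delta> i) * ennreal ((proc G (l ! i) \<omega>)\<^sup>2)) \<partial>P)"
    unfolding msq_def
  proof (rule nn_integral_mono)
    fix \<omega>
    have "ennreal ((sint (\<lambda>\<tau> \<omega>. \<tau>) G \<omega>)\<^sup>2) \<le> ennreal ((T - t) * (\<Sum>i<n. (proc G (l ! i) \<omega>)\<^sup>2 * \<Delta> i))"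
      using cs[of "\<lambda>i. proc G (l ! i) \<omega>"]
      by (intro ennreal_leI) (simp add: sint_nodes[OF l(1,3)] n_def \<Delta>_def)
    also have "\<dots> = ennreal (T - t) * (\<Sum>i<n. ennreal ((proc G (l ! i) \<omega>)\<^sup>2 * \<Delta> i))"
      using t_less \<Delta> by (subst sum_ennreal) (auto simp: ennreal_mult')
    also have "\<dots> = ennreal (T - t) * (\<Sum>i<n. ennreal (\<Delta> i) * ennreal ((proc G (l ! i) \<omega>)\<^sup>2))"
      using \<Delta> by (intro arg_cong2[where f = "(*)"] sum.cong refl) (simp add: ennreal_mult mult.commute)
    finally show "ennreal ((sint (\<lambda>\<tau> \<omega>. \<tau>) G \<omega>)\<^sup>2)
      \<le> ennreal (T - t) * (\<Sum>i<n. ennreal (\<Delta> i) * ennreal ((proc G (l ! i) \<omega>)\<^sup>2))" .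
  qed
  also have "\<dots> = ennreal (T - t) * (\<Sum>i<n. ennreal (\<Delta> i) * msq P (proc G (l ! i)))"
    unfolding msq_def by (simp add: nn_integral_cmult nn_integral_sum)
  also have "(\<Sum>i<n. ennreal (\<Delta> i) * msq P (proc G (l ! i)))
      = (\<Sum>i<n. \<integral>\<^sup>+\<tau>\<in>{l ! i..<l ! Suc i}. msq P (proc G \<tau>) \<partial>lborel)"
  proof (rule sum.cong)
    fix i assume "i \<in> {..<n}"
    then have i: "Suc i < length l" and le: "l ! i \<le> l ! Suc i" using \<Delta>[of i] by (auto simp: n_def \<Delta>_def)
    have "(\<integral>\<^sup>+\<tau>\<in>{l ! i..<l ! Suc i}. msq P (proc G \<tau>) \<partial>lborel)
        = (\<integral>\<^sup>+\<tau>. msq P (proc G (l ! i)) * indicator {l ! i..<l ! Suc i} \<tau> \<partial>lborel)"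
    proof (intro nn_integral_cong)
      fix \<tau>
      show "msq P (proc G \<tau>) * indicator {l ! i..<l ! Suc i} \<tau>
          = msq P (proc G (l ! i)) * indicator {l ! i..<l ! Suc i} \<tau>"
        using proc_nodes[OF l(1,3) i, of \<tau>] by (cases "\<tau> \<in> {l ! i..<l ! Suc i}") (simp_all add: msq_def)
    qed
    also have "\<dots> = ennreal (\<Delta> i) * msq P (proc G (l ! i))"
      using le by (simp add: nn_integral_cmult_indicator \<Delta>_def mult.commute)
    finally show "ennreal (\<Delta> i) * msq P (proc G (l ! i))
        = (\<integral>\<^sup>+\<tau>\<in>{l ! i..<l ! Suc i}. msq P (proc G \<tau>) \<partial>lborel)" by simp
  qed simp
  also have "\<dots> \<le> msq_int (proc G)"
    unfolding msq_int_def n_def using joint_meas_msq[OF joint_meas_proc[OF G]]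
    by (intro sum_nodes_nn_integral_le[OF l(1,2)]) simp
  finally show ?thesis by (simp add: mult_left_mono)
qed

text \<open>One constant above both K, from the bound on \<rho>, and \<open>T - t\<close>, from
  Cauchy-Schwarz in time, so that later estimates need not distinguish the integrators.\<close>

definition C where "C = ennreal (K + (T - t))"

lemma C_finite: "C < \<infinity>" by (simp add: C_def)

theorem sint_bound:
  assumes "simple c G"
  shows "msq P (sint (Z c) G) \<le> C * msq_int (proc G)"
proof (cases c)
  case Martingale
  with assms have "msq P (sint M G) \<le> ennreal K * msq_int (proc G)"
    using sint_martingale_bound weighted_square_le[OF joint_meas_proc[OF assms]] by (auto intro: order_trans)
  also have "\<dots> \<le> C * msq_int (proc G)" unfolding C_def using t_less by (intro mult_right_mono ennreal_leI) auto
  finally show ?thesis by (simp add: Martingale)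
next
  case Time
  with assms have "msq P (sint (\<lambda>\<tau> \<omega>. \<tau>) G) \<le> ennreal (T - t) * msq_int (proc G)"
    using sint_time_bound by auto
  also have "\<dots> \<le> C * msq_int (proc G)" unfolding C_def using K_nonneg by (intro mult_right_mono ennreal_leI) auto
  finally show ?thesis by (simp add: Time)
qed

end

section \<open>Partitions\<close>

abbreviation reversed_sum :: "(real \<Rightarrow> 'a \<Rightarrow> real) \<Rightarrow> (real \<Rightarrow> 'a \<Rightarrow> real) \<Rightarrow> (real \<Rightarrow> 'a \<Rightarrow> real) \<Rightarrow> real list \<Rightarrow> 'a \<Rightarrow> real" where
  "reversed_sum g Z R p \<equiv> (\<lambda>\<omega>. \<Sum>l<length p - 1. g (p ! l) \<omega> * (Z (p ! Suc l) \<omega> - Z (p ! l) \<omega>) * R (p ! Suc l) \<omega>)"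

lemma partition_nth:
  assumes "partition_on_interval a b p"
  shows "p ! 0 = a" "p ! (length p - 1) = b" "0 < length p"
  using assms by (auto simp: partition_on_interval_def hd_conv_nth last_conv_nth)

lemma partition_nth_less:
  assumes "partition_on_interval a b p" "j < length p - 1"
  shows "p ! j < p ! Suc j"
  using assms sorted_wrt_nth_less[of "(<)" p j "Suc j"] by (simp add: partition_on_interval_def)

lemma partition_nth_bounds:
  assumes "partition_on_interval a b p" "j < length p"
  shows "a \<le> p ! j" "p ! j \<le> b"
  using sorted_wrt_nth_le_iff[of p 0 j] sorted_wrt_nth_le_iff[of p j "length p - 1"] partition_nth[OF assms(1)] assms
  by (auto simp: partition_on_interval_def)

lemma partition_Suc_bounds:
  assumes "partition_on_interval a b p" "j < length p - 1"
  shows "p ! j \<in> {a..b}" "p ! Suc j \<in> {a..b}"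
proof -
  have "j < length p" "Suc j < length p" using assms(2) by linarith+
  then show "p ! j \<in> {a..b}" "p ! Suc j \<in> {a..b}" using partition_nth_bounds[OF assms(1)] by auto
qed

lemma partition_gap_le_mesh:
  assumes "j < length p - 1"
  shows "p ! Suc j - p ! j \<le> mesh p"
  unfolding mesh_def using assms by (intro Max_ge) auto

lemma partition_locate:
  assumes "partition_on_interval a b p" "a \<le> \<sigma>" "\<sigma> < b"
  obtains j where "j < length p - 1" "p ! j \<le> \<sigma>" "\<sigma> < p ! Suc j"
proof -
  let ?Q = "\<lambda>j. j < length p \<and> p ! j \<le> \<sigma>"
  have 0: "?Q 0" using partition_nth[OF assms(1)] assms(2) by auto
  have bnd: "\<And>j. ?Q j \<Longrightarrow> j \<le> length p" by simp
  define j where "j = Greatest ?Q"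
  have j: "?Q j" unfolding j_def using 0 bnd by (rule GreatestI_nat)
  have "j \<noteq> length p - 1" using j partition_nth[OF assms(1)] assms(3) by auto
  then have j': "j < length p - 1" using j by linarith
  have "\<not> ?Q (Suc j)" using Greatest_le_nat[of ?Q "Suc j" "length p"] bnd by (auto simp: j_def)
  then show ?thesis using that[of j] j j' by auto
qed

lemma partition_seq_exists:
  assumes "a \<le> b"
  obtains p where "partition_seq a b p"
proof (cases "a = b")
  case True
  then have "partition_seq a b (\<lambda>n. [a])"
    by (simp add: partition_seq_def partition_on_interval_def mesh_def)
  then show ?thesis by (rule that)
next
  case False
  with assms have ab: "a < b" by simp
  define x where "x n i = a + (b - a) * real i / real (Suc n)" for n i
  \<comment> \<open>With \<open>n + 2\<close> nodes there is at least one subinterval for every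
    \<open>n\<close>, including 0, and the spacing is \<open>(b - a) / Suc n\<close>.\<close>
  define p where "p n = map (x n) [0..<n + 2]" for n
  have len: "length (p n) = n + 2" for n by (simp add: p_def)
  have nth: "p n ! i = x n i" if "i < n + 2" for n i
    using that unfolding p_def by (simp only: nth_map_upt diff_zero add_0)
  have x_Suc: "x n (Suc i) - x n i = (b - a) / real (Suc n)" for n i
  proof -
    have "(b - a) * real (Suc i) - (b - a) * real i = b - a" by (simp add: algebra_simps)
    then show ?thesis unfolding x_def by (simp only: add_diff_cancel_left diff_divide_distrib[symmetric])
  qed
  have mesh: "mesh (p n) \<le> (b - a) / real (Suc n)" for n
    unfolding mesh_def using ab by (auto simp: len nth x_Suc)
  have mesh0: "0 \<le> mesh (p n)" for n unfolding mesh_def by simp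
  have "(\<lambda>n. (b - a) / real (Suc n)) \<longlonglongrightarrow> 0"
    by (rule lim_const_over_n[THEN LIMSEQ_Suc])
  then have "(\<lambda>n. mesh (p n)) \<longlonglongrightarrow> 0"
    by (rule tendsto_sandwich[OF _ _ tendsto_const, rotated 2]) (intro always_eventually allI mesh mesh0)+
  moreover have "partition_on_interval a b (p n)" for n
  proof -
    have mono: "x n i < x n j" if "i < j" for i j
      using that ab by (auto simp: x_def divide_strict_right_mono)
    have "(b - a) * real (Suc n) / real (Suc n) = b - a" by (rule nonzero_mult_div_cancel_right) simp
    then have x_last: "x n (Suc n) = b" unfolding x_def by linarith
    have "p n \<noteq> []" by (simp add: p_def)
    moreover have "hd (p n) = a"
      using nth[of 0 n] len[of n] \<open>p n \<noteq> []\<close> by (simp add: hd_conv_nth x_def)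
    moreover have "last (p n) = b"
      using nth[of "Suc n" n] len[of n] \<open>p n \<noteq> []\<close>
      by (simp add: last_conv_nth x_last)
    moreover have "sorted_wrt (<) (p n)"
      using mono by (auto simp: sorted_wrt_iff_nth_less len nth)
    ultimately show ?thesis by (simp add: partition_on_interval_def)
  qed
  ultimately show ?thesis by (intro that[of p]) (simp add: partition_seq_def)
qed

text \<open>The cut-off \<open>\<tau>\<^sub>0\<close> makes one partition of \<open>[a,T]\<close> serve the integrals up to every time
  \<open>\<tau>\<^sub>0 \<le> T\<close>, as needed for the jump process in the reversal of the order of integration.\<close>

definition riemann :: "real list \<Rightarrow> (nat \<Rightarrow> real) \<Rightarrow> real \<Rightarrow> (real \<Rightarrow> 'a \<Rightarrow> real) \<Rightarrow> 'a simple" where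
  "riemann p x \<tau>\<^sub>0 f = map (\<lambda>j. (p ! j, p ! Suc j, f (x j))) (filter (\<lambda>j. p ! Suc j \<le> \<tau>\<^sub>0) [0..<length p - 1])"

lemma proc_riemann_sum:
  "proc (riemann p x \<tau>\<^sub>0 f) \<sigma> \<omega> =
    (\<Sum>j<length p - 1. if p ! Suc j \<le> \<tau>\<^sub>0 then indicator {p ! j..<p ! Suc j} \<sigma> * f (x j) \<omega> else 0)"
  unfolding proc_def riemann_def
  by (simp add: comp_def sum_list_map_filter' interv_sum_list_conv_sum_set_nat atLeast0LessThan)

lemma sint_riemann_sum:
  "sint Z (riemann p x \<tau>\<^sub>0 f) \<omega> =
    (\<Sum>j<length p - 1. if p ! Suc j \<le> \<tau>\<^sub>0 then f (x j) \<omega> * (Z (p ! Suc j) \<omega> - Z (p ! j) \<omega>) else 0)"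
  unfolding sint_def riemann_def
  by (simp add: comp_def sum_list_map_filter' interv_sum_list_conv_sum_set_nat atLeast0LessThan)

lemma sint_riemann_full:
  assumes "partition_on_interval a b p" "b \<le> \<tau>\<^sub>0"
  shows "sint Z (riemann p x \<tau>\<^sub>0 f) \<omega> = (\<Sum>j<length p - 1. f (x j) \<omega> * (Z (p ! Suc j) \<omega> - Z (p ! j) \<omega>))"
  unfolding sint_riemann_sum
  by (intro sum.cong if_P order_trans[OF partition_nth_bounds(2)[OF assms(1)] assms(2)]) auto

text \<open>Subintervals of a partition are disjoint, so at most one summand survives; it is missing
  when its interval ends after the cut-off.\<close>

lemma proc_riemann_eq:
  assumes p: "partition_on_interval a b p" and j: "j < length p - 1" "p ! j \<le> \<sigma>" "\<sigma> < p ! Suc j"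
  shows "proc (riemann p x \<tau>\<^sub>0 f) \<sigma> \<omega> = (if p ! Suc j \<le> \<tau>\<^sub>0 then f (x j) \<omega> else 0)"
proof -
  have sorted: "sorted_wrt (<) p" using p by (simp add: partition_on_interval_def)
  have "\<sigma> \<notin> {p ! i..<p ! Suc i}" if "i < length p - 1" "i \<noteq> j" for i
  proof (cases "i < j")
    case True
    then have "p ! Suc i \<le> p ! j" using sorted_wrt_nth_le_iff[OF sorted, of "Suc i" j] that j by auto
    then show ?thesis using j by auto
  next
    case False
    then have "p ! Suc j \<le> p ! i" using sorted_wrt_nth_le_iff[OF sorted, of "Suc j" i] that j by auto
    then show ?thesis using j by auto
  qed
  then have "proc (riemann p x \<tau>\<^sub>0 f) \<sigma> \<omega> =
      (\<Sum>i\<in>{j}. if p ! Suc i \<le> \<tau>\<^sub>0 then indicator {p ! i..<p ! Suc i} \<sigma> * f (x i) \<omega> else 0)"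
    unfolding proc_riemann_sum using j by (intro sum.mono_neutral_right) auto
  then show ?thesis using j by simp
qed

lemma proc_riemann_outside:
  assumes p: "partition_on_interval a b p" and "\<sigma> < a \<or> \<tau>\<^sub>0 \<le> \<sigma> \<or> b \<le> \<sigma>"
  shows "proc (riemann p x \<tau>\<^sub>0 f) \<sigma> \<omega> = 0"
  unfolding proc_riemann_sum
proof (intro sum.neutral ballI)
  fix j assume "j \<in> {..<length p - 1}"
  then have j: "j < length p" "Suc j < length p" by auto
  show "(if p ! Suc j \<le> \<tau>\<^sub>0 then indicator {p ! j..<p ! Suc j} \<sigma> * f (x j) \<omega> else 0) = 0"
    using assms(2) partition_nth_bounds[OF p j(1)] partition_nth_bounds[OF p j(2)] by (auto simp: indicator_def)
qed

section \<open>The integral of a process in the closure of the simple processes\<close>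

context bounded_martingale_setting
begin

lemma msq_int_minus_commute: "msd_int f g = msd_int g f"
  unfolding msq_int_def by (subst msq_minus_commute) simp

lemma msq_int_cong_AE:
  assumes "\<And>\<tau>. \<tau> \<in> {t..T} \<Longrightarrow> AE \<omega> in P. f \<tau> \<omega> = g \<tau> \<omega>"
  shows "msq_int f = msq_int g"
  unfolding msq_int_def by (intro nn_integral_cong) (use assms in \<open>auto simp: indicator_def intro!: msq_cong_AE\<close>)

lemma msq_int_le_const:
  assumes "\<And>\<tau>. \<tau> \<in> {t..T} \<Longrightarrow> msq P (f \<tau>) \<le> ennreal B * indicator {u..<v} \<tau>" "u \<le> v"
  shows "msq_int f \<le> ennreal B * ennreal (v - u)"
proof -
  have "msq_int f \<le> (\<integral>\<^sup>+\<tau>. ennreal B * indicator {u..<v} \<tau> \<partial>lborel)"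
    unfolding msq_int_def
  proof (rule nn_integral_mono)
    fix \<tau>
    show "msq P (f \<tau>) * indicator {t..T} \<tau> \<le> ennreal B * indicator {u..<v} \<tau>"
      using assms(1)[of \<tau>] by (cases "\<tau> \<in> {t..T}") simp_all
  qed
  also have "\<dots> = ennreal B * ennreal (v - u)"
    using assms(2) by (simp add: nn_integral_cmult_indicator)
  finally show ?thesis .
qed

lemma sint_diff_bound:
  assumes "simple c G" "simple c H"
  shows "msd P (sint (Z c) G) (sint (Z c) H) \<le> C * msd_int (proc G) (proc H)"
proof -
  have "simple c (G @ scale (-1) H)" using assms by simp
  moreover have "sint (Z c) (G @ scale (-1) H) = (\<lambda>\<omega>. sint (Z c) G \<omega> - sint (Z c) H \<omega>)"
    "proc (G @ scale (-1) H) = (\<lambda>\<tau> \<omega>. proc G \<tau> \<omega> - proc H \<tau> \<omega>)"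
    by (simp_all add: fun_eq_iff)
  ultimately show ?thesis using sint_bound[of c "G @ scale (-1) H"] by simp
qed

definition approximates :: "integrator \<Rightarrow> (nat \<Rightarrow> 'a simple) \<Rightarrow> (real \<Rightarrow> 'a \<Rightarrow> real) \<Rightarrow> bool" where
  "approximates c G f \<longleftrightarrow> (\<forall>n. simple c (G n)) \<and> (\<lambda>n. msd_int (proc (G n)) f) \<longlonglongrightarrow> 0"

definition integrand :: "integrator \<Rightarrow> (real \<Rightarrow> 'a \<Rightarrow> real) \<Rightarrow> bool" where
  "integrand c f \<longleftrightarrow> joint_meas f \<and> msq_int f < \<infinity> \<and> (\<exists>G. approximates c G f)"

text \<open>\<open>X\<close> is a version of the stochastic integral of \<open>f\<close> over \<open>[t,T]\<close>; integrals over \<open>[t,s]\<close> are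
  integrals of the truncation \<open>cut t s f\<close>.\<close>

definition SI :: "integrator \<Rightarrow> (real \<Rightarrow> 'a \<Rightarrow> real) \<Rightarrow> ('a \<Rightarrow> real) \<Rightarrow> bool" where
  "SI c f X \<longleftrightarrow> square_integrable P X \<and>
    (\<forall>G. approximates c G f \<longrightarrow> (\<lambda>n. msd P (sint (Z c) (G n)) X) \<longlonglongrightarrow> 0)"

lemma SI_square: "SI c f X \<Longrightarrow> square_integrable P X"
  by (simp add: SI_def)

lemma SI_meas: "SI c f X \<Longrightarrow> X \<in> borel_measurable P"
  by (simp add: SI_def square_integrable_def)

lemma approximates_cong:
  assumes "\<And>\<tau>. \<tau> \<in> {t..T} \<Longrightarrow> AE \<omega> in P. f \<tau> \<omega> = g \<tau> \<omega>"
  shows "approximates c G f \<longleftrightarrow> approximates c G g"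
proof -
  have "msd_int (proc (G n)) f = msd_int (proc (G n)) g" for n
  proof (rule msq_int_cong_AE)
    fix \<tau> assume "\<tau> \<in> {t..T}"
    from assms[OF this] show "AE \<omega> in P. proc (G n) \<tau> \<omega> - f \<tau> \<omega> = proc (G n) \<tau> \<omega> - g \<tau> \<omega>"
      by eventually_elim simp
  qed
  then show ?thesis unfolding approximates_def by simp
qed

lemma SI_cong:
  assumes "\<And>\<tau>. \<tau> \<in> {t..T} \<Longrightarrow> AE \<omega> in P. f \<tau> \<omega> = g \<tau> \<omega>"
  shows "SI c f X \<longleftrightarrow> SI c g X"
  unfolding SI_def using approximates_cong[OF assms] by simp

text \<open>For two members of one approximating sequence this gives the Cauchy property, for two
  sequences independence of the choice, and with the empty list as \<open>H\<close> a bound on a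
  single integral.\<close>

lemma sint_dist_approximates:
  assumes "joint_meas f" "simple c G" "simple c H"
  shows "msd P (sint (Z c) G) (sint (Z c) H)
    \<le> (2 * C) * msd_int (proc G) f + (2 * C) * msd_int (proc H) f"
proof -
  have "msd P (sint (Z c) G) (sint (Z c) H) \<le> C * msd_int (proc G) (proc H)"
    by (rule sint_diff_bound[OF assms(2,3)])
  also have "\<dots> \<le> C * (2 * msd_int (proc G) f + 2 * msd_int (proc H) f)"
    using msq_int_triangle[OF joint_meas_proc[OF assms(2)] assms(1) joint_meas_proc[OF assms(3)]]
    by (intro mult_left_mono) (simp_all add: msq_int_minus_commute[of f])
  also have "\<dots> = (2 * C) * msd_int (proc G) f + (2 * C) * msd_int (proc H) f"
    by (simp add: ring_distribs mult_ac)
  finally show ?thesis .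
qed

lemma two_C_finite: "2 * C < \<infinity>"
  using C_finite by (simp add: ennreal_mult_less_top)

text \<open>\<open>N\<close> is kept general so that the integral up to time \<open>s\<close> can be
  given an \<open>F s\<close>-measurable version.\<close>

lemma SI_exists:
  assumes f: "joint_meas f" "msq_int f < \<infinity>" and G: "approximates c G f"
    and N: "subalgebra P N" "\<And>n. sint (Z c) (G n) \<in> borel_measurable N"
  shows "\<exists>X\<in>borel_measurable N. SI c f X"
proof -
  have sG: "simple c (G n)" for n using G by (simp add: approximates_def)
  define a where "a n = (2 * C) * msd_int (proc (G n)) f" for n
  have a: "a \<longlonglongrightarrow> 0"
    using G ennreal_tendsto_cmult[OF two_C_finite[unfolded infinity_ennreal_def]]
    unfolding a_def approximates_def by force
  note sm [measurable] = sint_meas[OF sG]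
  have "\<exists>m0. \<forall>m\<ge>m0. \<forall>n\<ge>m0. msd P (sint (Z c) (G m)) (sint (Z c) (G n)) \<le> ennreal e" if "0 < e" for e
  proof -
    have "eventually (\<lambda>n. a n < ennreal (e/2)) sequentially"
      using a that unfolding ennreal_tendsto_0_iff_real by simp
    then obtain m0 where m0: "\<And>n. n \<ge> m0 \<Longrightarrow> a n < ennreal (e/2)" by (auto simp: eventually_sequentially)
    have "msd P (sint (Z c) (G m)) (sint (Z c) (G n)) \<le> ennreal e" if "m \<ge> m0" "n \<ge> m0" for m n
    proof -
      have "msd P (sint (Z c) (G m)) (sint (Z c) (G n)) \<le> a m + a n"
        unfolding a_def by (rule sint_dist_approximates[OF f(1) sG sG])
      also have "\<dots> \<le> ennreal (e/2) + ennreal (e/2)"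
        using m0 that by (intro add_mono less_imp_le)
      also have "\<dots> = ennreal e" using \<open>0 < e\<close> by (simp flip: ennreal_plus)
      finally show ?thesis .
    qed
    then show ?thesis by blast
  qed
  from msq_complete[OF prob_space_axioms N this]
  obtain X where X: "X \<in> borel_measurable N" "(\<lambda>n. msd P (sint (Z c) (G n)) X) \<longlonglongrightarrow> 0" by auto
  have [measurable]: "X \<in> borel_measurable P" using measurable_from_subalg[OF N(1) X(1)] .
  have "(\<lambda>n. msd P (sint (Z c) (H n)) X) \<longlonglongrightarrow> 0" if H: "approximates c H f" for H
  proof -
    have sH: "simple c (H n)" for n using H by (simp add: approximates_def)
    note [measurable] = sint_meas[OF sH]
    have "(\<lambda>n. msd P (sint (Z c) (H n)) (sint (Z c) (G n))) \<longlonglongrightarrow> 0"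
      by (rule ennreal_tendsto_0_le[OF ennreal_tendsto_0_lincomb sint_dist_approximates[OF f(1) sH sG]])
         (use G H two_C_finite in \<open>auto simp: approximates_def\<close>)
    then show ?thesis
      by (rule ennreal_tendsto_0_le[OF ennreal_tendsto_0_lincomb[OF _ X(2)] msq_triangle]) auto
  qed
  moreover have "msq P X < \<infinity>"
  proof -
    have "eventually (\<lambda>n. a n < ennreal 1 \<and> msd P (sint (Z c) (G n)) X < ennreal 1) sequentially"
      using a X(2) by (intro eventually_conj order_tendstoD(2)) auto
    then obtain n where n: "a n < 1" "msd P (sint (Z c) (G n)) X < 1"
      by (auto simp: eventually_sequentially)
    have "msq P (sint (Z c) (G n)) \<le> a n + (2 * C) * msq_int f"
      using sint_dist_approximates[OF f(1) sG[of n] simple_Nil] msq_int_minus_commute[of "\<lambda>\<tau> \<omega>. 0" f]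
      by (simp add: a_def)
    also have "\<dots> < \<infinity>"
      using order.strict_trans[OF n(1), of \<infinity>] ennreal_mult_less_top[of "2 * C" "msq_int f"] f(2) two_C_finite by simp
    finally have "msq P (sint (Z c) (G n)) < \<infinity>" .
    moreover have "msd P X (sint (Z c) (G n)) < \<infinity>"
      using order.strict_trans[OF n(2), of \<infinity>] by (simp add: msq_minus_commute[of P X])
    ultimately show ?thesis
      using msq_add_le[of "\<lambda>\<omega>. X \<omega> - sint (Z c) (G n) \<omega>" P "sint (Z c) (G n)"]
      by (simp add: ennreal_mult_less_top order.strict_trans1)
  qed
  ultimately have "SI c f X" by (simp add: SI_def square_integrable_iff_msq)
  with X(1) show ?thesis by blast
qed

lemma SI_unique:
  assumes "integrand c f" "SI c f X" "SI c f Y"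
  shows "AE \<omega> in P. X \<omega> = Y \<omega>"
proof -
  obtain G where "approximates c G f" using assms(1) by (auto simp: integrand_def)
  then show ?thesis using assms(2,3)
    by (intro msq_tendsto_unique[of "\<lambda>n. sint (Z c) (G n)"])
       (auto simp: SI_def square_integrable_def approximates_def intro: sint_meas)
qed

text \<open>One factor 2 comes from passing from \<open>X\<close> to an approximating sum, the other
  from passing from that sum to \<open>f\<close>.\<close>

lemma SI_bound:
  assumes "integrand c f" "SI c f X"
  shows "msq P X \<le> (4 * C) * msq_int f"
proof -
  obtain G where G: "approximates c G f" using assms(1) by (auto simp: integrand_def)
  have f: "joint_meas f" using assms(1) by (simp add: integrand_def)
  have sG: "simple c (G n)" for n using G by (simp add: approximates_def)
  note [measurable] = sint_meas[OF sG] SI_meas[OF assms(2)]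
  define d where "d n = msd P (sint (Z c) (G n)) X" for n
  define a where "a n = msd_int (proc (G n)) f" for n
  have lim: "(\<lambda>n. 2 * d n + (4 * C) * a n) \<longlonglongrightarrow> 0"
    using G assms(2) C_finite unfolding d_def a_def SI_def approximates_def
    by (intro ennreal_tendsto_0_lincomb) (auto simp: ennreal_mult_less_top)
  have "msq P X \<le> (2 * d n + (4 * C) * a n) + (4 * C) * msq_int f" for n
  proof -
    have "msq P X \<le> 2 * d n + 2 * msq P (sint (Z c) (G n))"
      using msq_add_le[of "\<lambda>\<omega>. X \<omega> - sint (Z c) (G n) \<omega>" P "sint (Z c) (G n)"]
      by (simp add: d_def msq_minus_commute[of P X])
    also have "\<dots> \<le> 2 * d n + 2 * ((2 * C) * a n + (2 * C) * msq_int f)"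
      using sint_dist_approximates[OF f sG[of n] simple_Nil] msq_int_minus_commute[of "\<lambda>\<tau> \<omega>. 0" f]
      by (intro add_left_mono mult_left_mono) (simp_all add: a_def)
    also have "\<dots> = (2 * d n + (4 * C) * a n) + (4 * C) * msq_int f"
      by (simp add: ring_distribs mult_ac add_ac)
    finally show ?thesis .
  qed
  moreover have "(\<lambda>n. (2 * d n + (4 * C) * a n) + (4 * C) * msq_int f) \<longlonglongrightarrow> 0 + (4 * C) * msq_int f"
    by (intro tendsto_add lim tendsto_const)
  ultimately show ?thesis by (intro LIMSEQ_le_const) auto
qed

lemma integrand_SI_diff:
  assumes f: "integrand c f" and g: "integrand c g" and X: "SI c f X" and Y: "SI c g Y"
  shows "integrand c (\<lambda>\<tau> \<omega>. f \<tau> \<omega> - g \<tau> \<omega>)" "SI c (\<lambda>\<tau> \<omega>. f \<tau> \<omega> - g \<tau> \<omega>) (\<lambda>\<omega>. X \<omega> - Y \<omega>)"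
proof -
  obtain Gf Gg where G: "approximates c Gf f" "approximates c Gg g" using f g by (auto simp: integrand_def)
  have s: "simple c (Gf n)" "simple c (Gg n)" for n using G by (auto simp: approximates_def)
  have jf: "joint_meas f" and jg: "joint_meas g" using f g by (auto simp: integrand_def)
  have "(\<lambda>n. msq_int (\<lambda>\<tau> \<omega>. proc (Gf n @ scale (-1) (Gg n)) \<tau> \<omega> - (f \<tau> \<omega> - g \<tau> \<omega>))) \<longlonglongrightarrow> 0"
  proof (rule ennreal_tendsto_0_le[OF ennreal_tendsto_0_lincomb])
    fix n
    show "msq_int (\<lambda>\<tau> \<omega>. proc (Gf n @ scale (-1) (Gg n)) \<tau> \<omega> - (f \<tau> \<omega> - g \<tau> \<omega>))
      \<le> 2 * msd_int (proc (Gf n)) f + 2 * msd_int (proc (Gg n)) g"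
      using msq_int_triangle[OF joint_meas_diff[OF joint_meas_proc[OF s(1)[of n]] joint_meas_proc[OF s(2)[of n]]]
          joint_meas_diff[OF jf joint_meas_proc[OF s(2)[of n]]] joint_meas_diff[OF jf jg]]
      by (simp add: msq_int_minus_commute[of g])
  qed (use G in \<open>auto simp: approximates_def\<close>)
  then have "approximates c (\<lambda>n. Gf n @ scale (-1) (Gg n)) (\<lambda>\<tau> \<omega>. f \<tau> \<omega> - g \<tau> \<omega>)"
    using s by (simp add: approximates_def)
  moreover have "msd_int f g < \<infinity>"
  proof -
    have z: "joint_meas (\<lambda>\<tau> \<omega>. 0)" using joint_meas_proc[OF simple_Nil] by (simp add: proc_def[abs_def])
    have "msd_int f g \<le> 2 * msq_int f + 2 * msq_int g"
      using msq_int_triangle[OF jf z jg] msq_int_minus_commute[of "\<lambda>\<tau> \<omega>. 0" g] by simp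
    also have "\<dots> < \<infinity>" using f g by (auto simp: integrand_def ennreal_mult_less_top)
    finally show ?thesis .
  qed
  ultimately show "integrand c (\<lambda>\<tau> \<omega>. f \<tau> \<omega> - g \<tau> \<omega>)"
    using joint_meas_diff[OF jf jg] by (auto simp: integrand_def)
  show "SI c (\<lambda>\<tau> \<omega>. f \<tau> \<omega> - g \<tau> \<omega>) (\<lambda>\<omega>. X \<omega> - Y \<omega>)"
    unfolding SI_def
  proof (intro conjI allI impI)
    show "square_integrable P (\<lambda>\<omega>. X \<omega> - Y \<omega>)"
      by (rule square_integrable_diff[OF SI_square[OF X] SI_square[OF Y]])
    fix H assume H: "approximates c H (\<lambda>\<tau> \<omega>. f \<tau> \<omega> - g \<tau> \<omega>)"
    then have sH: "simple c (H n)" for n by (simp add: approximates_def)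
    \<comment> \<open>\<open>SI\<close> demands the limit along every \<open>H\<close> approximating
      the difference. Adding a fixed approximation of \<open>g\<close> turns \<open>H\<close> into
      an approximation of \<open>f\<close>, and the limits \<open>X\<close> and \<open>Y\<close> are
      then available.\<close>
    have "(\<lambda>n. msd_int (proc (H n @ Gg n)) f) \<longlonglongrightarrow> 0"
    proof (rule ennreal_tendsto_0_le[OF ennreal_tendsto_0_lincomb])
      fix n
      show "msd_int (proc (H n @ Gg n)) f
        \<le> 2 * msq_int (\<lambda>\<tau> \<omega>. proc (H n) \<tau> \<omega> - (f \<tau> \<omega> - g \<tau> \<omega>)) + 2 * msd_int (proc (Gg n)) g"
        using msq_int_triangle[OF joint_meas_add[OF joint_meas_proc[OF sH[of n]] joint_meas_proc[OF s(2)[of n]]]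
            joint_meas_add[OF joint_meas_diff[OF jf jg] joint_meas_proc[OF s(2)[of n]]] jf]
        by (simp add: algebra_simps)
    qed (use G H in \<open>auto simp: approximates_def\<close>)
    then have "approximates c (\<lambda>n. H n @ Gg n) f" using sH s by (simp add: approximates_def)
    then have lim: "(\<lambda>n. msd P (sint (Z c) (H n @ Gg n)) X) \<longlonglongrightarrow> 0"
      "(\<lambda>n. msd P (sint (Z c) (Gg n)) Y) \<longlonglongrightarrow> 0"
      using X Y G by (auto simp only: SI_def)
    note [measurable] = sint_meas[OF sH] sint_meas[OF s(2)] SI_meas[OF X] SI_meas[OF Y]
    show "(\<lambda>n. msq P (\<lambda>\<omega>. sint (Z c) (H n) \<omega> - (X \<omega> - Y \<omega>))) \<longlonglongrightarrow> 0"
    proof (rule ennreal_tendsto_0_le[OF ennreal_tendsto_0_lincomb[OF lim]])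
      fix n
      have "msq P (\<lambda>\<omega>. (sint (Z c) (H n @ Gg n) \<omega> - X \<omega>) - (sint (Z c) (Gg n) \<omega> - Y \<omega>))
        \<le> 2 * msd P (sint (Z c) (H n @ Gg n)) X + 2 * msd P (sint (Z c) (Gg n)) Y"
        by (rule msq_diff_le) simp_all
      then show "msq P (\<lambda>\<omega>. sint (Z c) (H n) \<omega> - (X \<omega> - Y \<omega>))
        \<le> 2 * msd P (sint (Z c) (H n @ Gg n)) X + 2 * msd P (sint (Z c) (Gg n)) Y"
        by (simp add: algebra_simps)
    qed auto
  qed
qed

lemma SI_diff_bound:
  assumes "integrand c f" "integrand c g" "SI c f X" "SI c g Y"
  shows "msd P X Y \<le> (4 * C) * msd_int f g"
  using SI_bound[OF integrand_SI_diff[OF assms]] .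

text \<open>The finite exceptional set is Lebesgue null; it leaves room for the discontinuities of
  the integrand.\<close>

lemma msq_int_dominated_convergence:
  assumes g: "\<And>n. joint_meas (g n)" and B: "\<And>n \<tau>. \<tau> \<in> {t..T} \<Longrightarrow> msq P (g n \<tau>) \<le> ennreal B"
    and S: "finite S" "\<And>\<tau>. \<tau> \<in> {t..T} - S \<Longrightarrow> (\<lambda>n. msq P (g n \<tau>)) \<longlonglongrightarrow> 0"
  shows "(\<lambda>n. msq_int (g n)) \<longlonglongrightarrow> 0"
proof -
  have "(\<lambda>n. \<integral>\<^sup>+\<tau>. msq P (g n \<tau>) * indicator {t..T} \<tau> \<partial>lborel) \<longlonglongrightarrow> (\<integral>\<^sup>+\<tau>. 0 \<partial>(lborel :: real measure))"
  proof (rule nn_integral_dominated_convergence[where u = "\<lambda>n \<tau>. msq P (g n \<tau>) * indicator {t..T} \<tau>"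
        and u' = "\<lambda>\<tau>. 0" and w = "\<lambda>\<tau>. ennreal B * indicator {t..T} \<tau>"])
    show "(\<integral>\<^sup>+\<tau>. ennreal B * indicator {t..T} \<tau> \<partial>lborel) < \<infinity>"
      using t_less by (simp add: nn_integral_cmult_indicator ennreal_mult_less_top)
    have "AE \<tau> in lborel. \<tau> \<notin> S" using S(1) by (intro AE_not_in finite_imp_null_set_lborel)
    then show "AE \<tau> in lborel. (\<lambda>n. msq P (g n \<tau>) * indicator {t..T} \<tau>) \<longlonglongrightarrow> 0"
      by eventually_elim (use S(2) in \<open>auto simp: indicator_def\<close>)
    show "AE \<tau> in lborel. msq P (g n \<tau>) * indicator {t..T} \<tau> \<le> ennreal B * indicator {t..T} \<tau>" for n
      using B by (auto simp: indicator_def)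
  qed (use joint_meas_msq[OF g] in auto)
  then show ?thesis by (simp add: msq_int_def)
qed

section \<open>Piecewise mean-square continuous processes\<close>

text \<open>\<open>at\<close> leaves out the point itself, but the sequence may hit \<sigma>. Since
  the distance vanishes there, the punctured limit extends to the full neighbourhood filter.\<close>

lemma msq_continuous_seq:
  assumes "((\<lambda>u. msd P (f u) (f \<sigma>)) \<longlongrightarrow> 0) (at (\<sigma> :: real) within S)" "x \<longlonglongrightarrow> \<sigma>" "\<And>n. x n \<in> S"
  shows "(\<lambda>n. msd P (f (x n)) (f \<sigma>)) \<longlonglongrightarrow> 0"
proof -
  have z: "msd P (f \<sigma>) (f \<sigma>) = 0" by simp
  have "filterlim x (inf (nhds \<sigma>) (principal S)) sequentially"
    using assms(2,3) by (auto simp: filterlim_inf filterlim_principal)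
  then show ?thesis
    by (rule filterlim_compose[OF tendsto_at_iff_tendsto_nhds_within[THEN iffD1, OF z assms(1)]])
qed

abbreviation ms_cont_at :: "(real \<Rightarrow> 'a \<Rightarrow> real) \<Rightarrow> real \<Rightarrow> bool" where
  "ms_cont_at f \<tau> \<equiv> ((\<lambda>u. msd P (f u) (f \<tau>)) \<longlongrightarrow> 0) (at \<tau> within {t..T})"

text \<open>The class in which the whole argument runs. It contains \<open>\<phi>\<close> and the
  adapted jump processes, and it is closed under differences, continuous weights and integration.
  The finite set \<open>S\<close> admits jumps; the bound \<open>B\<close> feeds dominated
  convergence.\<close>

definition regular :: "(real \<Rightarrow> 'a \<Rightarrow> real) \<Rightarrow> bool" where
  "regular f \<longleftrightarrow> joint_meas f \<and> (\<forall>\<tau>\<in>{t..T}. f \<tau> \<in> borel_measurable (F \<tau>)) \<and>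
    (\<exists>B. \<forall>\<tau>\<in>{t..T}. msq P (f \<tau>) \<le> ennreal B) \<and>
    (\<exists>S. finite S \<and> (\<forall>\<tau>\<in>{t..T} - S. ms_cont_at f \<tau>))"

lemma regular_joint: "regular f \<Longrightarrow> joint_meas f"
  and regular_adapted: "regular f \<Longrightarrow> \<tau> \<in> {t..T} \<Longrightarrow> f \<tau> \<in> borel_measurable (F \<tau>)"
  by (auto simp: regular_def)

lemma regular_meas: "regular f \<Longrightarrow> \<tau> \<in> {t..T} \<Longrightarrow> f \<tau> \<in> borel_measurable P"
  using regular_adapted measurable_F_P by blast

lemma regular_bounded:
  assumes "regular f"
  obtains B where "0 \<le> B" "\<And>\<tau>. \<tau> \<in> {t..T} \<Longrightarrow> msq P (f \<tau>) \<le> ennreal B"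
proof -
  obtain B where B: "\<forall>\<tau>\<in>{t..T}. msq P (f \<tau>) \<le> ennreal B" using assms by (auto simp: regular_def)
  show ?thesis
  proof (rule that[of "max 0 B"])
    show "msq P (f \<tau>) \<le> ennreal (max 0 B)" if "\<tau> \<in> {t..T}" for \<tau>
      using B that by (auto intro: order_trans ennreal_leI)
  qed simp
qed

lemma regular_diff:
  assumes "regular f" "regular g"
  shows "regular (\<lambda>\<tau> \<omega>. f \<tau> \<omega> - g \<tau> \<omega>)"
  unfolding regular_def
proof (intro conjI)
  show "joint_meas (\<lambda>\<tau> \<omega>. f \<tau> \<omega> - g \<tau> \<omega>)" using assms by (intro joint_meas_diff regular_joint)
  show "\<forall>\<tau>\<in>{t..T}. (\<lambda>\<omega>. f \<tau> \<omega> - g \<tau> \<omega>) \<in> borel_measurable (F \<tau>)"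
    using assms by (auto intro: borel_measurable_diff regular_adapted)
  obtain B1 where B1: "0 \<le> B1" "\<And>\<tau>. \<tau> \<in> {t..T} \<Longrightarrow> msq P (f \<tau>) \<le> ennreal B1" using regular_bounded[OF assms(1)] by blast
  obtain B2 where B2: "0 \<le> B2" "\<And>\<tau>. \<tau> \<in> {t..T} \<Longrightarrow> msq P (g \<tau>) \<le> ennreal B2" using regular_bounded[OF assms(2)] by blast
  have "msd P (f \<tau>) (g \<tau>) \<le> ennreal (2 * B1 + 2 * B2)" if "\<tau> \<in> {t..T}" for \<tau>
  proof -
    have "msd P (f \<tau>) (g \<tau>) \<le> 2 * msq P (f \<tau>) + 2 * msq P (g \<tau>)"
      using assms that by (intro msq_diff_le regular_meas)
    also have "\<dots> \<le> 2 * ennreal B1 + 2 * ennreal B2"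
      by (intro add_mono mult_left_mono B1(2) B2(2) that) auto
    also have "\<dots> = ennreal (2 * B1 + 2 * B2)" using B1(1) B2(1) by (simp add: ennreal_mult)
    finally show ?thesis .
  qed
  then show "\<exists>B. \<forall>\<tau>\<in>{t..T}. msd P (f \<tau>) (g \<tau>) \<le> ennreal B" by blast
  obtain S1 where S1: "finite S1" "\<And>\<tau>. \<tau> \<in> {t..T} - S1 \<Longrightarrow> ms_cont_at f \<tau>"
    using assms(1) unfolding regular_def by blast
  obtain S2 where S2: "finite S2" "\<And>\<tau>. \<tau> \<in> {t..T} - S2 \<Longrightarrow> ms_cont_at g \<tau>"
    using assms(2) unfolding regular_def by blast
  have "((\<lambda>u. msq P (\<lambda>\<omega>. (f u \<omega> - g u \<omega>) - (f \<tau> \<omega> - g \<tau> \<omega>))) \<longlongrightarrow> 0) (at \<tau> within {t..T})"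
    if \<tau>: "\<tau> \<in> {t..T} - (S1 \<union> S2)" for \<tau>
  proof (rule tendsto_sandwich[OF _ _ tendsto_const ennreal_tendsto_0_lincomb[OF S1(2) S2(2)]])
    show "\<forall>\<^sub>F u in at \<tau> within {t..T}. msq P (\<lambda>\<omega>. (f u \<omega> - g u \<omega>) - (f \<tau> \<omega> - g \<tau> \<omega>))
        \<le> 2 * msd P (f u) (f \<tau>) + 2 * msd P (g u) (g \<tau>)"
      unfolding eventually_at_filter
    proof (intro always_eventually allI impI)
      fix u assume u: "u \<in> {t..T}"
      note [measurable] = regular_meas[OF assms(1) u] regular_meas[OF assms(2) u]
        regular_meas[OF assms(1), of \<tau>] regular_meas[OF assms(2), of \<tau>]
      have "msq P (\<lambda>\<omega>. (f u \<omega> - f \<tau> \<omega>) - (g u \<omega> - g \<tau> \<omega>))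
          \<le> 2 * msd P (f u) (f \<tau>) + 2 * msd P (g u) (g \<tau>)"
        using \<tau> by (intro msq_diff_le borel_measurable_diff) auto
      then show "msq P (\<lambda>\<omega>. (f u \<omega> - g u \<omega>) - (f \<tau> \<omega> - g \<tau> \<omega>))
          \<le> 2 * msd P (f u) (f \<tau>) + 2 * msd P (g u) (g \<tau>)"
        by (simp add: algebra_simps)
    qed
  qed (use \<tau> in auto)
  then show "\<exists>S. finite S \<and> (\<forall>\<tau>\<in>{t..T} - S. ((\<lambda>u. msq P (\<lambda>\<omega>. (f u \<omega> - g u \<omega>) - (f \<tau> \<omega> - g \<tau> \<omega>))) \<longlongrightarrow> 0) (at \<tau> within {t..T}))"
    using S1(1) S2(1) by (intro exI[of _ "S1 \<union> S2"]) blast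
qed

lemma regular_mult_continuous:
  assumes f: "regular f" and g: "continuous_on {t..T} g"
  shows "regular (\<lambda>\<tau> \<omega>. g \<tau> * f \<tau> \<omega>)"
  unfolding regular_def
proof (intro conjI)
  have "(\<lambda>\<tau>. indicator {t..T} \<tau> * g \<tau>) \<in> borel_measurable borel"
    using borel_measurable_continuous_on_indicator[OF _ g] by simp
  from joint_meas_prod[OF regular_joint[OF f] this, of "\<lambda>\<omega>. 1"]
  show "joint_meas (\<lambda>\<tau> \<omega>. g \<tau> * f \<tau> \<omega>)" by simp
  show "\<forall>\<tau>\<in>{t..T}. (\<lambda>\<omega>. g \<tau> * f \<tau> \<omega>) \<in> borel_measurable (F \<tau>)"
    using f by (auto intro: borel_measurable_times regular_adapted)
  have "bounded (g ` {t..T})" using g by (intro compact_imp_bounded compact_continuous_image) auto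
  then have "\<exists>D. \<forall>\<tau>\<in>{t..T}. \<bar>g \<tau>\<bar> \<le> D" by (simp add: bounded_iff)
  then obtain D where D: "\<And>\<tau>. \<tau> \<in> {t..T} \<Longrightarrow> \<bar>g \<tau>\<bar> \<le> D" by blast
  then have D2: "(g \<tau>)\<^sup>2 \<le> D\<^sup>2" if "\<tau> \<in> {t..T}" for \<tau>
    using that power_mono[OF D[OF that], of 2] by simp
  obtain B where B: "0 \<le> B" "\<And>\<tau>. \<tau> \<in> {t..T} \<Longrightarrow> msq P (f \<tau>) \<le> ennreal B" using regular_bounded[OF f] by blast
  have "msq P (\<lambda>\<omega>. g \<tau> * f \<tau> \<omega>) \<le> ennreal (D\<^sup>2 * B)" if "\<tau> \<in> {t..T}" for \<tau>
    using B D2[OF that] that regular_meas[OF f that]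
    by (auto simp: msq_cmult ennreal_mult intro!: mult_mono ennreal_leI)
  then show "\<exists>B. \<forall>\<tau>\<in>{t..T}. msq P (\<lambda>\<omega>. g \<tau> * f \<tau> \<omega>) \<le> ennreal B" by blast
  obtain S where S: "finite S" "\<And>\<tau>. \<tau> \<in> {t..T} - S \<Longrightarrow> ms_cont_at f \<tau>"
    using f unfolding regular_def by blast
  have "((\<lambda>u. msq P (\<lambda>\<omega>. g u * f u \<omega> - g \<tau> * f \<tau> \<omega>)) \<longlongrightarrow> 0) (at \<tau> within {t..T})"
    if \<tau>: "\<tau> \<in> {t..T} - S" for \<tau>
  proof -
    have "((\<lambda>u. ennreal ((g u - g \<tau>)\<^sup>2)) \<longlongrightarrow> ennreal ((g \<tau> - g \<tau>)\<^sup>2)) (at \<tau> within {t..T})"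
      using g \<tau> by (intro tendsto_intros tendsto_ennrealI) (auto simp: continuous_on_def)
    then have lim: "((\<lambda>u. ennreal ((g u - g \<tau>)\<^sup>2)) \<longlongrightarrow> 0) (at \<tau> within {t..T})" by simp
    show ?thesis
    proof (rule tendsto_sandwich[OF _ _ tendsto_const ennreal_tendsto_0_lincomb[OF S(2) lim]])
      show "\<forall>\<^sub>F u in at \<tau> within {t..T}. msq P (\<lambda>\<omega>. g u * f u \<omega> - g \<tau> * f \<tau> \<omega>)
          \<le> (2 * ennreal (D\<^sup>2)) * msd P (f u) (f \<tau>) + (2 * ennreal B) * ennreal ((g u - g \<tau>)\<^sup>2)"
        unfolding eventually_at_filter
      proof (intro always_eventually allI impI)
        fix u assume u: "u \<in> {t..T}"
        have \<tau>': "\<tau> \<in> {t..T}" using \<tau> by simp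
        note [measurable] = regular_meas[OF f u] regular_meas[OF f \<tau>']
        have "msq P (\<lambda>\<omega>. g u * (f u \<omega> - f \<tau> \<omega>) + (g u - g \<tau>) * f \<tau> \<omega>)
            \<le> 2 * msq P (\<lambda>\<omega>. g u * (f u \<omega> - f \<tau> \<omega>)) + 2 * msq P (\<lambda>\<omega>. (g u - g \<tau>) * f \<tau> \<omega>)"
          by (intro msq_add_le) auto
        also have "\<dots> = 2 * (ennreal ((g u)\<^sup>2) * msd P (f u) (f \<tau>)) + 2 * (ennreal ((g u - g \<tau>)\<^sup>2) * msq P (f \<tau>))"
          by (subst (1 2) msq_cmult) auto
        also have "\<dots> \<le> 2 * (ennreal (D\<^sup>2) * msd P (f u) (f \<tau>)) + 2 * (ennreal ((g u - g \<tau>)\<^sup>2) * ennreal B)"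
          by (intro add_mono mult_left_mono mult_right_mono B(2) \<tau>' ennreal_leI D2 u) auto
        finally show "msq P (\<lambda>\<omega>. g u * f u \<omega> - g \<tau> * f \<tau> \<omega>)
          \<le> (2 * ennreal (D\<^sup>2)) * msd P (f u) (f \<tau>) + (2 * ennreal B) * ennreal ((g u - g \<tau>)\<^sup>2)"
          by (simp add: algebra_simps)
      qed
    qed (use \<tau> in \<open>auto simp: ennreal_mult_less_top\<close>)
  qed
  then show "\<exists>S. finite S \<and> (\<forall>\<tau>\<in>{t..T} - S. ((\<lambda>u. msq P (\<lambda>\<omega>. g u * f u \<omega> - g \<tau> * f \<tau> \<omega>)) \<longlongrightarrow> 0) (at \<tau> within {t..T}))"
    using S(1) by blast
qed

text \<open>Away from \<open>u\<close> the process is locally constant in time, and from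
  \<open>u\<close> on its value is known. These are the summands of the jump process in the
  reversal.\<close>

lemma regular_jump:
  assumes "u \<in> {t..T}" "\<xi> \<in> borel_measurable (F u)" "msq P \<xi> < \<infinity>"
  shows "regular (\<lambda>\<tau> \<omega>. indicator {u..} \<tau> * \<xi> \<omega>)"
  unfolding regular_def
proof (intro conjI)
  have \<xi>: "\<xi> \<in> borel_measurable P" using measurable_F_P[OF assms(2,1)] .
  have "(\<lambda>\<tau>. indicator {t..T} \<tau> * indicator {u..} \<tau> :: real) \<in> borel_measurable borel" by simp
  from joint_meas_prod[OF joint_meas_const this \<xi>]
  show "joint_meas (\<lambda>\<tau> \<omega>. indicator {u..} \<tau> * \<xi> \<omega>)" by simp
  show "\<forall>\<tau>\<in>{t..T}. (\<lambda>\<omega>. indicator {u..} \<tau> * \<xi> \<omega>) \<in> borel_measurable (F \<tau>)"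
  proof
    fix \<tau> assume "\<tau> \<in> {t..T}"
    then show "(\<lambda>\<omega>. indicator {u..} \<tau> * \<xi> \<omega>) \<in> borel_measurable (F \<tau>)"
      using assms measurable_F_mono[OF assms(2), of \<tau>] by (cases "u \<le> \<tau>") auto
  qed
  have "msq P (\<lambda>\<omega>. indicator {u..} \<tau> * \<xi> \<omega>) \<le> ennreal (enn2real (msq P \<xi>))" for \<tau>
    using assms(3) by (cases "u \<le> \<tau>") (auto simp: less_top)
  then show "\<exists>B. \<forall>\<tau>\<in>{t..T}. msq P (\<lambda>\<omega>. indicator {u..} \<tau> * \<xi> \<omega>) \<le> ennreal B" by blast
  have "((\<lambda>v. msq P (\<lambda>\<omega>. indicator {u..} v * \<xi> \<omega> - indicator {u..} \<tau> * \<xi> \<omega>)) \<longlongrightarrow> 0) (at \<tau> within {t..T})"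
    if "\<tau> \<noteq> u" for \<tau>
  proof (rule tendsto_eventually)
    have "\<forall>\<^sub>F v in nhds \<tau>. (u \<le> v \<longleftrightarrow> u \<le> \<tau>)"
    proof (cases "u < \<tau>")
      case True
      then have "\<forall>\<^sub>F v in nhds \<tau>. v \<in> {u<..}" by (intro eventually_nhds_in_open) auto
      then show ?thesis by eventually_elim (use True in auto)
    next
      case False
      then have "\<forall>\<^sub>F v in nhds \<tau>. v \<in> {..<u}" using that by (intro eventually_nhds_in_open) auto
      then show ?thesis by eventually_elim (use False that in auto)
    qed
    then show "\<forall>\<^sub>F v in at \<tau> within {t..T}. msq P (\<lambda>\<omega>. indicator {u..} v * \<xi> \<omega> - indicator {u..} \<tau> * \<xi> \<omega>) = 0"
      unfolding eventually_at_filter by eventually_elim (simp add: indicator_def)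
  qed
  then show "\<exists>S. finite S \<and> (\<forall>\<tau>\<in>{t..T} - S.
      ((\<lambda>v. msq P (\<lambda>\<omega>. indicator {u..} v * \<xi> \<omega> - indicator {u..} \<tau> * \<xi> \<omega>)) \<longlongrightarrow> 0) (at \<tau> within {t..T}))"
    by (intro exI[of _ "{u}"]) auto
qed

lemma joint_meas_cut:
  assumes "joint_meas f"
  shows "joint_meas (cut a b f)"
  using joint_meas_prod[OF assms, of "indicator {a..<b}" "\<lambda>\<omega>. 1"] by simp

lemma msq_cut_le:
  "msq P (\<lambda>\<omega>. indicator A \<tau> * f \<tau> \<omega>) \<le> msq P (f \<tau>)"
  by (cases "\<tau> \<in> A") auto

section \<open>Riemann sums\<close>

lemma simple_riemann:
  assumes "partition_on_interval a b p" "t \<le> a" "b \<le> T"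
    and "\<And>j. j < length p - 1 \<Longrightarrow> f (x j) \<in> borel_measurable (alg c (p ! j))"
  shows "simple c (riemann p x \<tau>\<^sub>0 f)"
  unfolding simple_def
proof safe
  fix u v \<xi> assume "(u, v, \<xi>) \<in> set (riemann p x \<tau>\<^sub>0 f)"
  then obtain j where j: "j < length p - 1" "u = p ! j" "v = p ! Suc j" "\<xi> = f (x j)"
    by (auto simp: riemann_def)
  then have "j < length p" "Suc j < length p" by auto
  then show "t \<le> u" "u \<le> v" "v \<le> T" "\<xi> \<in> borel_measurable (alg c u)"
    using partition_nth_bounds[OF assms(1), of j] partition_nth_bounds[OF assms(1), of "Suc j"]
      partition_nth_less[OF assms(1) j(1)] assms j by auto
qed

lemma simple_riemann_left:
  assumes "partition_on_interval a b p" "t \<le> a" "b \<le> T"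
    and "\<And>\<tau>. \<tau> \<in> {a..b} \<Longrightarrow> f \<tau> \<in> borel_measurable (F \<tau>)"
  shows "simple c (riemann p ((!) p) \<tau>\<^sub>0 f)"
proof (rule simple_riemann[OF assms(1-3)])
  fix j assume "j < length p - 1"
  then have "p ! j \<in> {a..b}" "p ! j \<in> {t..T}"
    using partition_Suc_bounds(1)[OF assms(1), of j] assms(2,3) by auto
  then show "f (p ! j) \<in> borel_measurable (alg c (p ! j))"
    using assms(4) measurable_F_P by (cases c) auto
qed

lemma msq_proc_riemann_le:
  assumes part: "partition_on_interval a b p" and B: "\<And>j. j < length p - 1 \<Longrightarrow> msq P (f (x j)) \<le> ennreal B"
  shows "msq P (proc (riemann p x \<tau>\<^sub>0 f) \<sigma>) \<le> ennreal B"
proof (cases "a \<le> \<sigma> \<and> \<sigma> < b")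
  case True
  then obtain j where j: "j < length p - 1" "p ! j \<le> \<sigma>" "\<sigma> < p ! Suc j"
    using partition_locate[OF part] by blast
  show ?thesis using B[OF j(1)] proc_riemann_eq[OF part j, of x \<tau>\<^sub>0 f]
    by (cases "p ! Suc j \<le> \<tau>\<^sub>0") (simp_all add: msq_def)
next
  case False
  then have "\<sigma> < a \<or> \<tau>\<^sub>0 \<le> \<sigma> \<or> b \<le> \<sigma>" by auto
  then show ?thesis using proc_riemann_outside[OF part, of \<sigma> \<tau>\<^sub>0 x f] by (simp add: msq_def)
qed

text \<open>At a continuity point \<sigma> before the cut-off, the sample points of the subintervals
  around \<sigma> tend to \<sigma>; outside \<open>{a..<\<tau>\<^sub>0}\<close> both processes
  vanish. Bounded second moments then allow dominated convergence in time.\<close>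

lemma msq_int_riemann_tendsto:
  assumes f: "regular f" and ab: "t \<le> a" "b \<le> T" and p: "partition_seq a b p" and "\<tau>\<^sub>0 \<le> b"
    and x: "\<And>n j. j < length (p n) - 1 \<Longrightarrow> x n j \<in> {p n ! j..p n ! Suc j}"
  shows "(\<lambda>n. msd_int (proc (riemann (p n) (x n) \<tau>\<^sub>0 f)) (cut a \<tau>\<^sub>0 f)) \<longlonglongrightarrow> 0"
proof -
  have part: "partition_on_interval a b (p n)" for n using p by (simp add: partition_seq_def)
  have xT: "x n j \<in> {t..T}" if "j < length (p n) - 1" for n j
    using x[OF that] partition_Suc_bounds[OF part that] ab by auto
  \<comment> \<open>\<open>Time\<close> is chosen because values at arbitrary sample points need not
    be adapted; the fact serves only to obtain measurability.\<close>
  have s: "simple Time (riemann (p n) (x n) \<tau>\<^sub>0 f)" for n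
    using xT by (intro simple_riemann[OF part ab]) (auto intro: regular_meas[OF f])
  obtain B where B: "0 \<le> B" "\<And>\<tau>. \<tau> \<in> {t..T} \<Longrightarrow> msq P (f \<tau>) \<le> ennreal B" using regular_bounded[OF f] by blast
  obtain S where S: "finite S" "\<And>\<tau>. \<tau> \<in> {t..T} - S \<Longrightarrow> ms_cont_at f \<tau>"
    using f unfolding regular_def by blast
  have pB: "msq P (proc (riemann (p n) (x n) \<tau>\<^sub>0 f) \<sigma>) \<le> ennreal B" for n \<sigma>
    using xT by (intro msq_proc_riemann_le[OF part] B(2)) auto
  show ?thesis
  proof (rule msq_int_dominated_convergence[OF _ _ S(1)])
    show "joint_meas (\<lambda>\<sigma> \<omega>. proc (riemann (p n) (x n) \<tau>\<^sub>0 f) \<sigma> \<omega> - indicator {a..<\<tau>\<^sub>0} \<sigma> * f \<sigma> \<omega>)" for n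
      by (intro joint_meas_diff joint_meas_proc[OF s] joint_meas_cut regular_joint[OF f])
    show "msd P (proc (riemann (p n) (x n) \<tau>\<^sub>0 f) \<sigma>) (cut a \<tau>\<^sub>0 f \<sigma>) \<le> ennreal (4 * B)"
      if \<sigma>: "\<sigma> \<in> {t..T}" for n \<sigma>
    proof -
      have "msd P (proc (riemann (p n) (x n) \<tau>\<^sub>0 f) \<sigma>) (cut a \<tau>\<^sub>0 f \<sigma>)
          \<le> 2 * msq P (proc (riemann (p n) (x n) \<tau>\<^sub>0 f) \<sigma>) + 2 * msq P (\<lambda>\<omega>. indicator {a..<\<tau>\<^sub>0} \<sigma> * f \<sigma> \<omega>)"
        using regular_meas[OF f \<sigma>] by (intro msq_diff_le proc_meas[OF s]) auto
      also have "\<dots> \<le> 2 * ennreal B + 2 * ennreal B"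
        by (intro add_mono mult_left_mono pB order_trans[OF msq_cut_le[where f = f] B(2)[OF \<sigma>]]) auto
      also have "\<dots> = ennreal (4 * B)" using B(1) by (simp add: ennreal_mult flip: distrib_right)
      finally show ?thesis .
    qed
    fix \<sigma> assume \<sigma>: "\<sigma> \<in> {t..T} - S"
    show "(\<lambda>n. msd P (proc (riemann (p n) (x n) \<tau>\<^sub>0 f) \<sigma>) (cut a \<tau>\<^sub>0 f \<sigma>)) \<longlonglongrightarrow> 0"
    proof (cases "a \<le> \<sigma> \<and> \<sigma> < \<tau>\<^sub>0")
      case False
      then have "\<sigma> < a \<or> \<tau>\<^sub>0 \<le> \<sigma> \<or> b \<le> \<sigma>" by auto
      moreover have "indicator {a..<\<tau>\<^sub>0} \<sigma> = (0 :: real)" using False by (auto simp: indicator_def)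
      ultimately show ?thesis by (simp add: proc_riemann_outside[OF part])
    next
      case True
      then have \<sigma>b: "a \<le> \<sigma>" "\<sigma> < b" using \<open>\<tau>\<^sub>0 \<le> b\<close> by auto
      have "\<exists>j. j < length (p n) - 1 \<and> p n ! j \<le> \<sigma> \<and> \<sigma> < p n ! Suc j" for n
        using partition_locate[OF part \<sigma>b] by blast
      then obtain j where j: "\<And>n. j n < length (p n) - 1" "\<And>n. p n ! j n \<le> \<sigma>" "\<And>n. \<sigma> < p n ! Suc (j n)"
        by metis
      have mesh: "(\<lambda>n. mesh (p n)) \<longlonglongrightarrow> 0" using p by (simp add: partition_seq_def)
      have near: "\<bar>x n (j n) - \<sigma>\<bar> \<le> mesh (p n)" "p n ! Suc (j n) \<le> \<sigma> + mesh (p n)" for n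
        using x[OF j(1), of n] j(2,3)[of n] partition_gap_le_mesh[OF j(1), of n] by (auto simp: abs_le_iff)
      have "(\<lambda>n. x n (j n) - \<sigma>) \<longlonglongrightarrow> 0"
        by (rule tendsto_rabs_zero_cancel, rule tendsto_sandwich[OF _ _ tendsto_const mesh]) (auto simp: near)
      then have xlim: "(\<lambda>n. x n (j n)) \<longlonglongrightarrow> \<sigma>" by (simp add: LIM_zero_iff)
      have lim: "(\<lambda>n. msd P (f (x n (j n))) (f \<sigma>)) \<longlonglongrightarrow> 0"
        by (rule msq_continuous_seq[OF S(2)[OF \<sigma>] xlim xT[OF j(1)]])
      \<comment> \<open>Once the mesh is this small, the subinterval around \<sigma> ends before the
        cut-off and its summand is kept.\<close>
      have "eventually (\<lambda>n. mesh (p n) < \<tau>\<^sub>0 - \<sigma>) sequentially"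
        using mesh True by (intro order_tendstoD(2)) auto
      then have "eventually (\<lambda>n. msd P (f (x n (j n))) (f \<sigma>)
        = msd P (proc (riemann (p n) (x n) \<tau>\<^sub>0 f) \<sigma>) (cut a \<tau>\<^sub>0 f \<sigma>)) sequentially"
      proof eventually_elim
        case (elim n)
        then have "p n ! Suc (j n) \<le> \<tau>\<^sub>0" using near(2)[of n] by linarith
        then show ?case using True by (simp add: proc_riemann_eq[OF part j])
      qed
      then show ?thesis using lim by (rule tendsto_cong[THEN iffD1])
    qed
  qed
qed

text \<open>Sampling at left endpoints makes the coefficients adapted, so these sums serve either
  integrator.\<close>

lemma approximates_riemann_left:
  assumes f: "regular f" and ab: "t \<le> a" "b \<le> T" and p: "partition_seq a b p" and "\<tau>\<^sub>0 \<le> b"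
  shows "approximates c (\<lambda>n. riemann (p n) ((!) (p n)) \<tau>\<^sub>0 f) (cut a \<tau>\<^sub>0 f)"
  unfolding approximates_def
proof (intro conjI allI)
  have part: "partition_on_interval a b (p n)" for n using p by (simp add: partition_seq_def)
  show "simple c (riemann (p n) ((!) (p n)) \<tau>\<^sub>0 f)" for n
    using ab by (intro simple_riemann_left[OF part ab regular_adapted[OF f]]) auto
  show "(\<lambda>n. msd_int (proc (riemann (p n) ((!) (p n)) \<tau>\<^sub>0 f)) (cut a \<tau>\<^sub>0 f)) \<longlonglongrightarrow> 0"
    by (intro msq_int_riemann_tendsto[OF f ab p \<open>\<tau>\<^sub>0 \<le> b\<close>]) (simp add: less_imp_le[OF partition_nth_less[OF part]])
qed

lemma regular_msq_int_cut:
  assumes "regular f"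
  shows "msq_int (cut a b f) < \<infinity>"
proof -
  obtain B where B: "0 \<le> B" "\<And>\<tau>. \<tau> \<in> {t..T} \<Longrightarrow> msq P (f \<tau>) \<le> ennreal B" using regular_bounded[OF assms] by blast
  \<comment> \<open>\<open>msq_int_le_const\<close> works with half-open intervals, and the one from
    \<open>t\<close> to \<open>T + 1\<close> contains \<open>{t..T}\<close>; hence the factor
    \<open>(T + 1) - t\<close> here and below.\<close>
  have "msq_int (cut a b f) \<le> ennreal B * ennreal ((T + 1) - t)"
    using t_less by (intro msq_int_le_const) (auto intro!: order_trans[OF msq_cut_le[where f = f] B(2)])
  also have "\<dots> < \<infinity>" by (simp add: ennreal_mult_less_top)
  finally show ?thesis .
qed

lemma integrand_cut:
  assumes "regular f" "s \<in> {t..T}"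
  shows "integrand c (cut t s f)"
proof -
  obtain p where p: "partition_seq t s p" using partition_seq_exists[of t s] assms(2) by auto
  have "approximates c (\<lambda>n. riemann (p n) ((!) (p n)) s f) (cut t s f)"
    using assms(2) by (intro approximates_riemann_left[OF assms(1) _ _ p]) auto
  then show ?thesis
    using joint_meas_cut[OF regular_joint[OF assms(1)]] regular_msq_int_cut[OF assms(1)] by (auto simp: integrand_def)
qed

lemma SI_cut_exists:
  assumes f: "regular f" and s: "s \<in> {t..T}"
  shows "\<exists>X\<in>borel_measurable (F s). SI c (cut t s f) X"
proof -
  obtain p where p: "partition_seq t s p" using partition_seq_exists[of t s] s by auto
  have part: "partition_on_interval t s (p n)" for n using p by (simp add: partition_seq_def)
  have "sint (Z c) (riemann (p n) ((!) (p n)) s f) \<in> borel_measurable (F s)" for n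
    unfolding sint_riemann_full[OF part order_refl, abs_def]
  proof (intro borel_measurable_sum borel_measurable_times borel_measurable_diff)
    fix j assume "j \<in> {..<length (p n) - 1}"
    then have j: "p n ! j \<in> {t..s}" "p n ! Suc j \<in> {t..s}"
      using partition_Suc_bounds[OF part, of j n] by auto
    show "f (p n ! j) \<in> borel_measurable (F s)"
      using j s by (intro measurable_F_mono[OF regular_adapted[OF f, of "p n ! j"]]) auto
    show "Z c (p n ! j) \<in> borel_measurable (F s)"
      using j s by (intro measurable_F_mono[OF Z_meas_F[of "p n ! j"]]) auto
    show "Z c (p n ! Suc j) \<in> borel_measurable (F s)"
      using j s by (intro measurable_F_mono[OF Z_meas_F[of "p n ! Suc j"]]) auto
  qed
  then show ?thesis
    using s by (intro SI_exists[OF joint_meas_cut[OF regular_joint[OF f]] regular_msq_int_cut[OF f]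
          approximates_riemann_left[OF f _ _ p order_refl] subalg[OF s]]) auto
qed

text \<open>The two truncations differ only between \<open>s\<close> and \<open>s'\<close>. The
  estimate serves twice: for a jointly measurable version of the integral and for its mean-square
  continuity.\<close>

lemma SI_cut_increment:
  assumes f: "regular f" and B: "\<And>\<tau>. \<tau> \<in> {t..T} \<Longrightarrow> msq P (f \<tau>) \<le> ennreal B" "0 \<le> B"
    and s: "s \<in> {t..T}" "s' \<in> {t..T}"
    and X: "SI c (cut t s f) X" and X': "SI c (cut t s' f) X'"
  shows "msd P X' X \<le> ennreal (4 * (K + (T - t)) * B * \<bar>s' - s\<bar>)"
proof -
  have "msd P X' X
      \<le> (4 * C) * msd_int (cut t s' f) (cut t s f)"
    by (rule SI_diff_bound[OF integrand_cut[OF f s(2)] integrand_cut[OF f s(1)] X' X])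
  also have "\<dots> \<le> (4 * C) * (ennreal B * ennreal (max s s' - min s s'))"
  proof (intro mult_left_mono msq_int_le_const)
    fix \<tau> assume "\<tau> \<in> {t..T}"
    have "msq P (\<lambda>\<omega>. indicator {t..<s'} \<tau> * f \<tau> \<omega> - indicator {t..<s} \<tau> * f \<tau> \<omega>) \<le> msq P (f \<tau>) * indicator {min s s'..<max s s'} \<tau>"
      using \<open>\<tau> \<in> {t..T}\<close> by (auto simp: indicator_def)
    also have "\<dots> \<le> ennreal B * indicator {min s s'..<max s s'} \<tau>"
      by (intro mult_right_mono B \<open>\<tau> \<in> {t..T}\<close>) auto
    finally show "msq P (\<lambda>\<omega>. indicator {t..<s'} \<tau> * f \<tau> \<omega> - indicator {t..<s} \<tau> * f \<tau> \<omega>)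
      \<le> ennreal B * indicator {min s s'..<max s s'} \<tau>" .
  qed auto
  also have "max s s' - min s s' = \<bar>s' - s\<bar>" by auto
  also have "(4 * C) * (ennreal B * ennreal \<bar>s' - s\<bar>) = ennreal (4 * (K + (T - t)) * B * \<bar>s' - s\<bar>)"
    using K_nonneg t_less B(2) unfolding C_def
    by (simp only: ennreal_mult[symmetric] ennreal_numeral[symmetric] mult_nonneg_nonneg add_nonneg_nonneg
        abs_ge_zero diff_ge_0_iff_ge less_imp_le zero_le_numeral mult.assoc)
  finally show ?thesis .
qed

section \<open>The indefinite integral as a process\<close>

lemma SI_AE_cong:
  assumes "SI c f X" "AE \<omega> in P. X \<omega> = Y \<omega>" "Y \<in> borel_measurable P"
  shows "SI c f Y"
proof -
  have "msq P Y = msq P X" using assms(2) by (intro msq_cong_AE) auto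
  moreover have "msd P A Y = msd P A X" for A
    by (rule msq_cong_AE) (use assms(2) in eventually_elim, simp)
  ultimately show ?thesis using assms(1,3) by (simp add: SI_def square_integrable_iff_msq)
qed

text \<open>A separate choice at each time gives no joint measurability. Step processes sampled at
  left endpoints are jointly measurable and adapted, and the Lipschitz bound lets the meshes be
  chosen with summable errors, so that the pointwise \<open>lim\<close> is a version at every
  time.\<close>

lemma measurable_version:
  assumes I: "\<And>s. s \<in> {t..T} \<Longrightarrow> I s \<in> borel_measurable (F s)"
    and L: "\<And>s s'. s \<in> {t..T} \<Longrightarrow> s' \<in> {t..T} \<Longrightarrow> msd P (I s') (I s) \<le> ennreal (L * \<bar>s' - s\<bar>)" "0 \<le> L"
  shows "\<exists>I'. joint_meas I' \<and> (\<forall>s\<in>{t..T}. I' s \<in> borel_measurable (F s)) \<and> (\<forall>s\<in>{t..T}. AE \<omega> in P. I s \<omega> = I' s \<omega>)"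
proof -
  obtain p where p: "partition_seq t T p" using partition_seq_exists[of t T] t_less by auto
  have "(\<lambda>n. L * mesh (p n)) \<longlonglongrightarrow> L * 0"
    using p by (intro tendsto_mult_left) (simp add: partition_seq_def)
  then have "eventually (\<lambda>m. L * mesh (p m) < (1/2)^n) sequentially" for n
    by (intro order_tendstoD(2)) auto
  then obtain r where r: "strict_mono r" "\<And>n. L * mesh (p (r n)) < (1/2)^n"
    using subseq_of_eventually[of "\<lambda>n m. L * mesh (p m) < (1/2)^n"] by blast
  have part: "partition_on_interval t T (p n)" for n using p by (simp add: partition_seq_def)
  define G where "G n = riemann (p (r n)) ((!) (p (r n))) T I" for n
  have sG: "simple Martingale (G n)" for n
    unfolding G_def by (rule simple_riemann_left[OF part order_refl order_refl I])
  have close: "msd P (proc (G n) s) (I s) \<le> ennreal ((1/2)^n)" if s: "t \<le> s" "s < T" for n s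
  proof -
    obtain j where j: "j < length (p (r n)) - 1" "p (r n) ! j \<le> s" "s < p (r n) ! Suc j"
      using partition_locate[OF part s] by blast
    have jT: "p (r n) ! j \<in> {t..T}" "p (r n) ! Suc j \<in> {t..T}" using partition_Suc_bounds[OF part j(1)] .
    have "msd P (proc (G n) s) (I s) = msd P (I (p (r n) ! j)) (I s)"
      using jT unfolding G_def by (simp add: proc_riemann_eq[OF part j])
    also have "\<dots> \<le> ennreal (L * \<bar>p (r n) ! j - s\<bar>)" using s jT by (intro L) auto
    also have "\<dots> \<le> ennreal ((1/2)^n)"
    proof (rule ennreal_leI)
      have "L * \<bar>p (r n) ! j - s\<bar> \<le> L * mesh (p (r n))"
        using j partition_gap_le_mesh[OF j(1)] by (intro mult_left_mono L) auto
      then show "L * \<bar>p (r n) ! j - s\<bar> \<le> (1/2)^n" using r(2)[of n] by linarith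
    qed
    finally show ?thesis .
  qed
  \<comment> \<open>Simple processes live on half-open intervals and vanish at \<open>T\<close>, so
    the value there is taken over from \<open>I\<close>.\<close>
  define I' where "I' s \<omega> = (if s < T then lim (\<lambda>n. proc (G n) s \<omega>) else I T \<omega>)" for s \<omega>
  have "joint_meas I'"
  proof -
    have IT: "I T \<in> borel_measurable P" using measurable_F_P[OF I[of T]] t_less by auto
    have "(\<lambda>x. indicator {t..<T} (fst x) * lim (\<lambda>n. (\<lambda>(\<tau>, \<omega>). indicator {t..T} \<tau> * proc (G n) \<tau> \<omega>) x)
        + indicator {T} (fst x) * I T (snd x)) \<in> borel_measurable (lborel \<Otimes>\<^sub>M P)"
      using joint_meas_proc[OF sG, unfolded joint_meas_def]
      by (intro borel_measurable_add borel_measurable_times indicator_fst_measurable borel_measurable_lim_metric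
          measurable_compose[OF measurable_snd IT]) auto
    moreover have "(\<lambda>x. indicator {t..<T} (fst x) * lim (\<lambda>n. (\<lambda>(\<tau>, \<omega>). indicator {t..T} \<tau> * proc (G n) \<tau> \<omega>) x)
        + indicator {T} (fst x) * I T (snd x)) = (\<lambda>(\<tau>, \<omega>). indicator {t..T} \<tau> * I' \<tau> \<omega>)"
      using t_less by (auto simp: fun_eq_iff I'_def indicator_def)
    ultimately show ?thesis by (simp add: joint_meas_def)
  qed
  moreover have "I' s \<in> borel_measurable (F s)" if s: "s \<in> {t..T}" for s
  proof (cases "s < T")
    case True
    then have "I' s = (\<lambda>\<omega>. lim (\<lambda>n. proc (G n) s \<omega>))" by (simp add: I'_def[abs_def])
    then show ?thesis using proc_adapted[OF sG s] by (simp add: borel_measurable_lim_metric)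
  next
    case False
    then have "s = T" using s by simp
    moreover have "I' T = I T" by (simp add: I'_def[abs_def])
    ultimately show ?thesis using I[OF s] by simp
  qed
  moreover have "AE \<omega> in P. I s \<omega> = I' s \<omega>" if s: "s \<in> {t..T}" for s
  proof (cases "s < T")
    case True
    then have ts: "t \<le> s" "s < T" using s by auto
    have "AE \<omega> in P. (\<lambda>n. proc (G n) s \<omega> - I s \<omega>) \<longlonglongrightarrow> 0"
      by (rule AE_LIMSEQ_of_msq_le[OF _ close[OF ts]])
         (intro borel_measurable_diff proc_meas[OF sG] measurable_F_P[OF I[OF s] s])
    then show ?thesis
    proof eventually_elim
      case (elim \<omega>)
      then have "(\<lambda>n. proc (G n) s \<omega>) \<longlonglongrightarrow> I s \<omega>" by (simp add: LIM_zero_iff)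
      then show ?case using True by (simp add: I'_def limI)
    qed
  next
    case False
    then have "s = T" using s by simp
    then show ?thesis by (simp add: I'_def)
  qed
  ultimately show ?thesis by blast
qed

definition indefinite_integral :: "integrator \<Rightarrow> (real \<Rightarrow> 'a \<Rightarrow> real) \<Rightarrow> (real \<Rightarrow> 'a \<Rightarrow> real) \<Rightarrow> bool" where
  "indefinite_integral c f I \<longleftrightarrow> joint_meas I \<and> (\<forall>s\<in>{t..T}. I s \<in> borel_measurable (F s)) \<and>
    (\<forall>s\<in>{t..T}. SI c (cut t s f) (I s))"

lemma indefinite_integral_exists:
  assumes f: "regular f"
  shows "\<exists>I. indefinite_integral c f I"
proof -
  obtain B where B: "0 \<le> B" "\<And>\<tau>. \<tau> \<in> {t..T} \<Longrightarrow> msq P (f \<tau>) \<le> ennreal B" using regular_bounded[OF f] by blast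
  have "\<forall>s\<in>{t..T}. \<exists>X. X \<in> borel_measurable (F s) \<and> SI c (cut t s f) X"
    using SI_cut_exists[OF f] by blast
  from bchoice[OF this] obtain I where I: "\<And>s. s \<in> {t..T} \<Longrightarrow> I s \<in> borel_measurable (F s)"
    "\<And>s. s \<in> {t..T} \<Longrightarrow> SI c (cut t s f) (I s)" by blast
  have L: "0 \<le> 4 * (K + (T - t)) * B" using K_nonneg t_less B(1) by simp
  obtain I' where I': "joint_meas I'" "\<And>s. s \<in> {t..T} \<Longrightarrow> I' s \<in> borel_measurable (F s)"
      "\<And>s. s \<in> {t..T} \<Longrightarrow> AE \<omega> in P. I s \<omega> = I' s \<omega>"
    using measurable_version[OF I(1) SI_cut_increment[OF f B(2,1) _ _ I(2) I(2)] L] by blast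
  have "indefinite_integral c f I'"
    unfolding indefinite_integral_def
    using I' SI_AE_cong[OF I(2) I'(3)] measurable_F_P[OF I'(2)] by blast
  then show ?thesis by blast
qed

text \<open>\<open>J\<close> is well defined only up to null sets at each time, so all its algebraic laws hold almost everywhere.\<close>

definition J :: "integrator \<Rightarrow> (real \<Rightarrow> 'a \<Rightarrow> real) \<Rightarrow> real \<Rightarrow> 'a \<Rightarrow> real" where
  "J c f = (SOME I. indefinite_integral c f I)"

lemma J_indefinite_integral: "regular f \<Longrightarrow> indefinite_integral c f (J c f)"
  unfolding J_def using indefinite_integral_exists by (rule someI_ex)

lemma J_SI: "regular f \<Longrightarrow> s \<in> {t..T} \<Longrightarrow> SI c (cut t s f) (J c f s)"
  using J_indefinite_integral[of f c] by (simp add: indefinite_integral_def)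

lemma J_msq_le:
  assumes "regular f" "s \<in> {t..T}"
  shows "msq P (J c f s) \<le> (4 * C) * msq_int f"
proof -
  have "msq P (J c f s) \<le> (4 * C) * msq_int (cut t s f)"
    by (rule SI_bound[OF integrand_cut[OF assms] J_SI[OF assms]])
  also have "\<dots> \<le> (4 * C) * msq_int f"
    unfolding msq_int_def by (intro mult_left_mono nn_integral_mono mult_right_mono msq_cut_le) auto
  finally show ?thesis .
qed

lemma msq_int_le_bound:
  assumes "\<And>\<tau>. \<tau> \<in> {t..T} \<Longrightarrow> msq P (f \<tau>) \<le> ennreal B"
  shows "msq_int f \<le> ennreal B * ennreal ((T + 1) - t)"
  using assms t_less by (intro msq_int_le_const) auto

text \<open>The bound is chosen before \<open>f\<close>, so it is uniform along a sequence of
  integrands, as dominated convergence at the next level requires.\<close>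

lemma J_msq_bounded:
  assumes "0 \<le> B"
  shows "\<exists>B'\<ge>0. \<forall>f. regular f \<longrightarrow> (\<forall>\<tau>\<in>{t..T}. msq P (f \<tau>) \<le> ennreal B) \<longrightarrow>
    (\<forall>s\<in>{t..T}. msq P (J c f s) \<le> ennreal B')"
proof (intro exI[of _ "4 * (K + (T - t)) * (B * ((T + 1) - t))"] conjI allI impI ballI)
  show "0 \<le> 4 * (K + (T - t)) * (B * ((T + 1) - t))" using K_nonneg t_less assms by simp
  fix f s assume f: "regular f" "\<forall>\<tau>\<in>{t..T}. msq P (f \<tau>) \<le> ennreal B" and s: "s \<in> {t..T}"
  have "msq P (J c f s) \<le> (4 * C) * msq_int f" by (rule J_msq_le[OF f(1) s])
  also have "\<dots> \<le> (4 * C) * (ennreal B * ennreal ((T + 1) - t))"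
    using f(2) by (intro mult_left_mono msq_int_le_bound) auto
  also have "\<dots> = ennreal (4 * (K + (T - t)) * (B * ((T + 1) - t)))"
    using K_nonneg t_less assms unfolding C_def
    by (subst ennreal_mult, simp, simp)+ (simp add: ennreal_mult)
  finally show "msq P (J c f s) \<le> ennreal (4 * (K + (T - t)) * (B * ((T + 1) - t)))" .
qed

text \<open>The exceptional set of the integral is empty even if the integrand jumps, because the
  second moments of its increments are at most proportional to the elapsed time.\<close>

lemma J_regular:
  assumes f: "regular f"
  shows "regular (J c f)"
proof -
  obtain B where B: "0 \<le> B" "\<And>\<tau>. \<tau> \<in> {t..T} \<Longrightarrow> msq P (f \<tau>) \<le> ennreal B" using regular_bounded[OF f] by blast
  define L where "L = 4 * (K + (T - t)) * B"
  have cont: "ms_cont_at (J c f) \<tau>" if \<tau>: "\<tau> \<in> {t..T}" for \<tau>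
  proof (rule tendsto_sandwich[OF _ _ tendsto_const])
    have "((\<lambda>u. ennreal (L * \<bar>u - \<tau>\<bar>)) \<longlongrightarrow> ennreal (L * \<bar>\<tau> - \<tau>\<bar>)) (at \<tau> within {t..T})"
      by (intro tendsto_intros tendsto_ennrealI)
    then show "((\<lambda>u. ennreal (L * \<bar>u - \<tau>\<bar>)) \<longlongrightarrow> 0) (at \<tau> within {t..T})" by simp
    show "\<forall>\<^sub>F u in at \<tau> within {t..T}. msd P (J c f u) (J c f \<tau>) \<le> ennreal (L * \<bar>u - \<tau>\<bar>)"
      unfolding eventually_at_filter L_def
      by (intro always_eventually allI impI SI_cut_increment[OF f B(2,1) \<tau> _ J_SI[OF f \<tau>] J_SI[OF f]])
  qed auto
  have "\<exists>B. \<forall>\<tau>\<in>{t..T}. msq P (J c f \<tau>) \<le> ennreal B" using J_msq_bounded[OF B(1)] f B(2) by blast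
  moreover have "\<exists>S. finite S \<and> (\<forall>\<tau>\<in>{t..T} - S. ms_cont_at (J c f) \<tau>)"
    using cont by (intro exI[of _ "{}"]) auto
  ultimately show "regular (J c f)"
    using J_indefinite_integral[OF f, of c] unfolding regular_def indefinite_integral_def by blast
qed

lemma J_meas: "regular f \<Longrightarrow> s \<in> {t..T} \<Longrightarrow> J c f s \<in> borel_measurable P"
  using J_regular regular_meas by blast

text \<open>Hypothesis and conclusion have the same form, an almost sure identity at each time, so
  that the law can be fed to the next level.\<close>

lemma J_diff:
  assumes f: "regular f" and g: "regular g" and h: "regular h"
    and eq: "\<And>\<tau>. \<tau> \<in> {t..T} \<Longrightarrow> AE \<omega> in P. h \<tau> \<omega> = f \<tau> \<omega> - g \<tau> \<omega>" and s: "s \<in> {t..T}"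
  shows "AE \<omega> in P. J c h s \<omega> = J c f s \<omega> - J c g s \<omega>"
proof -
  have cut: "AE \<omega> in P. indicator {t..<s} \<tau> * f \<tau> \<omega> - indicator {t..<s} \<tau> * g \<tau> \<omega> = indicator {t..<s} \<tau> * h \<tau> \<omega>"
    if "\<tau> \<in> {t..T}" for \<tau>
    using eq[OF that] by eventually_elim (simp only: right_diff_distrib)
  have "SI c (cut t s h) (\<lambda>\<omega>. J c f s \<omega> - J c g s \<omega>)"
    by (rule SI_cong[THEN iffD1, OF cut
          integrand_SI_diff(2)[OF integrand_cut[OF f s] integrand_cut[OF g s] J_SI[OF f s] J_SI[OF g s]]])
  then show ?thesis using SI_unique[OF integrand_cut[OF h s] J_SI[OF h s]] by blast
qed

text \<open>Since the integrand vanishes before \<open>a\<close>, partitions that start at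
  \<open>a\<close> compute the integral that starts at \<open>t\<close>.\<close>

lemma J_riemann_tendsto:
  assumes f: "regular f" and p: "partition_seq a T p" and a: "t \<le> a" and zero: "\<And>\<tau> \<omega>. t \<le> \<tau> \<Longrightarrow> \<tau> < a \<Longrightarrow> f \<tau> \<omega> = 0"
    and s: "s \<in> {t..T}"
  shows "(\<lambda>n. msd P (sint (Z c) (riemann (p n) ((!) (p n)) s f)) (J c f s)) \<longlonglongrightarrow> 0"
proof -
  have "(cut a s f) = (cut t s f)"
    using a zero by (force simp: fun_eq_iff indicator_def)
  then have "approximates c (\<lambda>n. riemann (p n) ((!) (p n)) s f) (cut t s f)"
    using approximates_riemann_left[OF f a order_refl p, of s c] s by simp
  then show ?thesis using J_SI[OF f s, of c] by (simp add: SI_def)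
qed

text \<open>The factor \<open>\<xi>\<close> need not be bounded: both Riemann sums converge almost everywhere along a subsequence.\<close>

lemma J_scale:
  assumes f: "regular f" and h: "regular h"
    and eq: "\<And>\<tau>. \<tau> \<in> {t..T} \<Longrightarrow> AE \<omega> in P. h \<tau> \<omega> = \<xi> \<omega> * f \<tau> \<omega>" and s: "s \<in> {t..T}"
  shows "AE \<omega> in P. J c h s \<omega> = \<xi> \<omega> * J c f s \<omega>"
proof -
  obtain p where p: "partition_seq t s p" using partition_seq_exists[of t s] s by auto
  have part: "partition_on_interval t s (p n)" for n using p by (simp add: partition_seq_def)
  define R where "R g n = sint (Z c) (riemann (p n) ((!) (p n)) s g)" for g n
  have R_lim: "(\<lambda>n. msd P (R g n) (J c g s)) \<longlonglongrightarrow> 0"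
    and R_meas: "R g n \<in> borel_measurable P" if g: "regular g" for g n
  proof -
    have G: "approximates c (\<lambda>n. riemann (p n) ((!) (p n)) s g) (cut t s g)"
      using s by (intro approximates_riemann_left[OF g _ _ p]) auto
    show "(\<lambda>n. msd P (R g n) (J c g s)) \<longlonglongrightarrow> 0"
      using J_SI[OF g s, of c] G unfolding R_def SI_def by blast
    show "R g n \<in> borel_measurable P"
      using G unfolding R_def approximates_def by (intro sint_meas) blast
  qed
  obtain r1 :: "nat \<Rightarrow> nat" where r1: "strict_mono r1" "AE \<omega> in P. (\<lambda>n. R f (r1 n) \<omega>) \<longlonglongrightarrow> J c f s \<omega>"
    using msq_tendsto_subseq_AE[OF R_meas[OF f] J_meas[OF f s] R_lim[OF f]] by blast
  \<comment> \<open>Thinning the subsequence for \<open>f\<close> once more gives one subsequence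
    along which both sums converge.\<close>
  have "(\<lambda>n. msd P (R h (r1 n)) (J c h s)) \<longlonglongrightarrow> 0"
    using LIMSEQ_subseq_LIMSEQ[OF R_lim[OF h] r1(1)] by (simp add: comp_def)
  from msq_tendsto_subseq_AE[OF R_meas[OF h] J_meas[OF h s] this]
  obtain r2 :: "nat \<Rightarrow> nat" where r2: "strict_mono r2" "AE \<omega> in P. (\<lambda>n. R h (r1 (r2 n)) \<omega>) \<longlonglongrightarrow> J c h s \<omega>" by blast
  have "AE \<omega> in P. \<forall>n. R h n \<omega> = \<xi> \<omega> * R f n \<omega>"
    unfolding AE_all_countable
  proof
    fix n
    have "AE \<omega> in P. \<forall>j\<in>{..<length (p n) - 1}. h (p n ! j) \<omega> = \<xi> \<omega> * f (p n ! j) \<omega>"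
    proof (rule AE_finite_allI)
      fix j assume "j \<in> {..<length (p n) - 1}"
      then have "p n ! j \<in> {t..T}" using partition_Suc_bounds(1)[OF part, of j n] s by auto
      then show "AE \<omega> in P. h (p n ! j) \<omega> = \<xi> \<omega> * f (p n ! j) \<omega>" by (rule eq)
    qed simp
    then show "AE \<omega> in P. R h n \<omega> = \<xi> \<omega> * R f n \<omega>"
      unfolding R_def sint_riemann_full[OF part order_refl]
      by eventually_elim (simp add: sum_distrib_left mult.assoc)
  qed
  then show ?thesis using r1(2) r2(2)
  proof eventually_elim
    case (elim \<omega>)
    have "(\<lambda>n. R f (r1 (r2 n)) \<omega>) \<longlonglongrightarrow> J c f s \<omega>"
      using LIMSEQ_subseq_LIMSEQ[OF elim(2) r2(1)] by (simp add: comp_def)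
    then have "(\<lambda>n. \<xi> \<omega> * R f (r1 (r2 n)) \<omega>) \<longlonglongrightarrow> \<xi> \<omega> * J c f s \<omega>" by (rule tendsto_mult_left)
    with elim(1,3) show ?case by (auto intro: LIMSEQ_unique)
  qed
qed

lemma J_tendsto_0:
  assumes h: "\<And>n. regular (h n)" and B: "\<And>n \<tau>. \<tau> \<in> {t..T} \<Longrightarrow> msq P (h n \<tau>) \<le> ennreal B"
    and lim: "\<And>\<tau>. \<tau> \<in> {t..T} \<Longrightarrow> (\<lambda>n. msq P (h n \<tau>)) \<longlonglongrightarrow> 0" and s: "s \<in> {t..T}"
  shows "(\<lambda>n. msq P (J c (h n) s)) \<longlonglongrightarrow> 0"
proof (rule ennreal_tendsto_0_le[OF _ J_msq_le[OF h s]])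
  have "(\<lambda>n. msq_int (h n)) \<longlonglongrightarrow> 0"
    by (rule msq_int_dominated_convergence[OF regular_joint[OF h] B finite.emptyI]) (use lim in auto)
  then have "(\<lambda>n. (4 * C) * msq_int (h n)) \<longlonglongrightarrow> (4 * C) * 0"
    using C_finite by (intro ennreal_tendsto_cmult) (auto simp: ennreal_mult_less_top)
  then show "(\<lambda>n. (4 * C) * msq_int (h n)) \<longlonglongrightarrow> 0" by simp
qed

end

section \<open>Iterated integrals and the reversal of the order of integration\<close>

locale iterated_setting = bounded_martingale_setting P F T M \<rho> t K
  for P :: "'a measure" and F T M \<rho> t K +
  fixes c :: "nat \<Rightarrow> integrator" and \<psi> :: "nat \<Rightarrow> real \<Rightarrow> real" and k :: nat
  assumes \<psi>_continuous: "\<And>l. l \<in> {1..k} \<Longrightarrow> continuous_on {t..T} (\<psi> l)"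
begin

definition level :: "nat \<Rightarrow> (real \<Rightarrow> 'a \<Rightarrow> real) \<Rightarrow> real \<Rightarrow> 'a \<Rightarrow> real" where
  "level l f = J (c l) (\<lambda>\<tau> \<omega>. \<psi> l \<tau> * f \<tau> \<omega>)"

text \<open>The highest level acts first, so \<open>levels r\<close> is the operator formed by the
  \<open>r\<close> outer integrals, applied to whatever process stands inside. The reversal feeds
  jump processes to it.\<close>

primrec levels :: "nat \<Rightarrow> (real \<Rightarrow> 'a \<Rightarrow> real) \<Rightarrow> real \<Rightarrow> 'a \<Rightarrow> real" where
  "levels 0 f = f"
| "levels (Suc r) f = levels r (level (Suc r) f)"

lemma regular_weight: "l \<in> {1..k} \<Longrightarrow> regular f \<Longrightarrow> regular (\<lambda>\<tau> \<omega>. \<psi> l \<tau> * f \<tau> \<omega>)"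
  using regular_mult_continuous \<psi>_continuous by blast

lemma level_regular: "l \<in> {1..k} \<Longrightarrow> regular f \<Longrightarrow> regular (level l f)"
  unfolding level_def using J_regular regular_weight by blast

lemma levels_regular: "r \<le> k \<Longrightarrow> regular f \<Longrightarrow> regular (levels r f)"
proof (induction r arbitrary: f)
  case (Suc r)
  then show ?case using level_regular[of "Suc r" f] by simp
qed simp

lemma level_scale:
  assumes "l \<in> {1..k}" "regular f" "regular h"
    and eq: "\<And>\<tau>. \<tau> \<in> {t..T} \<Longrightarrow> AE \<omega> in P. h \<tau> \<omega> = \<xi> \<omega> * f \<tau> \<omega>" and s: "s \<in> {t..T}"
  shows "AE \<omega> in P. level l h s \<omega> = \<xi> \<omega> * level l f s \<omega>"
  unfolding level_def
proof (rule J_scale[OF regular_weight[OF assms(1,2)] regular_weight[OF assms(1,3)] _ s])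
  fix \<tau> assume "\<tau> \<in> {t..T}"
  from eq[OF this] show "AE \<omega> in P. \<psi> l \<tau> * h \<tau> \<omega> = \<xi> \<omega> * (\<psi> l \<tau> * f \<tau> \<omega>)"
    by eventually_elim simp
qed

lemma level_diff:
  assumes "l \<in> {1..k}" "regular f" "regular g" "regular h"
    and eq: "\<And>\<tau>. \<tau> \<in> {t..T} \<Longrightarrow> AE \<omega> in P. h \<tau> \<omega> = f \<tau> \<omega> - g \<tau> \<omega>" and s: "s \<in> {t..T}"
  shows "AE \<omega> in P. level l h s \<omega> = level l f s \<omega> - level l g s \<omega>"
  unfolding level_def
proof (rule J_diff[OF regular_weight[OF assms(1,2)] regular_weight[OF assms(1,3)] regular_weight[OF assms(1,4)] _ s])
  fix \<tau> assume "\<tau> \<in> {t..T}"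
  from eq[OF this] show "AE \<omega> in P. \<psi> l \<tau> * h \<tau> \<omega> = \<psi> l \<tau> * f \<tau> \<omega> - \<psi> l \<tau> * g \<tau> \<omega>"
    by eventually_elim (simp add: right_diff_distrib)
qed

lemma weight_bounded:
  assumes "l \<in> {1..k}"
  obtains D where "0 \<le> D" "\<And>\<tau>. \<tau> \<in> {t..T} \<Longrightarrow> (\<psi> l \<tau>)\<^sup>2 \<le> D"
proof -
  have "bounded ((\<lambda>\<tau>. (\<psi> l \<tau>)\<^sup>2) ` {t..T})"
    using \<psi>_continuous[OF assms] by (intro compact_imp_bounded compact_continuous_image continuous_on_power) auto
  then obtain D where D: "\<forall>\<tau>\<in>{t..T}. \<bar>(\<psi> l \<tau>)\<^sup>2\<bar> \<le> D" unfolding bounded_iff by auto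
  then have "\<bar>(\<psi> l t)\<^sup>2\<bar> \<le> D" using t_less by simp
  then have "0 \<le> D" using abs_ge_zero order_trans by blast
  then show ?thesis using D by (intro that[of D]) auto
qed

text \<open>Both the uniform bound and the convergence at each time are handed on, so the step can
  be repeated through all levels.\<close>

lemma level_tendsto_0:
  assumes l: "l \<in> {1..k}" and h: "\<And>n. regular (h n)"
    and B: "0 \<le> B" "\<And>n \<tau>. \<tau> \<in> {t..T} \<Longrightarrow> msq P (h n \<tau>) \<le> ennreal B"
    and lim: "\<And>\<tau>. \<tau> \<in> {t..T} \<Longrightarrow> (\<lambda>n. msq P (h n \<tau>)) \<longlonglongrightarrow> 0"
  shows "\<exists>B'\<ge>0. \<forall>n. \<forall>s\<in>{t..T}. msq P (level l (h n) s) \<le> ennreal B'"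
    and "s \<in> {t..T} \<Longrightarrow> (\<lambda>n. msq P (level l (h n) s)) \<longlonglongrightarrow> 0"
proof -
  obtain D where D: "0 \<le> D" "\<And>\<tau>. \<tau> \<in> {t..T} \<Longrightarrow> (\<psi> l \<tau>)\<^sup>2 \<le> D" using weight_bounded[OF l] by blast
  have wr: "regular (\<lambda>\<tau> \<omega>. \<psi> l \<tau> * h n \<tau> \<omega>)" for n by (rule regular_weight[OF l h])
  have w: "msq P (\<lambda>\<omega>. \<psi> l \<tau> * h n \<tau> \<omega>) = ennreal ((\<psi> l \<tau>)\<^sup>2) * msq P (h n \<tau>)" if "\<tau> \<in> {t..T}" for n \<tau>
    by (rule msq_cmult[OF regular_meas[OF h that]])
  have wB: "msq P (\<lambda>\<omega>. \<psi> l \<tau> * h n \<tau> \<omega>) \<le> ennreal (D * B)" if "\<tau> \<in> {t..T}" for n \<tau>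
    unfolding w[OF that] using D B that by (auto simp: ennreal_mult intro!: mult_mono ennreal_leI)
  have DB: "0 \<le> D * B" using D(1) B(1) by simp
  obtain B' where "0 \<le> B'" "\<And>f. regular f \<Longrightarrow> (\<forall>\<tau>\<in>{t..T}. msq P (f \<tau>) \<le> ennreal (D * B)) \<Longrightarrow>
      (\<forall>s\<in>{t..T}. msq P (J (c l) f s) \<le> ennreal B')"
    using J_msq_bounded[OF DB, of "c l"] by blast
  then show "\<exists>B'\<ge>0. \<forall>n. \<forall>s\<in>{t..T}. msq P (level l (h n) s) \<le> ennreal B'"
    unfolding level_def using wr wB by blast
  show "(\<lambda>n. msq P (level l (h n) s)) \<longlonglongrightarrow> 0" if s: "s \<in> {t..T}"
    unfolding level_def
  proof (rule J_tendsto_0[OF wr wB _ s])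
    fix \<tau> assume \<tau>: "\<tau> \<in> {t..T}"
    have "(\<lambda>n. ennreal ((\<psi> l \<tau>)\<^sup>2) * msq P (h n \<tau>)) \<longlonglongrightarrow> ennreal ((\<psi> l \<tau>)\<^sup>2) * 0"
      by (intro ennreal_tendsto_cmult lim[OF \<tau>]) simp
    then show "(\<lambda>n. msq P (\<lambda>\<omega>. \<psi> l \<tau> * h n \<tau> \<omega>)) \<longlonglongrightarrow> 0" by (simp add: w[OF \<tau>])
  qed
qed

lemma levels_scale:
  assumes "r \<le> k" "regular f" "regular h" "\<And>\<tau>. \<tau> \<in> {t..T} \<Longrightarrow> AE \<omega> in P. h \<tau> \<omega> = \<xi> \<omega> * f \<tau> \<omega>" "s \<in> {t..T}"
  shows "AE \<omega> in P. levels r h s \<omega> = \<xi> \<omega> * levels r f s \<omega>"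
  using assms
proof (induction r arbitrary: f h)
  case (Suc r)
  have l: "Suc r \<in> {1..k}" using Suc.prems(1) by simp
  show ?case unfolding levels.simps
    by (rule Suc.IH) (use Suc.prems l level_scale[OF l Suc.prems(2-4)] in \<open>auto intro: level_regular\<close>)
qed simp

lemma levels_diff:
  assumes "r \<le> k" "regular f" "regular g" "regular h"
    and "\<And>\<tau>. \<tau> \<in> {t..T} \<Longrightarrow> AE \<omega> in P. h \<tau> \<omega> = f \<tau> \<omega> - g \<tau> \<omega>" "s \<in> {t..T}"
  shows "AE \<omega> in P. levels r h s \<omega> = levels r f s \<omega> - levels r g s \<omega>"
  using assms
proof (induction r arbitrary: f g h)
  case (Suc r)
  have l: "Suc r \<in> {1..k}" using Suc.prems(1) by simp
  show ?case unfolding levels.simps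
    by (rule Suc.IH) (use Suc.prems l level_diff[OF l Suc.prems(2-5)] in \<open>auto intro: level_regular\<close>)
qed simp

lemma levels_tendsto_0:
  assumes "r \<le> k" "\<And>n. regular (h n)" "0 \<le> B" "\<And>n \<tau>. \<tau> \<in> {t..T} \<Longrightarrow> msq P (h n \<tau>) \<le> ennreal B"
    and "\<And>\<tau>. \<tau> \<in> {t..T} \<Longrightarrow> (\<lambda>n. msq P (h n \<tau>)) \<longlonglongrightarrow> 0" and s: "s \<in> {t..T}"
  shows "(\<lambda>n. msq P (levels r (h n) s)) \<longlonglongrightarrow> 0"
  using assms(1-5)
proof (induction r arbitrary: h B)
  case 0
  then show ?case using s by simp
next
  case (Suc r)
  have l: "Suc r \<in> {1..k}" using Suc.prems(1) by simp
  obtain B' where B': "0 \<le> B'" "\<And>n s. s \<in> {t..T} \<Longrightarrow> msq P (level (Suc r) (h n) s) \<le> ennreal B'"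
    using level_tendsto_0(1)[OF l Suc.prems(2-5)] by blast
  show ?case unfolding levels.simps
    by (rule Suc.IH[OF _ level_regular[OF l Suc.prems(2)] B' level_tendsto_0(2)[OF l Suc.prems(2-5)]])
       (use Suc.prems(1) in auto)
qed

section \<open>Jump processes and iterated integrals over [s,T]\<close>

lemma zero_regular: "regular (\<lambda>\<tau> \<omega>. 0)"
  using regular_jump[of t "\<lambda>\<omega>. 0"] t_less by simp

lemma regular_add:
  assumes "regular f" "regular g"
  shows "regular (\<lambda>\<tau> \<omega>. f \<tau> \<omega> + g \<tau> \<omega>)"
  using regular_diff[OF assms(1) regular_diff[OF zero_regular assms(2)]] by simp

lemma regular_jumps:
  assumes "\<And>l. l < (N :: nat) \<Longrightarrow> u l \<in> {t..T} \<and> \<xi> l \<in> borel_measurable (F (u l)) \<and> msq P (\<xi> l) < \<infinity>"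
  shows "regular (\<lambda>\<tau> \<omega>. \<Sum>l<N. indicator {u l..} \<tau> * \<xi> l \<omega>)"
  using assms
proof (induction N)
  case (Suc N)
  then show ?case using regular_jump[of "u N" "\<xi> N"] by (auto intro: regular_add)
qed (simp add: zero_regular)

text \<open>A process that is 1 from time \<open>s\<close> on confines all integrations to
  \<open>[s,T]\<close>, so this is the forward iterated integral of the first \<open>r\<close>
  weights over that interval. It will turn out to be the inner reversed integral.\<close>

definition tail :: "nat \<Rightarrow> real \<Rightarrow> 'a \<Rightarrow> real" where
  "tail r s = levels r (\<lambda>\<tau> \<omega>. indicator {s..} \<tau>) T"

lemma regular_indicator: "u \<in> {t..T} \<Longrightarrow> regular (\<lambda>\<tau> \<omega>. indicator {u..} \<tau>)"
  using regular_jump[of u "\<lambda>\<omega>. 1"] by (simp add: msq_def emeasure_space_1)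

lemma levels_jumps:
  assumes "r \<le> k" "\<And>l. l < (N :: nat) \<Longrightarrow> u l \<in> {t..T} \<and> \<xi> l \<in> borel_measurable (F (u l)) \<and> msq P (\<xi> l) < \<infinity>"
  shows "AE \<omega> in P. levels r (\<lambda>\<tau> \<omega>. \<Sum>l<N. indicator {u l..} \<tau> * \<xi> l \<omega>) T \<omega> = (\<Sum>l<N. \<xi> l \<omega> * tail r (u l) \<omega>)"
  using assms(2)
proof (induction N)
  case 0
  \<comment> \<open>Scaling by the factor 0 shows that the zero process is sent to 0 almost
    surely.\<close>
  show ?case
    using levels_scale[OF assms(1) zero_regular zero_regular, of "\<lambda>\<omega>. 0" T] t_less by simp
next
  case (Suc N)
  note N = Suc.prems[of N, simplified]
  have T: "T \<in> {t..T}" using t_less by simp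
  \<comment> \<open>The last jump is the difference of two consecutive sums, so the law for
    differences yields additivity.\<close>
  have "AE \<omega> in P. levels r (\<lambda>\<tau> \<omega>. indicator {u N..} \<tau> * \<xi> N \<omega>) T \<omega>
      = levels r (\<lambda>\<tau> \<omega>. \<Sum>l<Suc N. indicator {u l..} \<tau> * \<xi> l \<omega>) T \<omega>
        - levels r (\<lambda>\<tau> \<omega>. \<Sum>l<N. indicator {u l..} \<tau> * \<xi> l \<omega>) T \<omega>"
    using Suc.prems by (intro levels_diff[OF assms(1) _ _ _ _ T] regular_jumps regular_jump) auto
  moreover have "AE \<omega> in P. levels r (\<lambda>\<tau> \<omega>. indicator {u N..} \<tau> * \<xi> N \<omega>) T \<omega> = \<xi> N \<omega> * tail r (u N) \<omega>"
    unfolding tail_def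
    using N by (intro levels_scale[OF assms(1) _ _ _ T] regular_indicator regular_jump) auto
  moreover have "AE \<omega> in P. levels r (\<lambda>\<tau> \<omega>. \<Sum>l<N. indicator {u l..} \<tau> * \<xi> l \<omega>) T \<omega> = (\<Sum>l<N. \<xi> l \<omega> * tail r (u l) \<omega>)"
    using Suc.prems by (intro Suc.IH) auto
  ultimately show ?case by eventually_elim simp
qed

text \<open>Cauchy-Schwarz would ask for fourth moments of \<open>g u\<close> and of the increment.
  The product is the integral of a one-interval simple process, so the general bound applies
  instead.\<close>

lemma increment_msq_finite:
  assumes g: "regular g" and uv: "t \<le> u" "u \<le> v" "v \<le> T"
  shows "msq P (\<lambda>\<omega>. g u \<omega> * (Z b v \<omega> - Z b u \<omega>)) < \<infinity>"
proof -
  obtain B where B: "0 \<le> B" "\<And>\<tau>. \<tau> \<in> {t..T} \<Longrightarrow> msq P (g \<tau>) \<le> ennreal B" using regular_bounded[OF g] by blast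
  let ?G = "[(u, v, g u)]"
  have u: "u \<in> {t..T}" using uv by simp
  have "simple b ?G"
    using regular_adapted[OF g u] regular_meas[OF g u] uv by (cases b) (auto simp: simple_def)
  then have "msq P (sint (Z b) ?G) \<le> C * msq_int (proc ?G)" by (rule sint_bound)
  also have "\<dots> \<le> C * (ennreal B * ennreal ((T + 1) - t))"
    using B(2)[OF u] by (intro mult_left_mono msq_int_le_bound) (auto simp: proc_def[abs_def] indicator_def)
  also have "\<dots> < \<infinity>" using C_finite by (simp add: ennreal_mult_less_top)
  finally show ?thesis by (simp add: sint_def[abs_def])
qed

text \<open>With the indicator of \<open>{a..}\<close> as \<open>f\<close> this identifies the inner
  reversed integrals, with \<open>f = \<phi>\<close> and \<open>a = t\<close> the outer one. The
  assumption \<open>zero\<close> lets partitions of \<open>[a,T]\<close> compute integrals that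
  start at \<open>t\<close>.\<close>

theorem reversed_sums_converge:
  assumes r: "Suc r \<le> k" and f: "regular f" and a: "a \<in> {t..T}" and zero: "\<And>\<tau> \<omega>. t \<le> \<tau> \<Longrightarrow> \<tau> < a \<Longrightarrow> f \<tau> \<omega> = 0"
  shows "ms_partition_limit P a T (reversed_sum (\<lambda>\<tau> \<omega>. \<psi> (Suc r) \<tau> * f \<tau> \<omega>) (Z (c (Suc r))) (tail r)) (levels (Suc r) f T)"
  unfolding ms_partition_limit_def
proof (intro allI impI)
  fix p assume p: "partition_seq a T p"
  then have part: "partition_on_interval a T (p n)" for n by (simp add: partition_seq_def)
  have l: "Suc r \<in> {1..k}" and rk: "r \<le> k" using r by auto
  have T: "T \<in> {t..T}" using t_less by simp
  define g where "g = (\<lambda>\<tau> \<omega>. \<psi> (Suc r) \<tau> * f \<tau> \<omega>)"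
  define b where "b = c (Suc r)"
  have g: "regular g" unfolding g_def by (rule regular_weight[OF l f])
  have Jg: "level (Suc r) f = J b g" by (simp add: level_def g_def b_def)
  define \<xi> where "\<xi> n l \<omega> = g (p n ! l) \<omega> * (Z b (p n ! Suc l) \<omega> - Z b (p n ! l) \<omega>)" for n l \<omega>
  have nodes: "p n ! l \<in> {t..T}" "p n ! Suc l \<in> {t..T}" "p n ! l < p n ! Suc l" if "l < length (p n) - 1" for n l
    using partition_Suc_bounds[OF part that] partition_nth_less[OF part that] a by auto
  have \<xi>: "p n ! Suc l \<in> {t..T} \<and> \<xi> n l \<in> borel_measurable (F (p n ! Suc l)) \<and> msq P (\<xi> n l) < \<infinity>"
    if "l < length (p n) - 1" for n l
  proof (intro conjI)
    note N = nodes[OF that]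
    show "p n ! Suc l \<in> {t..T}" by (rule N)
    show "\<xi> n l \<in> borel_measurable (F (p n ! Suc l))"
      unfolding \<xi>_def using N
      by (intro borel_measurable_times borel_measurable_diff Z_meas_F measurable_F_mono[OF Z_meas_F, of "p n ! l"]
          measurable_F_mono[OF regular_adapted[OF g], of "p n ! l"]) auto
    show "msq P (\<xi> n l) < \<infinity>" unfolding \<xi>_def using N by (intro increment_msq_finite[OF g]) auto
  qed
  \<comment> \<open>The jump sits at the right endpoint, where \<open>\<xi> n l\<close> is first
    guaranteed to be known; for that reason \<open>tail\<close> is evaluated at
    \<open>p ! Suc l\<close>.\<close>
  define h where "h n = (\<lambda>\<tau> \<omega>. \<Sum>l<length (p n) - 1. indicator {p n ! Suc l..} \<tau> * \<xi> n l \<omega>)" for n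
  have h: "regular (h n)" for n unfolding h_def by (rule regular_jumps) (rule \<xi>)
  \<comment> \<open>At a fixed time the jump process is the Riemann sum over the subintervals
    completed by then, so the bound and the limit of Riemann sums apply to it.\<close>
  have h_sint: "h n \<tau> = sint (Z b) (riemann (p n) ((!) (p n)) \<tau> g)" for n \<tau>
    unfolding h_def sint_riemann_sum[abs_def] \<xi>_def by (intro ext sum.cong) (auto simp: indicator_def)
  have d: "regular (\<lambda>\<tau> \<omega>. h n \<tau> \<omega> - J b g \<tau> \<omega>)" for n
    by (rule regular_diff[OF h J_regular[OF g]])
  obtain B1 where B1: "0 \<le> B1" "\<And>\<tau>. \<tau> \<in> {t..T} \<Longrightarrow> msq P (g \<tau>) \<le> ennreal B1" using regular_bounded[OF g] by blast
  obtain B2 where B2: "0 \<le> B2" "\<And>\<tau>. \<tau> \<in> {t..T} \<Longrightarrow> msq P (J b g \<tau>) \<le> ennreal B2"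
    using regular_bounded[OF J_regular[OF g]] by blast
  \<comment> \<open>\<open>B3\<close> is the constant of \<open>C\<close> times a bound on
    \<open>msq_int\<close> of the Riemann processes, valid for all \<open>n\<close> and all
    times.\<close>
  define B3 where "B3 = (K + (T - t)) * (B1 * ((T + 1) - t))"
  have B3: "0 \<le> B3" using K_nonneg t_less B1(1) by (simp add: B3_def)
  have hB: "msq P (h n \<tau>) \<le> ennreal B3" if "\<tau> \<in> {t..T}" for n \<tau>
  proof -
    have "simple b (riemann (p n) ((!) (p n)) \<tau> g)"
      using a by (intro simple_riemann_left[OF part] regular_adapted[OF g]) auto
    then have "msq P (h n \<tau>) \<le> C * msq_int (proc (riemann (p n) ((!) (p n)) \<tau> g))"
      unfolding h_sint by (rule sint_bound)
    also have "\<dots> \<le> C * (ennreal B1 * ennreal ((T + 1) - t))"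
      by (intro mult_left_mono msq_int_le_bound msq_proc_riemann_le[OF part] B1(2) nodes(1)) auto
    also have "\<dots> = ennreal B3"
      using K_nonneg t_less B1(1) unfolding C_def B3_def by (subst ennreal_mult, simp, simp)+ simp
    finally show ?thesis .
  qed
  have dB: "msd P (h n \<tau>) (J b g \<tau>) \<le> ennreal (2 * B3 + 2 * B2)" if "\<tau> \<in> {t..T}" for n \<tau>
  proof -
    have "msd P (h n \<tau>) (J b g \<tau>) \<le> 2 * msq P (h n \<tau>) + 2 * msq P (J b g \<tau>)"
      using that by (intro msq_diff_le regular_meas[OF h] J_meas[OF g])
    also have "\<dots> \<le> 2 * ennreal B3 + 2 * ennreal B2"
      by (intro add_mono mult_left_mono hB B2(2) that) auto
    also have "\<dots> = ennreal (2 * B3 + 2 * B2)" using B3 B2(1) by (simp add: ennreal_mult)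
    finally show ?thesis .
  qed
  have g0: "g \<tau> \<omega> = 0" if "t \<le> \<tau>" "\<tau> < a" for \<tau> \<omega> using zero[OF that] by (simp add: g_def)
  have dlim: "(\<lambda>n. msd P (h n \<tau>) (J b g \<tau>)) \<longlonglongrightarrow> 0" if "\<tau> \<in> {t..T}" for \<tau>
    unfolding h_sint using a that by (intro J_riemann_tendsto[OF g p _ g0]) auto
  have lim: "(\<lambda>n. msq P (levels r (\<lambda>\<tau> \<omega>. h n \<tau> \<omega> - J b g \<tau> \<omega>) T)) \<longlonglongrightarrow> 0"
    using B3 B2(1) by (intro levels_tendsto_0[OF rk d _ dB dlim T]) auto
  define S where "S n \<omega> = (\<Sum>l<length (p n) - 1. \<xi> n l \<omega> * tail r (p n ! Suc l) \<omega>)" for n \<omega>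
  have "AE \<omega> in P. levels r (\<lambda>\<tau> \<omega>. h n \<tau> \<omega> - J b g \<tau> \<omega>) T \<omega> = S n \<omega> - levels (Suc r) f T \<omega>" for n
  proof -
    have "AE \<omega> in P. levels r (\<lambda>\<tau> \<omega>. h n \<tau> \<omega> - J b g \<tau> \<omega>) T \<omega> = levels r (h n) T \<omega> - levels r (J b g) T \<omega>"
      by (rule levels_diff[OF rk h J_regular[OF g] d _ T]) simp
    moreover have "AE \<omega> in P. levels r (h n) T \<omega> = S n \<omega>"
      unfolding h_def S_def by (rule levels_jumps[OF rk \<xi>])
    ultimately show ?thesis by eventually_elim (simp add: Jg)
  qed
  then have "msq P (levels r (\<lambda>\<tau> \<omega>. h n \<tau> \<omega> - J b g \<tau> \<omega>) T) = msd P (S n) (levels (Suc r) f T)" for n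
    by (rule msq_cong_AE)
  with lim have S_lim: "(\<lambda>n. msd P (S n) (levels (Suc r) f T)) \<longlonglongrightarrow> 0" by simp
  have tail_meas: "tail r u \<in> borel_measurable P" if "u \<in> {t..T}" for u
    unfolding tail_def by (rule regular_meas[OF levels_regular[OF rk regular_indicator[OF that]] T])
  have S_meas: "S n \<in> borel_measurable P" for n
    unfolding S_def using nodes(2) \<xi>
    by (intro borel_measurable_sum borel_measurable_times tail_meas measurable_F_P) auto
  have X: "square_integrable P (levels (Suc r) f T)"
  proof -
    have reg: "regular (levels (Suc r) f)" by (rule levels_regular[OF r f])
    obtain B where "msq P (levels (Suc r) f T) \<le> ennreal B" using regular_bounded[OF reg] T by blast
    then have "msq P (levels (Suc r) f T) < \<infinity>" by (rule order.strict_trans1) simp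
    then show ?thesis using regular_meas[OF reg T] by (simp add: square_integrable_iff_msq)
  qed
  have S_eq: "(\<lambda>n. reversed_sum (\<lambda>\<tau> \<omega>. \<psi> (Suc r) \<tau> * f \<tau> \<omega>) (Z (c (Suc r))) (tail r) (p n)) = S"
    by (simp add: fun_eq_iff S_def \<xi>_def g_def b_def)
  show "ms_tendsto P (\<lambda>n. reversed_sum (\<lambda>\<tau> \<omega>. \<psi> (Suc r) \<tau> * f \<tau> \<omega>) (Z (c (Suc r))) (tail r) (p n)) (levels (Suc r) f T)"
    unfolding S_eq ms_tendsto_iff_msq using S_meas X S_lim by blast
qed

end

section \<open>The integrals of the statement\<close>

context bounded_martingale_setting
begin

lemma weighted_add_le:
  assumes f: "joint_meas f" and g: "joint_meas g"
  shows "weighted (\<lambda>\<tau> \<omega>. f \<tau> \<omega> + g \<tau> \<omega>) \<le> 2 * weighted f + 2 * weighted g"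
proof -
  define u where "u h \<omega> \<tau> = ennreal ((h \<tau> \<omega>)\<^sup>2 * \<rho> \<tau> \<omega>) * indicator {t..T} \<tau>" for h \<omega> \<tau>
  have u_path: "u h \<omega> \<in> borel_measurable lborel" if "joint_meas h" "\<omega> \<in> space P" for h \<omega>
    using measurable_Pair1[OF weighted_square_measurable[OF that(1)] that(2)] by (simp add: u_def[abs_def])
  have u_outer: "(\<lambda>\<omega>. \<integral>\<^sup>+\<tau>. u h \<omega> \<tau> \<partial>lborel) \<in> borel_measurable P" if "joint_meas h" for h
    using nn_integral_time_measurable[OF weighted_square_measurable[OF that]] by (simp add: u_def)
  have sq: "(x + y)\<^sup>2 \<le> 2 * x\<^sup>2 + 2 * y\<^sup>2" for x y :: real
    using zero_le_power2[of "x - y"] by (simp add: power2_eq_square algebra_simps)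
  have "u (\<lambda>\<tau> \<omega>. f \<tau> \<omega> + g \<tau> \<omega>) \<omega> \<tau> \<le> 2 * u f \<omega> \<tau> + 2 * u g \<omega> \<tau>" for \<omega> \<tau>
  proof -
    have "ennreal ((f \<tau> \<omega> + g \<tau> \<omega>)\<^sup>2 * \<rho> \<tau> \<omega>) \<le> ennreal (2 * (f \<tau> \<omega>)\<^sup>2 + 2 * (g \<tau> \<omega>)\<^sup>2) * ennreal (\<rho> \<tau> \<omega>)"
      unfolding ennreal_mult'[OF zero_le_power2] by (intro mult_right_mono ennreal_leI sq) simp
    also have "\<dots> = 2 * ennreal ((f \<tau> \<omega>)\<^sup>2 * \<rho> \<tau> \<omega>) + 2 * ennreal ((g \<tau> \<omega>)\<^sup>2 * \<rho> \<tau> \<omega>)"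
      by (simp add: ennreal_mult ennreal_mult'[OF zero_le_power2] distrib_right mult.assoc)
    finally show ?thesis unfolding u_def by (auto simp: indicator_def)
  qed
  then have "weighted (\<lambda>\<tau> \<omega>. f \<tau> \<omega> + g \<tau> \<omega>) \<le> (\<integral>\<^sup>+\<omega>. (\<integral>\<^sup>+\<tau>. 2 * u f \<omega> \<tau> + 2 * u g \<omega> \<tau> \<partial>lborel) \<partial>P)"
    unfolding u_def by (intro nn_integral_mono)
  also have "\<dots> = (\<integral>\<^sup>+\<omega>. 2 * (\<integral>\<^sup>+\<tau>. u f \<omega> \<tau> \<partial>lborel) + 2 * (\<integral>\<^sup>+\<tau>. u g \<omega> \<tau> \<partial>lborel) \<partial>P)"
    using u_path[OF f] u_path[OF g]
    by (intro nn_integral_cong) (simp add: nn_integral_add nn_integral_cmult)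
  also have "\<dots> = 2 * weighted f + 2 * weighted g"
    using u_outer[OF f] u_outer[OF g] by (simp add: nn_integral_add nn_integral_cmult u_def)
  finally show ?thesis .
qed

text \<open>The step processes of the statement are measurable only on \<open>[t,s]\<close>; the
  truncation places them among the processes on \<open>[t,T]\<close>.\<close>

lemma joint_meas_cut_process:
  assumes "measurable_process P t s f" "s \<in> {t..T}"
  shows "joint_meas (cut t s f)"
proof -
  have "(\<lambda>x. indicator {t..<s} (fst x) * (\<lambda>(\<tau>, \<omega>). indicator {t..s} \<tau> * f \<tau> \<omega>) x) \<in> borel_measurable (lborel \<Otimes>\<^sub>M P)"
    using clamp_meas[OF assms(1)] assms(2) by (intro borel_measurable_times indicator_fst_measurable) auto
  moreover have "(\<lambda>x. indicator {t..<s} (fst x) * (\<lambda>(\<tau>, \<omega>). indicator {t..s} \<tau> * f \<tau> \<omega>) x)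
      = (\<lambda>(\<tau>, \<omega>). indicator {t..T} \<tau> * (indicator {t..<s} \<tau> * f \<tau> \<omega>))"
    using assms(2) by (auto simp: fun_eq_iff indicator_def)
  ultimately show ?thesis by (simp add: joint_meas_def)
qed

text \<open>Fubini's theorem accounts for the order of integration, and the null set
  \<open>{s}\<close> for the closed endpoint.\<close>

lemma weighted_cut:
  assumes s: "s \<in> {t..T}" and f: "joint_meas (cut t s f)"
  shows "(\<integral>\<^sup>+\<tau>\<in>{t..s}. (\<integral>\<^sup>+\<omega>. ennreal (\<bar>f \<tau> \<omega>\<bar>\<^sup>2 * \<rho> \<tau> \<omega>) \<partial>P) \<partial>lborel)
    = weighted (cut t s f)"
  unfolding weighted_square_Fubini[OF f]
proof (rule nn_integral_cong_AE)
  show "AE \<tau> in lborel. (\<integral>\<^sup>+\<omega>. ennreal (\<bar>f \<tau> \<omega>\<bar>\<^sup>2 * \<rho> \<tau> \<omega>) \<partial>P) * indicator {t..s} \<tau>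
      = (\<integral>\<^sup>+\<omega>. ennreal ((indicator {t..<s} \<tau> * f \<tau> \<omega>)\<^sup>2 * \<rho> \<tau> \<omega>) \<partial>P) * indicator {t..T} \<tau>"
    using AE_lborel_singleton[of s]
  proof eventually_elim
    case (elim \<tau>)
    then show ?case using s by (cases "\<tau> \<in> {t..<s}") (auto simp: indicator_def)
  qed
qed

lemma H2I:
  assumes "joint_meas f" "s \<in> {t..T}" "\<And>\<tau>. \<tau> \<in> {t..s} \<Longrightarrow> f \<tau> \<in> borel_measurable (F \<tau>)" "msq_int f < \<infinity>"
  shows "f \<in> H2 P F \<rho> t s"
proof -
  have "(\<integral>\<^sup>+\<omega>. (\<integral>\<^sup>+\<tau>\<in>{t..s}. ennreal ((f \<tau> \<omega>)\<^sup>2 * \<rho> \<tau> \<omega>) \<partial>lborel) \<partial>P) \<le> weighted f"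
    using assms(2) by (intro nn_integral_mono) (auto simp: indicator_def)
  also have "\<dots> \<le> ennreal K * msq_int f" by (rule weighted_square_le[OF assms(1)])
  also have "\<dots> < \<infinity>" using assms(4) by (simp add: ennreal_mult_less_top)
  finally show ?thesis
    using assms(2,3) measurable_process_of_joint_meas[OF assms(1)] by (simp add: H2_def)
qed

lemma regular_msq_int_finite:
  assumes "regular f" shows "msq_int f < \<infinity>"
proof -
  obtain B where B: "0 \<le> B" "\<And>\<tau>. \<tau> \<in> {t..T} \<Longrightarrow> msq P (f \<tau>) \<le> ennreal B" using regular_bounded[OF assms] by blast
  have "msq_int f \<le> ennreal B * ennreal ((T + 1) - t)" by (rule msq_int_le_bound[OF B(2)])
  also have "\<dots> < \<infinity>" by (simp add: ennreal_mult_less_top)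
  finally show ?thesis .
qed

text \<open>\<open>martingale_integral\<close> demands that approximations exist, since a condition
  on all of them could hold vacuously. Left Riemann processes qualify because \<rho> is
  bounded.\<close>

lemma step_approximation_exists:
  assumes f: "regular f" and s: "s \<in> {t..T}"
  shows "\<exists>p \<phi>s. step_approximation P F \<rho> t s f p \<phi>s"
proof -
  obtain p where p: "partition_seq t s p" using partition_seq_exists[of t s] s by auto
  have part: "partition_on_interval t s (p n)" for n using p by (simp add: partition_seq_def)
  define G where "G n = riemann (p n) ((!) (p n)) s f" for n
  have G: "approximates Martingale G (cut t s f)"
    unfolding G_def using s by (intro approximates_riemann_left[OF f _ _ p]) auto
  then have sG: "simple Martingale (G n)" for n by (simp add: approximates_def)
  obtain B where B: "0 \<le> B" "\<And>\<tau>. \<tau> \<in> {t..T} \<Longrightarrow> msq P (f \<tau>) \<le> ennreal B" using regular_bounded[OF f] by blast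
  have H2: "proc (G n) \<in> H2 P F \<rho> t s" for n
  proof (rule H2I[OF joint_meas_proc[OF sG] s])
    have "msq_int (proc (G n)) \<le> ennreal B * ennreal ((T + 1) - t)"
      unfolding G_def using partition_Suc_bounds(1)[OF part] s
      by (intro msq_int_le_bound msq_proc_riemann_le[OF part] B(2)) force
    also have "\<dots> < \<infinity>" by (simp add: ennreal_mult_less_top)
    finally show "msq_int (proc (G n)) < \<infinity>" .
  qed (use s in \<open>auto intro: proc_adapted[OF sG]\<close>)
  have step: "step_on (p n) (proc (G n))" for n
    unfolding step_on_def
  proof (intro allI impI ballI ext)
    fix i \<tau> \<omega> assume i: "i < length (p n) - 1" and \<tau>: "\<tau> \<in> {p n ! i..<p n ! Suc i}"
    have "p n ! i < p n ! Suc i" using partition_nth_less[OF part i] .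
    then show "proc (G n) \<tau> \<omega> = proc (G n) (p n ! i) \<omega>"
      using \<tau> unfolding G_def by (simp add: proc_riemann_eq[OF part i])
  qed
  have "(\<lambda>n. \<integral>\<^sup>+\<tau>\<in>{t..s}. (\<integral>\<^sup>+\<omega>. ennreal (\<bar>proc (G n) \<tau> \<omega> - f \<tau> \<omega>\<bar>\<^sup>2 * \<rho> \<tau> \<omega>) \<partial>P) \<partial>lborel) \<longlonglongrightarrow> 0"
  proof (rule ennreal_tendsto_0_le)
    have "(\<lambda>n. ennreal K * msd_int (proc (G n)) (cut t s f)) \<longlonglongrightarrow> ennreal K * 0"
      using G by (intro ennreal_tendsto_cmult) (auto simp: approximates_def)
    then show "(\<lambda>n. ennreal K * msd_int (proc (G n)) (cut t s f)) \<longlonglongrightarrow> 0" by simp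
    fix n
    have cut: "indicator {t..<s} \<tau> * (proc (G n) \<tau> \<omega> - f \<tau> \<omega>) = proc (G n) \<tau> \<omega> - indicator {t..<s} \<tau> * f \<tau> \<omega>" for \<tau> \<omega>
    proof (cases "\<tau> \<in> {t..<s}")
      case False
      then have "\<tau> < t \<or> s \<le> \<tau> \<or> s \<le> \<tau>" by auto
      from False proc_riemann_outside[OF part this, of n "\<lambda>j. p n ! j" f \<omega>] show ?thesis unfolding G_def by simp
    qed simp
    have j: "joint_meas (\<lambda>\<tau> \<omega>. proc (G n) \<tau> \<omega> - indicator {t..<s} \<tau> * f \<tau> \<omega>)"
      by (intro joint_meas_diff joint_meas_proc[OF sG] joint_meas_cut regular_joint[OF f])
    show "(\<integral>\<^sup>+\<tau>\<in>{t..s}. (\<integral>\<^sup>+\<omega>. ennreal (\<bar>proc (G n) \<tau> \<omega> - f \<tau> \<omega>\<bar>\<^sup>2 * \<rho> \<tau> \<omega>) \<partial>P) \<partial>lborel)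
        \<le> ennreal K * msd_int (proc (G n)) (cut t s f)"
      using weighted_square_le[OF j]
      by (simp only: weighted_cut[OF s, of "\<lambda>\<tau> \<omega>. proc (G n) \<tau> \<omega> - f \<tau> \<omega>", unfolded cut, OF j])
  qed
  then have "step_approximation P F \<rho> t s f p (\<lambda>n. proc (G n))"
    using p H2 step by (simp add: step_approximation_def)
  then show ?thesis by blast
qed

text \<open>The given step processes converge in the weighted norm, which does not control the norm
  of d\<tau>, so the defining property of \<open>SI\<close> cannot be applied to them. They are
  compared with left Riemann processes, for which the limit is known, through the bound in the
  weighted norm.\<close>

lemma J_martingale_integral:
  assumes f: "regular f" and s: "s \<in> {t..T}"
  shows "martingale_integral P F M \<rho> f t s (J Martingale f s)"
  unfolding martingale_integral_def
proof (intro conjI allI impI)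
  show "f \<in> H2 P F \<rho> t s"
    using s by (intro H2I[OF regular_joint[OF f] s _ regular_msq_int_finite[OF f]] regular_adapted[OF f]) auto
  show "\<exists>p \<phi>s. step_approximation P F \<rho> t s f p \<phi>s" by (rule step_approximation_exists[OF f s])
  fix p \<phi>s assume A: "step_approximation P F \<rho> t s f p \<phi>s"
  then have p: "partition_seq t s p" and H2: "\<And>n. \<phi>s n \<in> H2 P F \<rho> t s" and step: "\<And>n. step_on (p n) (\<phi>s n)"
    by (auto simp: step_approximation_def)
  have part: "partition_on_interval t s (p n)" for n using p by (simp add: partition_seq_def)
  have tsT: "t \<le> t" "s \<le> T" using s by auto
  define G where "G n = riemann (p n) ((!) (p n)) s (\<phi>s n)" for n
  define H where "H n = riemann (p n) ((!) (p n)) s f" for n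
  have sG: "simple Martingale (G n)" for n
    unfolding G_def using H2[of n] by (intro simple_riemann_left[OF part tsT]) (auto simp: H2_def)
  have H: "approximates Martingale H (cut t s f)"
    unfolding H_def by (rule approximates_riemann_left[OF f tsT p order_refl])
  then have sH: "simple Martingale (H n)" for n by (simp add: approximates_def)
  have H_lim: "(\<lambda>n. msd P (sint M (H n)) (J Martingale f s)) \<longlonglongrightarrow> 0"
    using J_SI[OF f s, of Martingale] H by (auto simp: SI_def)
  have procG: "proc (G n) = (\<lambda>\<tau> \<omega>. indicator {t..<s} \<tau> * \<phi>s n \<tau> \<omega>)" for n
  proof (intro ext)
    fix \<tau> \<omega>
    show "proc (G n) \<tau> \<omega> = indicator {t..<s} \<tau> * \<phi>s n \<tau> \<omega>"
    proof (cases "\<tau> \<in> {t..<s}")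
      case True
      then obtain j where j: "j < length (p n) - 1" "p n ! j \<le> \<tau>" "\<tau> < p n ! Suc j"
        using partition_locate[OF part, of \<tau> n] by auto
      have "p n ! Suc j \<le> s" using partition_Suc_bounds(2)[OF part j(1)] by simp
      then have "proc (G n) \<tau> \<omega> = \<phi>s n (p n ! j) \<omega>" unfolding G_def by (simp add: proc_riemann_eq[OF part j])
      moreover have "\<phi>s n \<tau> = \<phi>s n (p n ! j)"
        using step[unfolded step_on_def, rule_format, OF j(1), of \<tau>] j(2,3) by simp
      ultimately show ?thesis using True by simp
    next
      case False
      then have "\<tau> < t \<or> s \<le> \<tau> \<or> s \<le> \<tau>" by auto
      from False proc_riemann_outside[OF part this, of n "\<lambda>j. p n ! j" "\<phi>s n" \<omega>] show ?thesis unfolding G_def by simp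
    qed
  qed
  have jf: "joint_meas (cut t s f)" by (rule joint_meas_cut[OF regular_joint[OF f]])
  have jd: "joint_meas (\<lambda>\<tau> \<omega>. indicator {t..<s} \<tau> * (\<phi>s n \<tau> \<omega> - f \<tau> \<omega>))" for n
    using joint_meas_diff[OF joint_meas_cut_process[OF _ s] jf, of "\<phi>s n"] H2[of n]
    by (simp add: H2_def right_diff_distrib)
  have je: "joint_meas (\<lambda>\<tau> \<omega>. indicator {t..<s} \<tau> * f \<tau> \<omega> - proc (H n) \<tau> \<omega>)" for n
    by (rule joint_meas_diff[OF jf joint_meas_proc[OF sH]])
  define d where "d n = (\<integral>\<^sup>+\<tau>\<in>{t..s}. (\<integral>\<^sup>+\<omega>. ennreal (\<bar>\<phi>s n \<tau> \<omega> - f \<tau> \<omega>\<bar>\<^sup>2 * \<rho> \<tau> \<omega>) \<partial>P) \<partial>lborel)" for n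
  define e where "e n = msd_int (proc (H n)) (cut t s f)" for n
  have d: "d \<longlonglongrightarrow> 0" using A unfolding step_approximation_def d_def by blast
  have e: "e \<longlonglongrightarrow> 0" using H unfolding approximates_def e_def by blast
  \<comment> \<open>The truncated integrand is inserted: the given step processes are close to it in
    the weighted norm, the Riemann processes in the norm of d\<tau> and therefore also in the
    weighted one.\<close>
  have bound: "msd P (sint M (G n)) (sint M (H n)) \<le> 2 * d n + (2 * ennreal K) * e n" for n
  proof -
    have "simple Martingale (G n @ scale (-1) (H n))" using sG sH by simp
    from sint_martingale_bound[OF this]
    have "msd P (sint M (G n)) (sint M (H n)) \<le> weighted (\<lambda>\<tau> \<omega>. proc (G n) \<tau> \<omega> - proc (H n) \<tau> \<omega>)"
      by (simp add: sint_append[abs_def] fun_eq_iff)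
    also have "(\<lambda>\<tau> \<omega>. proc (G n) \<tau> \<omega> - proc (H n) \<tau> \<omega>)
        = (\<lambda>\<tau> \<omega>. indicator {t..<s} \<tau> * (\<phi>s n \<tau> \<omega> - f \<tau> \<omega>) + (indicator {t..<s} \<tau> * f \<tau> \<omega> - proc (H n) \<tau> \<omega>))"
      by (simp add: procG fun_eq_iff algebra_simps)
    also have "weighted \<dots> \<le> 2 * weighted (\<lambda>\<tau> \<omega>. indicator {t..<s} \<tau> * (\<phi>s n \<tau> \<omega> - f \<tau> \<omega>))
        + 2 * weighted (\<lambda>\<tau> \<omega>. indicator {t..<s} \<tau> * f \<tau> \<omega> - proc (H n) \<tau> \<omega>)"
      by (rule weighted_add_le[OF jd je])
    also have "\<dots> \<le> 2 * d n + 2 * (ennreal K * e n)"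
      unfolding d_def e_def weighted_cut[OF s jd]
      using weighted_square_le[OF je, of n]
      by (intro add_mono mult_left_mono) (simp_all add: msq_int_minus_commute[of "proc (H n)"])
    finally show ?thesis by (simp add: mult.assoc)
  qed
  have GH: "(\<lambda>n. msd P (sint M (G n)) (sint M (H n))) \<longlonglongrightarrow> 0"
    by (rule ennreal_tendsto_0_le[OF ennreal_tendsto_0_lincomb[OF d e] bound]) (auto simp: ennreal_mult_less_top)
  have meas: "sint M (G n) \<in> borel_measurable P" "sint M (H n) \<in> borel_measurable P" for n
    using sint_meas[OF sG] sint_meas[OF sH] by auto
  have "(\<lambda>n. msd P (sint M (G n)) (J Martingale f s)) \<longlonglongrightarrow> 0"
    by (rule ennreal_tendsto_0_le[OF ennreal_tendsto_0_lincomb[OF GH H_lim] msq_triangle[OF meas J_meas[OF f s]]]) auto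
  then have "ms_tendsto P (\<lambda>n. sint M (G n)) (J Martingale f s)"
    using meas(1) SI_square[OF J_SI[OF f s]] by (simp add: ms_tendsto_iff_msq)
  then show "ms_tendsto P (\<lambda>n \<omega>. \<Sum>j<length (p n) - 1. \<phi>s n (p n ! j) \<omega> * (M (p n ! Suc j) \<omega> - M (p n ! j) \<omega>)) (J Martingale f s)"
    unfolding G_def sint_riemann_full[OF part order_refl, abs_def] .
qed

lemma J_time_integral:
  assumes f: "regular f" and s: "s \<in> {t..T}"
  shows "time_integral P f t s (J Time f s)"
  unfolding time_integral_def
proof (intro allI impI, elim conjE)
  fix p \<xi> assume p: "partition_seq t s p" and \<xi>: "\<forall>n. \<forall>j<length (p n) - 1. \<xi> n j \<in> {p n ! j..p n ! Suc j}"
  have part: "partition_on_interval t s (p n)" for n using p by (simp add: partition_seq_def)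
  have tsT: "t \<le> t" "s \<le> T" using s by auto
  define G where "G n = riemann (p n) (\<xi> n) s f" for n
  have sG: "simple Time (G n)" for n
    unfolding G_def
  proof (rule simple_riemann[OF part tsT])
    fix j assume j: "j < length (p n) - 1"
    then have "\<xi> n j \<in> {t..T}" using \<xi>[rule_format, OF j] partition_Suc_bounds[OF part j] s by auto
    then show "f (\<xi> n j) \<in> borel_measurable (alg Time (p n ! j))" by (simp add: regular_meas[OF f])
  qed
  have "approximates Time G (cut t s f)"
    unfolding approximates_def G_def
    using sG[unfolded G_def] msq_int_riemann_tendsto[OF f tsT p order_refl, of \<xi>] \<xi> by blast
  then have "(\<lambda>n. msd P (sint (Z Time) (G n)) (J Time f s)) \<longlonglongrightarrow> 0"
    using J_SI[OF f s, of Time] by (simp add: SI_def)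
  then have "ms_tendsto P (\<lambda>n. sint (Z Time) (G n)) (J Time f s)"
    using sint_meas[OF sG] SI_square[OF J_SI[OF f s]] by (simp add: ms_tendsto_iff_msq)
  then show "ms_tendsto P (\<lambda>n \<omega>. \<Sum>j<length (p n) - 1. f (\<xi> n j) \<omega> * (p n ! Suc j - p n ! j)) (J Time f s)"
    unfolding G_def sint_riemann_full[OF part order_refl, abs_def] by simp
qed

lemma J_stoch_integral:
  "regular f \<Longrightarrow> s \<in> {t..T} \<Longrightarrow> stoch_integral P F M \<rho> b f t s (J b f s)"
  using J_martingale_integral J_time_integral by (cases b) auto

text \<open>The bound on second moments comes from compactness: times at which they grow without
  limit would accumulate at a point of \<open>[t,T]\<close>, against mean-square continuity
  there.\<close>

lemma regular_of_H2_ms: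
  assumes "\<phi> \<in> H2_ms P F \<rho> t T"
  shows "regular \<phi>"
proof -
  have H2: "\<phi> \<in> H2 P F \<rho> t T" and sq: "\<And>s. s \<in> {t..T} \<Longrightarrow> square_integrable P (\<phi> s)"
    and cont: "\<And>s. s \<in> {t..T} \<Longrightarrow> ((\<lambda>\<tau>. \<integral>\<omega>. (\<phi> \<tau> \<omega> - \<phi> s \<omega>)\<^sup>2 \<partial>P) \<longlongrightarrow> 0) (at s within {t..T})"
    using assms by (auto simp: H2_ms_def ms_continuous_on_def)
  have ms: "((\<lambda>u. msd P (\<phi> u) (\<phi> s)) \<longlongrightarrow> 0) (at s within {t..T})" if s: "s \<in> {t..T}" for s
  proof -
    have "((\<lambda>u. ennreal (\<integral>\<omega>. (\<phi> u \<omega> - \<phi> s \<omega>)\<^sup>2 \<partial>P)) \<longlongrightarrow> ennreal 0) (at s within {t..T})"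
      by (intro tendsto_ennrealI cont s)
    moreover have "\<forall>\<^sub>F u in at s within {t..T}. ennreal (\<integral>\<omega>. (\<phi> u \<omega> - \<phi> s \<omega>)\<^sup>2 \<partial>P) = msd P (\<phi> u) (\<phi> s)"
      unfolding eventually_at_filter
      by (intro always_eventually allI impI msq_eq_integral[symmetric] square_integrable_diff sq s)
    ultimately show ?thesis using tendsto_cong by force
  qed
  have meas: "\<phi> s \<in> borel_measurable P" if "s \<in> {t..T}" for s using sq[OF that] by (simp add: square_integrable_def)
  have "\<exists>B. \<forall>\<tau>\<in>{t..T}. msq P (\<phi> \<tau>) \<le> ennreal B"
  proof (rule ccontr)
    assume "\<not> ?thesis"
    then have "\<forall>n::nat. \<exists>x\<in>{t..T}. ennreal (real n) < msq P (\<phi> x)" by (meson not_le)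
    then obtain x where x: "\<And>n. x n \<in> {t..T}" "\<And>n::nat. ennreal (real n) < msq P (\<phi> (x n))" by metis
    obtain l r where l: "l \<in> {t..T}" and r: "strict_mono r" "(x \<circ> r) \<longlonglongrightarrow> l"
      using compact_Icc[of t T] x(1) unfolding compact_def by blast
    have "(\<lambda>n. msd P (\<phi> ((x \<circ> r) n)) (\<phi> l)) \<longlonglongrightarrow> 0"
      by (rule msq_continuous_seq[OF ms[OF l] r(2)]) (simp only: comp_def x(1))
    then have ev1: "\<forall>\<^sub>F n in sequentially. msd P (\<phi> ((x \<circ> r) n)) (\<phi> l) < 1"
      by (rule order_tendstoD(2)) simp
    define D where "D = (\<integral>\<omega>. (\<phi> l \<omega>)\<^sup>2 \<partial>P)"
    have D: "msq P (\<phi> l) = ennreal D" "0 \<le> D" using msq_eq_integral[OF sq[OF l]] by (auto simp: D_def)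
    \<comment> \<open>Close to the accumulation point second moments are at most
      \<open>2 * 1 + 2 * D\<close>, which \<open>m\<close> is chosen to exceed.\<close>
    obtain m :: nat where m: "2 + 2 * D < real m" using reals_Archimedean2 by blast
    obtain n where n: "n \<ge> m" "msd P (\<phi> ((x \<circ> r) n)) (\<phi> l) < 1"
      using eventually_happens'[OF sequentially_bot eventually_conj[OF eventually_ge_at_top[of m] ev1]] by blast
    have "msq P (\<phi> (x (r n))) \<le> 2 * msd P (\<phi> (x (r n))) (\<phi> l) + 2 * msq P (\<phi> l)"
      using msq_add_le[of "\<lambda>\<omega>. \<phi> (x (r n)) \<omega> - \<phi> l \<omega>" P "\<phi> l"] meas[OF x(1)[of "r n"]] meas[OF l] by simp
    also have "\<dots> \<le> 2 * 1 + 2 * ennreal D"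
      using n(2) by (intro add_mono mult_left_mono) (auto simp: D(1) less_imp_le)
    also have "\<dots> = ennreal (2 + 2 * D)" using D(2) by (simp add: ennreal_mult)
    also have "\<dots> \<le> ennreal (real (r n))"
      using m n(1) seq_suble[OF r(1), of n] by (intro ennreal_leI) linarith
    finally show False using x(2)[of "r n"] by simp
  qed
  moreover have "\<exists>S. finite S \<and> (\<forall>\<tau>\<in>{t..T} - S. ms_cont_at \<phi> \<tau>)"
    using ms by (intro exI[of _ "{}"]) auto
  moreover have "joint_meas \<phi>" "\<forall>\<tau>\<in>{t..T}. \<phi> \<tau> \<in> borel_measurable (F \<tau>)"
    using H2 joint_meas_of_measurable_process by (auto simp: H2_def)
  ultimately show ?thesis by (simp add: regular_def)
qed

end

section \<open>Uniqueness of the versions\<close>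

text \<open>The integrals are limits along all admissible approximations, so a single shared one
  decides. Integrands that agree almost everywhere at each time have the same approximations against
  M, and almost surely the same sums against time.\<close>

lemma stoch_integral_unique:
  assumes X: "stoch_integral P F M \<rho> b f a s X" and Y: "stoch_integral P F M \<rho> b g a s Y" and "a \<le> s"
    and eq: "\<And>\<tau>. \<tau> \<in> {a..s} \<Longrightarrow> AE \<omega> in P. f \<tau> \<omega> = g \<tau> \<omega>"
  shows "AE \<omega> in P. X \<omega> = Y \<omega>"
proof (cases b)
  case Martingale
  have eq_int: "(\<integral>\<^sup>+\<tau>\<in>{a..s}. (\<integral>\<^sup>+\<omega>. ennreal (\<bar>\<phi> \<tau> \<omega> - f \<tau> \<omega>\<bar>\<^sup>2 * \<rho> \<tau> \<omega>) \<partial>P) \<partial>lborel)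
      = (\<integral>\<^sup>+\<tau>\<in>{a..s}. (\<integral>\<^sup>+\<omega>. ennreal (\<bar>\<phi> \<tau> \<omega> - g \<tau> \<omega>\<bar>\<^sup>2 * \<rho> \<tau> \<omega>) \<partial>P) \<partial>lborel)" for \<phi>
  proof (rule nn_integral_cong)
    fix \<tau>
    show "(\<integral>\<^sup>+\<omega>. ennreal (\<bar>\<phi> \<tau> \<omega> - f \<tau> \<omega>\<bar>\<^sup>2 * \<rho> \<tau> \<omega>) \<partial>P) * indicator {a..s} \<tau>
        = (\<integral>\<^sup>+\<omega>. ennreal (\<bar>\<phi> \<tau> \<omega> - g \<tau> \<omega>\<bar>\<^sup>2 * \<rho> \<tau> \<omega>) \<partial>P) * indicator {a..s} \<tau>"
    proof (cases "\<tau> \<in> {a..s}")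
      case True
      have "(\<integral>\<^sup>+\<omega>. ennreal (\<bar>\<phi> \<tau> \<omega> - f \<tau> \<omega>\<bar>\<^sup>2 * \<rho> \<tau> \<omega>) \<partial>P) = (\<integral>\<^sup>+\<omega>. ennreal (\<bar>\<phi> \<tau> \<omega> - g \<tau> \<omega>\<bar>\<^sup>2 * \<rho> \<tau> \<omega>) \<partial>P)"
        by (rule nn_integral_cong_AE) (use eq[OF True] in eventually_elim, simp)
      then show ?thesis by simp
    qed simp
  qed
  then have step: "step_approximation P F \<rho> a s f p \<phi>s \<longleftrightarrow> step_approximation P F \<rho> a s g p \<phi>s" for p \<phi>s
    by (simp add: step_approximation_def)
  obtain p \<phi>s where p: "step_approximation P F \<rho> a s f p \<phi>s"
    using X by (auto simp: Martingale martingale_integral_def)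
  then have "ms_tendsto P (\<lambda>n \<omega>. \<Sum>j<length (p n) - 1. \<phi>s n (p n ! j) \<omega> * (M (p n ! Suc j) \<omega> - M (p n ! j) \<omega>)) X"
    using X by (simp add: Martingale martingale_integral_def)
  moreover have "ms_tendsto P (\<lambda>n \<omega>. \<Sum>j<length (p n) - 1. \<phi>s n (p n ! j) \<omega> * (M (p n ! Suc j) \<omega> - M (p n ! j) \<omega>)) Y"
    using Y p unfolding step by (simp add: Martingale martingale_integral_def)
  ultimately show ?thesis by (rule ms_tendsto_unique) simp
next
  case Time
  obtain p where p: "partition_seq a s p" using partition_seq_exists[OF \<open>a \<le> s\<close>] .
  then have part: "partition_on_interval a s (p n)" for n by (simp add: partition_seq_def)
  have nodes: "\<forall>n. \<forall>j<length (p n) - 1. p n ! j \<in> {p n ! j..p n ! Suc j}"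
    by (simp add: less_imp_le[OF partition_nth_less[OF part]])
  have "ms_tendsto P (\<lambda>n \<omega>. \<Sum>j<length (p n) - 1. f (p n ! j) \<omega> * (p n ! Suc j - p n ! j)) X"
    "ms_tendsto P (\<lambda>n \<omega>. \<Sum>j<length (p n) - 1. g (p n ! j) \<omega> * (p n ! Suc j - p n ! j)) Y"
    using X[unfolded Time stoch_integral.simps time_integral_def, rule_format, OF conjI[OF p nodes]]
      Y[unfolded Time stoch_integral.simps time_integral_def, rule_format, OF conjI[OF p nodes]] by blast+
  then show ?thesis
  proof (rule ms_tendsto_unique)
    fix n
    have "AE \<omega> in P. \<forall>j\<in>{..<length (p n) - 1}. f (p n ! j) \<omega> = g (p n ! j) \<omega>"
      using partition_Suc_bounds(1)[OF part, of _ n] by (intro AE_finite_allI eq) auto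
    then show "AE \<omega> in P. (\<Sum>j<length (p n) - 1. f (p n ! j) \<omega> * (p n ! Suc j - p n ! j))
        = (\<Sum>j<length (p n) - 1. g (p n ! j) \<omega> * (p n ! Suc j - p n ! j))"
      by eventually_elim simp
  qed
qed

lemma iterated_integral_unique:
  assumes X: "iterated_integral P F M \<rho> t T k c \<phi> \<psi> X" and Y: "iterated_integral P F M \<rho> t T k c \<phi> \<psi> Y" and "t \<le> T"
  shows "AE \<omega> in P. X \<omega> = Y \<omega>"
proof -
  obtain I where I: "\<And>s. s \<in> {t..T} \<Longrightarrow> stoch_integral P F M \<rho> (c (k + 1)) \<phi> t s (I (k + 1) s)"
    "\<And>l s. l \<in> {1..k} \<Longrightarrow> s \<in> {t..T} \<Longrightarrow> stoch_integral P F M \<rho> (c l) (\<lambda>\<tau> \<omega>. \<psi> l \<tau> * I (l + 1) \<tau> \<omega>) t s (I l s)"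
    "X = I 1 T" using X unfolding iterated_integral_def by blast
  obtain I' where I': "\<And>s. s \<in> {t..T} \<Longrightarrow> stoch_integral P F M \<rho> (c (k + 1)) \<phi> t s (I' (k + 1) s)"
    "\<And>l s. l \<in> {1..k} \<Longrightarrow> s \<in> {t..T} \<Longrightarrow> stoch_integral P F M \<rho> (c l) (\<lambda>\<tau> \<omega>. \<psi> l \<tau> * I' (l + 1) \<tau> \<omega>) t s (I' l s)"
    "Y = I' 1 T" using Y unfolding iterated_integral_def by blast
  \<comment> \<open>Induction from the innermost integral outwards, \<open>m\<close> counting the
    integrals passed: level \<open>l\<close> is determined by level \<open>l + 1\<close>, and only
    up to null sets at each time.\<close>
  have "\<forall>s\<in>{t..T}. AE \<omega> in P. I (k + 1 - m) s \<omega> = I' (k + 1 - m) s \<omega>" if "m \<le> k" for m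
    using that
  proof (induction m)
    case 0
    show ?case
    proof
      fix s assume s: "s \<in> {t..T}"
      show "AE \<omega> in P. I (k + 1 - 0) s \<omega> = I' (k + 1 - 0) s \<omega>"
        using stoch_integral_unique[OF I(1)[OF s] I'(1)[OF s]] s by simp
    qed
  next
    case (Suc m)
    have l: "k + 1 - Suc m \<in> {1..k}" and l1: "k + 1 - Suc m + 1 = k + 1 - m" using Suc.prems by auto
    show ?case
    proof
      fix s assume s: "s \<in> {t..T}"
      show "AE \<omega> in P. I (k + 1 - Suc m) s \<omega> = I' (k + 1 - Suc m) s \<omega>"
      proof (rule stoch_integral_unique[OF I(2)[OF l s] I'(2)[OF l s]])
        fix \<tau> assume "\<tau> \<in> {t..s}"
        then have "AE \<omega> in P. I (k + 1 - m) \<tau> \<omega> = I' (k + 1 - m) \<tau> \<omega>" using Suc s by auto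
        then show "AE \<omega> in P. \<psi> (k + 1 - Suc m) \<tau> * I (k + 1 - Suc m + 1) \<tau> \<omega> = \<psi> (k + 1 - Suc m) \<tau> * I' (k + 1 - Suc m + 1) \<tau> \<omega>"
          unfolding l1 by eventually_elim simp
      qed (use s in simp)
    qed
  qed
  from this[of k] show ?thesis using \<open>t \<le> T\<close> I(3) I'(3) by simp
qed

lemma ms_partition_limit_unique:
  assumes X: "ms_partition_limit P a b S X" and Y: "ms_partition_limit P a b S' Y" and "a \<le> b"
    and eq: "\<And>p. partition_on_interval a b p \<Longrightarrow> AE \<omega> in P. S p \<omega> = S' p \<omega>"
  shows "AE \<omega> in P. X \<omega> = Y \<omega>"
proof -
  obtain p where p: "partition_seq a b p" using partition_seq_exists[OF \<open>a \<le> b\<close>] .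
  then show ?thesis
    using X Y eq unfolding ms_partition_limit_def
    by (intro ms_tendsto_unique[of P "\<lambda>n. S (p n)" X "\<lambda>n. S' (p n)" Y]) (auto simp: partition_seq_def)
qed

lemma ms_partition_limit_cong:
  assumes "\<And>p. partition_on_interval a b p \<Longrightarrow> S p = S' p"
  shows "ms_partition_limit P a b S X \<longleftrightarrow> ms_partition_limit P a b S' X"
  unfolding ms_partition_limit_def partition_seq_def using assms by (intro all_cong imp_cong refl) simp

lemma reversed_sum_AE_cong:
  fixes g h :: "real \<Rightarrow> 'a \<Rightarrow> real"
  assumes part: "partition_on_interval a b p" and "{a..b} \<subseteq> A"
    and R: "\<And>s. s \<in> A \<Longrightarrow> AE \<omega> in P. R s \<omega> = R' s \<omega>"
  shows "AE \<omega> in P. reversed_sum g h R p \<omega> = reversed_sum g h R' p \<omega>"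
proof -
  have "AE \<omega> in P. \<forall>l\<in>{..<length p - 1}. R (p ! Suc l) \<omega> = R' (p ! Suc l) \<omega>"
  proof (rule AE_finite_allI)
    fix l assume "l \<in> {..<length p - 1}"
    then show "AE \<omega> in P. R (p ! Suc l) \<omega> = R' (p ! Suc l) \<omega>"
      using partition_Suc_bounds(2)[OF part, of l] assms(2) by (intro R) auto
  qed simp
  then show ?thesis by eventually_elim simp
qed

lemma reversed_integral_unique:
  assumes X: "reversed_integral P M t T k c \<phi> \<psi> X" and Y: "reversed_integral P M t T k c \<phi> \<psi> Y" and "t \<le> T"
  shows "AE \<omega> in P. X \<omega> = Y \<omega>"
proof -
  let ?S = "\<lambda>g b. reversed_sum g (integrator_process M b)"
  obtain R where R: "\<And>s. s \<in> {t..T} \<Longrightarrow> R 0 s = (\<lambda>\<omega>. 1)"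
    "\<And>r s. r \<in> {1..k} \<Longrightarrow> s \<in> {t..T} \<Longrightarrow> ms_partition_limit P s T (?S (\<lambda>\<tau> \<omega>. \<psi> r \<tau>) (c r) (R (r - 1))) (R r s)"
    "ms_partition_limit P t T (?S \<phi> (c (k + 1)) (R k)) X"
    using X unfolding reversed_integral_def by blast
  obtain R' where R': "\<And>s. s \<in> {t..T} \<Longrightarrow> R' 0 s = (\<lambda>\<omega>. 1)"
    "\<And>r s. r \<in> {1..k} \<Longrightarrow> s \<in> {t..T} \<Longrightarrow> ms_partition_limit P s T (?S (\<lambda>\<tau> \<omega>. \<psi> r \<tau>) (c r) (R' (r - 1))) (R' r s)"
    "ms_partition_limit P t T (?S \<phi> (c (k + 1)) (R' k)) Y"
    using Y unfolding reversed_integral_def by blast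
  have RR: "\<forall>s\<in>{t..T}. AE \<omega> in P. R r s \<omega> = R' r s \<omega>" if "r \<le> k" for r
    using that
  proof (induction r)
    case 0
    then show ?case by (simp add: R(1) R'(1))
  next
    case (Suc r)
    have r: "Suc r \<in> {1..k}" using Suc.prems by simp
    show ?case
    proof
      fix s assume s: "s \<in> {t..T}"
      show "AE \<omega> in P. R (Suc r) s \<omega> = R' (Suc r) s \<omega>"
      proof (rule ms_partition_limit_unique[OF R(2)[OF r s] R'(2)[OF r s]])
        fix p assume part: "partition_on_interval s T p"
        have IH: "\<And>u. u \<in> {t..T} \<Longrightarrow> AE \<omega> in P. R r u \<omega> = R' r u \<omega>" using Suc by simp
        have sub: "{s..T} \<subseteq> {t..T}" using s by auto
        show "AE \<omega> in P. ?S (\<lambda>\<tau> \<omega>. \<psi> (Suc r) \<tau>) (c (Suc r)) (R (Suc r - 1)) p \<omega>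
            = ?S (\<lambda>\<tau> \<omega>. \<psi> (Suc r) \<tau>) (c (Suc r)) (R' (Suc r - 1)) p \<omega>"
          unfolding diff_Suc_1
          by (rule reversed_sum_AE_cong[where g = "\<lambda>\<tau> \<omega>. \<psi> (Suc r) \<tau>", OF part sub IH])
      qed (use s in simp)
    qed
  qed
  show ?thesis
  proof (rule ms_partition_limit_unique[OF R(3) R'(3) \<open>t \<le> T\<close>])
    fix p assume part: "partition_on_interval t T p"
    have kk: "\<And>u. u \<in> {t..T} \<Longrightarrow> AE \<omega> in P. R k u \<omega> = R' k u \<omega>" using RR[of k] by simp
    show "AE \<omega> in P. ?S \<phi> (c (k + 1)) (R k) p \<omega> = ?S \<phi> (c (k + 1)) (R' k) p \<omega>"
      by (rule reversed_sum_AE_cong[OF part order_refl kk])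
  qed
qed

section \<open>Existence of both integrals and their equality\<close>

theorem theorem5:
  fixes P :: "'a measure" and F :: "real \<Rightarrow> 'a measure"
    and M \<rho> \<phi> :: "real \<Rightarrow> 'a \<Rightarrow> real" and \<psi> :: "nat \<Rightarrow> real \<Rightarrow> real"
    and c :: "nat \<Rightarrow> integrator" and t T K :: real and k :: nat
  assumes "martingale_setting P F T M \<rho>"
    and "0 \<le> t" and "t < T" and "k \<ge> 1"
    and "\<phi> \<in> H2_ms P F \<rho> t T"
    and "\<And>l. l \<in> {1..k} \<Longrightarrow> continuous_on {t..T} (\<psi> l)"
    and "\<And>\<tau>. \<tau> \<in> {t..T} \<Longrightarrow> AE \<omega> in P. \<bar>\<rho> \<tau> \<omega>\<bar> \<le> K"
  shows "(\<exists>Y. reversed_integral P M t T k c \<phi> \<psi> Y) \<and>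
         (\<exists>X. iterated_integral P F M \<rho> t T k c \<phi> \<psi> X) \<and>
         (\<forall>X Y. iterated_integral P F M \<rho> t T k c \<phi> \<psi> X \<longrightarrow>
                reversed_integral P M t T k c \<phi> \<psi> Y \<longrightarrow> (AE \<omega> in P. X \<omega> = Y \<omega>))"
proof -
  \<comment> \<open>the innermost integral is treated as a further level with weight 1\<close>
  define \<psi>' where "\<psi>' = \<psi>(Suc k := \<lambda>\<tau>. 1)"
  have weights: "\<And>l. l \<in> {1..Suc k} \<Longrightarrow> continuous_on {t..T} (\<psi>' l)"
    using assms(6) by (auto simp: \<psi>'_def le_Suc_eq)
  have \<psi>': "\<psi>' l = \<psi> l" if "l \<in> {1..k}" for l using that by (auto simp: \<psi>'_def)
  interpret martingale_setting P F T M \<rho> by (rule assms(1))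
  interpret iterated_setting P F T M \<rho> t K c \<psi>' "Suc k"
    using assms(2,3,7) weights by unfold_locales auto
  have \<phi>: "regular \<phi>" by (rule regular_of_H2_ms[OF assms(5)])
  define X where "X = levels (Suc k) \<phi> T"
  have rev: "reversed_integral P M t T k c \<phi> \<psi> X"
    unfolding reversed_integral_def
  \<comment> \<open>The witness consists of forward iterated integrals over \<open>[s,T]\<close>, so
    the inner limits are again instances of the reversal.\<close>
  proof (intro exI[of _ tail] conjI ballI)
    show "tail 0 s = (\<lambda>\<omega>. 1)" if "s \<in> {t..T}" for s
      using that by (simp add: tail_def indicator_def)
    show "ms_partition_limit P s T (reversed_sum (\<lambda>\<tau> \<omega>. \<psi> r \<tau>) (Z (c r)) (tail (r - 1))) (tail r s)"
      if r: "r \<in> {1..k}" and s: "s \<in> {t..T}" for r s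
    proof -
      obtain r' where r': "r = Suc r'" using r by (cases r) auto
      have "ms_partition_limit P s T (reversed_sum (\<lambda>\<tau> \<omega>. \<psi>' (Suc r') \<tau> * indicator {s..} \<tau>) (Z (c (Suc r'))) (tail r'))
          (levels (Suc r') (\<lambda>\<tau> \<omega>. indicator {s..} \<tau>) T)"
        using r r' s by (intro reversed_sums_converge regular_indicator) auto
      then show ?thesis
        unfolding r' tail_def[of "Suc r'"]
      proof (rule ms_partition_limit_cong[THEN iffD1, rotated])
        \<comment> \<open>All nodes lie in \<open>{s..T}\<close>, where the indicator is 1, so it
          disappears from the sums.\<close>
        fix p assume part: "partition_on_interval s T p"
        show "reversed_sum (\<lambda>\<tau> \<omega>. \<psi>' (Suc r') \<tau> * indicator {s..} \<tau>) (Z (c (Suc r'))) (tail r') p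
          = reversed_sum (\<lambda>\<tau> \<omega>. \<psi> (Suc r') \<tau>) (Z (c (Suc r'))) (tail (Suc r' - 1)) p"
          using partition_Suc_bounds(1)[OF part] \<psi>'[of "Suc r'"] r r' by (intro ext sum.cong) auto
      qed
    qed
    have "ms_partition_limit P t T (reversed_sum (\<lambda>\<tau> \<omega>. \<psi>' (Suc k) \<tau> * \<phi> \<tau> \<omega>) (Z (c (Suc k))) (tail k)) (levels (Suc k) \<phi> T)"
      using t_less by (intro reversed_sums_converge \<phi>) auto
    then show "ms_partition_limit P t T (reversed_sum \<phi> (Z (c (k + 1))) (tail k)) X"
      by (simp add: X_def \<psi>'_def)
  qed
  have iter: "iterated_integral P F M \<rho> t T k c \<phi> \<psi> X"
  proof -
    \<comment> \<open>The recursion starts from the innermost process: its argument counts the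
      integrals already applied, so 0 stands for index \<open>Suc (Suc k)\<close>, and step
      \<open>m\<close> applies level \<open>Suc k - m\<close>.\<close>
    define I where "I l = rec_nat \<phi> (\<lambda>m. level (Suc k - m)) (Suc (Suc k) - l)" for l
    have I_top: "I (Suc (Suc k)) = \<phi>" by (simp add: I_def)
    have I_step: "I l = level l (I (Suc l))" if "l \<in> {1..Suc k}" for l
    proof -
      have "Suc (Suc k) - l = Suc (Suc k - l)" "Suc k - (Suc k - l) = l" using that by auto
      then show ?thesis by (simp add: I_def)
    qed
    have I_reg: "regular (I (Suc (Suc k) - m))" if "m \<le> Suc k" for m
      using that
    proof (induction m)
      case (Suc m)
      have l: "Suc (Suc k) - Suc m \<in> {1..Suc k}" "Suc (Suc (Suc k) - Suc m) = Suc (Suc k) - m" using Suc.prems by auto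
      show ?case
        using level_regular[OF l(1), of "I (Suc (Suc k) - m)"] Suc I_step[OF l(1)] unfolding l(2) by simp
    qed (simp add: I_top \<phi>)
    have reg: "regular (I l)" if "l \<in> {1..Suc (Suc k)}" for l
    proof -
      have "Suc (Suc k) - l \<le> Suc k" "Suc (Suc k) - (Suc (Suc k) - l) = l" using that by auto
      then show ?thesis using I_reg[of "Suc (Suc k) - l"] by simp
    qed
    \<comment> \<open>The \<open>l\<close> outer levels applied to \<open>I (Suc l)\<close> give the
      whole integral for every \<open>l\<close>, so induction on \<open>l\<close> moves from
      \<open>I 1\<close> to the innermost process.\<close>
    have "levels l (I (Suc l)) = I 1" if "l \<le> Suc k" for l
      using that
    proof (induction l)
      case (Suc l)
      then show ?case using I_step[of "Suc l"] by simp
    qed simp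
    from this[of "Suc k"] have X: "X = I 1 T" by (simp add: X_def I_top)
    have int: "stoch_integral P F M \<rho> (c l) (\<lambda>\<tau> \<omega>. \<psi>' l \<tau> * I (Suc l) \<tau> \<omega>) t s (I l s)"
      if "l \<in> {1..Suc k}" "s \<in> {t..T}" for l s
      unfolding I_step[OF that(1)] level_def
      using that by (intro J_stoch_integral regular_weight reg) auto
    show ?thesis
      unfolding iterated_integral_def
    proof (intro exI[of _ I] conjI ballI)
      show "stoch_integral P F M \<rho> (c (k + 1)) \<phi> t s (I (k + 1) s)" if "s \<in> {t..T}" for s
        using int[of "Suc k" s] that by (simp add: I_top \<psi>'_def)
      show "stoch_integral P F M \<rho> (c l) (\<lambda>\<tau> \<omega>. \<psi> l \<tau> * I (l + 1) \<tau> \<omega>) t s (I l s)"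
        if "l \<in> {1..k}" "s \<in> {t..T}" for l s
        using int[of l s] \<psi>'[OF that(1)] that by simp
    qed (rule X)
  qed
  have "AE \<omega> in P. X' \<omega> = Y' \<omega>"
    if X': "iterated_integral P F M \<rho> t T k c \<phi> \<psi> X'" and Y': "reversed_integral P M t T k c \<phi> \<psi> Y'" for X' Y'
  proof -
    have "AE \<omega> in P. X' \<omega> = X \<omega>" "AE \<omega> in P. X \<omega> = Y' \<omega>"
      using iterated_integral_unique[OF X' iter] reversed_integral_unique[OF rev Y'] t_less by simp_all
    then show ?thesis by eventually_elim simp
  qed
  with rev iter show ?thesis by blast
qed

end
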